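(* Suppose $G$ is faithful and conservative. The assignment $$\widetilde G(-):\Sigma(\mathcal C,\mathcal V)\longrightarrow\Sigma(G_*\mathcal C,\mathcal U),\qquad J\mapsto \widetilde G J,\quad (\widetilde G J)(x)=\{\widetilde G R\mid R\in J(x)\},$$ is an injective morphism of lattices.
   Context: Setting. $(\mathcal U,\otimes,*_{\mathcal U})$ and $(\mathcal V,\otimes,*_{\mathcal V})$ are symmetric monoidal closed categories, each satisfying (with $\mathcal W$ standing for either): (i) $\mathcal W$ is locally finitely presentable (so well-powered, with a dense generating set $\mathcal G_{\mathcal W}$ of finitely presentable objects); (ii) $\mathcal W$ is locally small as an unenriched category; (iii) as a self-enriched category, $\mathcal W$ has all small conical limits and colimits (so is tensored and cotensored over itself); (iv) finite tensor products of finitely presentable objects are finitely presentable; (v) $\mathcal W$ is regular in the sense of Barr. $G:\mathcal V\to\mathcal U$ is a lax monoidal functor with coherence morphisms $u:*_{\mathcal U}\to G( *_{\mathcal V})$, $m_{ab}:G(a)\otimes G(b)\to G(a\otimes b)$, and $G$ is right adjoint, in the 2-category of monoidal categories and lax monoidal functors, to $F:\mathcal U\to\mathcal V$, with unit $\eta:1\to GF$ and counit $\epsilon:FG\to 1$ ($F$ is then strong monoidal). $\mathcal C$ is a small $\mathcal V$-category (equivalent to one with a small set of objects). A generating family $\mathcal G_{\mathcal U}$ of finitely presentable objects is fixed, and, when $G$ is faithful and conservative, one takes $\mathcal G_{\mathcal V}=F\mathcal G_{\mathcal U}$. Base change. $G_*\mathcal X$ is the $\mathcal U$-category with the objects of the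 $\mathcal V$-category $\mathcal X$, $G_*\mathcal X(x,y)=G(\mathcal X(x,y))$, identities $G(\mathrm{id})\cdot u$, composition $G(\circ)\cdot m$. For a $\mathcal V$-functor $A$, $G_*A$ acts as $A$ on objects and by $G(A_{xy})$ on homs. Write $k(f)=G(f)\cdot u$ for $f:*_{\mathcal V}\to\mathcal X(x,y)$. The functor $\widetilde G$. The monoidal adjunction induces a $\mathcal U$-adjunction $F^{\mathcal U}:\mathcal U\leftrightarrows G_*\mathcal V:G^{\mathcal U}$, where $G^{\mathcal U}x=Gx$ and $G^{\mathcal U}_{xy}=\Phi_{(Gx)y}\circ k(\epsilon_x)^*:G(\mathcal V(x,y))\to\mathcal U(Gx,Gy)$, with $\Phi:G\mathcal V(Fx,y)\to\mathcal U(x,Gy)$ the isomorphism of hom-objects and $k(\epsilon_x)^*$ precomposition with $k(\epsilon_x)$; on underlying morphisms it acts as $f\mapsto G(f)$. The unenriched functor $\widetilde G:[\mathcal C^{\mathrm{op}},\mathcal V]\to[G_*\mathcal C^{\mathrm{op}},\mathcal U]$ is $R\mapsto G^{\mathcal U}\circ(G_*R)$ on objects and $\{\alpha_x\}\mapsto\{G^{\mathcal U}_{Ax,Bx}\circ k(\alpha_x)\}$ on morphisms $\alpha:A\Rightarrow B$. Coverages. Let $\mathcal W\in\{\mathcal U,\mathcal V\}$ and $\mathcal X$ a small $\mathcal W$-category. A monomorphism of $\mathcal W$-functors is a $\mathcal W$-natural transformation with monic components. A sieve on $x\in\mathcal X$ is a subobject (isomorphism class of monomorphisms) of $\mathcal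 X(-,x)$ in $[\mathcal X^{\mathrm{op}},\mathcal W]$. The cotensor $\{v,B\}$ of $B\in[\mathcal X^{\mathrm{op}},\mathcal W]$ by $v\in\mathcal W$ is $x\mapsto\mathcal W(v,Bx)$. A morphism $f:v\to\mathcal X(y,x)$ induces, by Yoneda, $f:\mathcal X(-,y)\to\{v,\mathcal X(-,x)\}$, and for a sieve $R$ on $x$, $R_f$ is the (pointwise) pullback of $\mathcal X(-,y)\xrightarrow{f}\{v,\mathcal X(-,x)\}\leftarrow\{v,R\}$. A $\mathcal W$-coverage $J$ on $\mathcal X$ assigns to each object $x$ a family $J(x)$ of sieves on $x$ such that: (T1) $\mathcal X(-,x)\in J(x)$ for each $x$; (T2) for any object $y$, $R\in J(x)$, and $f:g\to\mathcal X(y,x)$ with $g\in\mathcal G_{\mathcal W}$, one has $R_f\in J(y)$. $\Sigma(\mathcal X,\mathcal W)$ is the set of $\mathcal W$-coverages on $\mathcal X$, ordered by $J\subseteq K$ iff $J(x)\subseteq K(x)$ for all $x$; it is a complete lattice, with meets computed by pointwise intersection. *)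

theory Defs
  imports "HOL-Algebra.Lattice"
begin

section \<open>Size\<close>

text \<open>
  Smallness is taken with respect to a Grothendieck universe, given by a type \<open>'s\<close> whose
  cardinality is (uncountable and strongly) inaccessible: a set is small if it has fewer elements
  than \<open>'s\<close>. Up to isomorphism every small category has its objects and arrows in \<open>'s\<close>.
\<close>

definition inaccessible_universe :: "'s itself \<Rightarrow> bool" where
  "inaccessible_universe s \<longleftrightarrow>
     (card_of (UNIV :: nat set), card_of (UNIV :: 's set)) \<in> ordLess \<and>
     regularCard (card_of (UNIV :: 's set)) \<and>
     (\<forall>X :: 's set. (card_of X, card_of (UNIV :: 's set)) \<in> ordLess \<longrightarrow>
        (card_of (Pow X), card_of (UNIV :: 's set)) \<in> ordLess)"

definition small :: "'s itself \<Rightarrow> 'x set \<Rightarrow> bool" where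
  "small s X \<longleftrightarrow> (card_of X, card_of (UNIV :: 's set)) \<in> ordLess"


section \<open>Ordinary categories\<close>

record ('o, 'a) cat =
  Ob :: "'o set"
  Ar :: "'a set"
  Dom :: "'a \<Rightarrow> 'o"
  Cod :: "'a \<Rightarrow> 'o"
  idn :: "'o \<Rightarrow> 'a"
  cmp :: "'a \<Rightarrow> 'a \<Rightarrow> 'a" (infixr \<open>\<bullet>\<index>\<close> 60)

definition Hom :: "('o, 'a, 'm) cat_scheme \<Rightarrow> 'o \<Rightarrow> 'o \<Rightarrow> 'a set" where
  "Hom C x y = {f \<in> Ar C. Dom C f = x \<and> Cod C f = y}"

locale category =
  fixes C :: "('o, 'a, 'm) cat_scheme" (structure)
  assumes dom_cod: "f \<in> Ar C \<Longrightarrow> Dom C f \<in> Ob C \<and> Cod C f \<in> Ob C"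
    and idn_hom: "x \<in> Ob C \<Longrightarrow> idn C x \<in> Hom C x x"
    and cmp_hom: "f \<in> Hom C x y \<Longrightarrow> g \<in> Hom C y z \<Longrightarrow> g \<bullet> f \<in> Hom C x z"
    and cmp_idn: "f \<in> Hom C x y \<Longrightarrow> f \<bullet> idn C x = f"
    and idn_cmp: "f \<in> Hom C x y \<Longrightarrow> idn C y \<bullet> f = f"
    and cmp_assoc: "f \<in> Hom C w x \<Longrightarrow> g \<in> Hom C x y \<Longrightarrow> h \<in> Hom C y z \<Longrightarrow>
          (h \<bullet> g) \<bullet> f = h \<bullet> (g \<bullet> f)"

definition monic :: "('o, 'a, 'm) cat_scheme \<Rightarrow> 'a \<Rightarrow> bool" where
  "monic C f \<longleftrightarrow> f \<in> Ar C \<and>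
     (\<forall>x. \<forall>g \<in> Hom C x (Dom C f). \<forall>h \<in> Hom C x (Dom C f).
        f \<bullet>\<^bsub>C\<^esub> g = f \<bullet>\<^bsub>C\<^esub> h \<longrightarrow> g = h)"

definition inverse_arrows :: "('o, 'a, 'm) cat_scheme \<Rightarrow> 'a \<Rightarrow> 'a \<Rightarrow> bool" where
  "inverse_arrows C f g \<longleftrightarrow> f \<in> Ar C \<and> g \<in> Hom C (Cod C f) (Dom C f) \<and>
     g \<bullet>\<^bsub>C\<^esub> f = idn C (Dom C f) \<and> f \<bullet>\<^bsub>C\<^esub> g = idn C (Cod C f)"

definition iso :: "('o, 'a, 'm) cat_scheme \<Rightarrow> 'a \<Rightarrow> bool" where
  "iso C f \<longleftrightarrow> (\<exists>g. inverse_arrows C f g)"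

definition inv_ar :: "('o, 'a, 'm) cat_scheme \<Rightarrow> 'a \<Rightarrow> 'a" where
  "inv_ar C f = (THE g. inverse_arrows C f g)"

record ('o, 'a, 'p, 'b) functr =
  fob :: "'o \<Rightarrow> 'p"
  far :: "'a \<Rightarrow> 'b"

locale is_functor =
  source: category C + target: category D
  for C :: "('o, 'a, 'm) cat_scheme" and D :: "('p, 'b, 'n) cat_scheme"
    and F :: "('o, 'a, 'p, 'b, 'f) functr_scheme" +
  assumes fob_Ob: "x \<in> Ob C \<Longrightarrow> fob F x \<in> Ob D"
    and far_Hom: "f \<in> Hom C x y \<Longrightarrow> far F f \<in> Hom D (fob F x) (fob F y)"
    and far_idn: "x \<in> Ob C \<Longrightarrow> far F (idn C x) = idn D (fob F x)"
    and far_cmp: "f \<in> Hom C x y \<Longrightarrow> g \<in> Hom C y z \<Longrightarrow>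
          far F (g \<bullet>\<^bsub>C\<^esub> f) = far F g \<bullet>\<^bsub>D\<^esub> far F f"

definition id_functor :: "('o, 'a, 'o, 'a) functr" where
  "id_functor = \<lparr>fob = \<lambda>x. x, far = \<lambda>f. f\<rparr>"

definition comp_functor ::
  "('p, 'b, 'q, 'c, 'g) functr_scheme \<Rightarrow> ('o, 'a, 'p, 'b, 'f) functr_scheme
     \<Rightarrow> ('o, 'a, 'q, 'c) functr" where
  "comp_functor G F = \<lparr>fob = \<lambda>x. fob G (fob F x), far = \<lambda>f. far G (far F f)\<rparr>"

definition nat_trans ::
  "('o, 'a, 'm) cat_scheme \<Rightarrow> ('p, 'b, 'n) cat_scheme \<Rightarrow> ('o, 'a, 'p, 'b, 'f) functr_scheme
     \<Rightarrow> ('o, 'a, 'p, 'b, 'g) functr_scheme \<Rightarrow> ('o \<Rightarrow> 'b) \<Rightarrow> bool" where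
  "nat_trans C D S T \<alpha> \<longleftrightarrow>
     (\<forall>x \<in> Ob C. \<alpha> x \<in> Hom D (fob S x) (fob T x)) \<and>
     (\<forall>x y. \<forall>f \<in> Hom C x y. \<alpha> y \<bullet>\<^bsub>D\<^esub> far S f = far T f \<bullet>\<^bsub>D\<^esub> \<alpha> x)"

definition faithful ::
  "('o, 'a, 'm) cat_scheme \<Rightarrow> ('o, 'a, 'p, 'b, 'f) functr_scheme \<Rightarrow> bool" where
  "faithful C F \<longleftrightarrow> (\<forall>x y. inj_on (far F) (Hom C x y))"

definition conservative ::
  "('o, 'a, 'm) cat_scheme \<Rightarrow> ('p, 'b, 'n) cat_scheme \<Rightarrow> ('o, 'a, 'p, 'b, 'f) functr_scheme \<Rightarrow> bool"
  where
  "conservative C D F \<longleftrightarrow> (\<forall>f \<in> Ar C. iso D (far F f) \<longrightarrow> iso C f)"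


subsection \<open>Limits and colimits\<close>

definition is_cone ::
  "('k, 'l, 'm) cat_scheme \<Rightarrow> ('o, 'a, 'n) cat_scheme \<Rightarrow> ('k, 'l, 'o, 'a, 'f) functr_scheme
     \<Rightarrow> 'o \<Rightarrow> ('k \<Rightarrow> 'a) \<Rightarrow> bool" where
  "is_cone K C D l \<pi> \<longleftrightarrow> l \<in> Ob C \<and> (\<forall>k \<in> Ob K. \<pi> k \<in> Hom C l (fob D k)) \<and>
     (\<forall>j k. \<forall>t \<in> Hom K j k. far D t \<bullet>\<^bsub>C\<^esub> \<pi> j = \<pi> k)"

definition is_limit ::
  "('k, 'l, 'm) cat_scheme \<Rightarrow> ('o, 'a, 'n) cat_scheme \<Rightarrow> ('k, 'l, 'o, 'a, 'f) functr_scheme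
     \<Rightarrow> 'o \<Rightarrow> ('k \<Rightarrow> 'a) \<Rightarrow> bool" where
  "is_limit K C D l \<pi> \<longleftrightarrow> is_cone K C D l \<pi> \<and>
     (\<forall>l' \<pi>'. is_cone K C D l' \<pi>' \<longrightarrow>
        (\<exists>!h. h \<in> Hom C l' l \<and> (\<forall>k \<in> Ob K. \<pi> k \<bullet>\<^bsub>C\<^esub> h = \<pi>' k)))"

definition is_cocone ::
  "('k, 'l, 'm) cat_scheme \<Rightarrow> ('o, 'a, 'n) cat_scheme \<Rightarrow> ('k, 'l, 'o, 'a, 'f) functr_scheme
     \<Rightarrow> 'o \<Rightarrow> ('k \<Rightarrow> 'a) \<Rightarrow> bool" where
  "is_cocone K C D l \<iota> \<longleftrightarrow> l \<in> Ob C \<and> (\<forall>k \<in> Ob K. \<iota> k \<in> Hom C (fob D k) l) \<and>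
     (\<forall>j k. \<forall>t \<in> Hom K j k. \<iota> k \<bullet>\<^bsub>C\<^esub> far D t = \<iota> j)"

definition is_colimit ::
  "('k, 'l, 'm) cat_scheme \<Rightarrow> ('o, 'a, 'n) cat_scheme \<Rightarrow> ('k, 'l, 'o, 'a, 'f) functr_scheme
     \<Rightarrow> 'o \<Rightarrow> ('k \<Rightarrow> 'a) \<Rightarrow> bool" where
  "is_colimit K C D l \<iota> \<longleftrightarrow> is_cocone K C D l \<iota> \<and>
     (\<forall>l' \<iota>'. is_cocone K C D l' \<iota>' \<longrightarrow>
        (\<exists>!h. h \<in> Hom C l l' \<and> (\<forall>k \<in> Ob K. h \<bullet>\<^bsub>C\<^esub> \<iota> k = \<iota>' k)))"

definition small_category :: "'s itself \<Rightarrow> ('s, 's) cat \<Rightarrow> bool" where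
  "small_category s K \<longleftrightarrow> category K \<and> small s (Ob K) \<and> small s (Ar K)"

definition is_pullback ::
  "('o, 'a, 'm) cat_scheme \<Rightarrow> 'a \<Rightarrow> 'a \<Rightarrow> 'a \<Rightarrow> 'a \<Rightarrow> bool" where
  "is_pullback C p q f g \<longleftrightarrow>
     p \<in> Ar C \<and> q \<in> Hom C (Dom C p) (Dom C g) \<and>
     f \<in> Hom C (Cod C p) (Cod C g) \<and> g \<in> Ar C \<and>
     f \<bullet>\<^bsub>C\<^esub> p = g \<bullet>\<^bsub>C\<^esub> q \<and>
     (\<forall>x. \<forall>p' \<in> Hom C x (Dom C f). \<forall>q' \<in> Hom C x (Dom C g).
        f \<bullet>\<^bsub>C\<^esub> p' = g \<bullet>\<^bsub>C\<^esub> q' \<longrightarrow>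
        (\<exists>!h. h \<in> Hom C x (Dom C p) \<and> p \<bullet>\<^bsub>C\<^esub> h = p' \<and> q \<bullet>\<^bsub>C\<^esub> h = q'))"

definition is_coequalizer :: "('o, 'a, 'm) cat_scheme \<Rightarrow> 'a \<Rightarrow> 'a \<Rightarrow> 'a \<Rightarrow> bool" where
  "is_coequalizer C e f g \<longleftrightarrow>
     f \<in> Ar C \<and> g \<in> Hom C (Dom C f) (Cod C f) \<and> e \<in> Ar C \<and> Dom C e = Cod C f \<and>
     e \<bullet>\<^bsub>C\<^esub> f = e \<bullet>\<^bsub>C\<^esub> g \<and>
     (\<forall>x. \<forall>e' \<in> Hom C (Cod C f) x. e' \<bullet>\<^bsub>C\<^esub> f = e' \<bullet>\<^bsub>C\<^esub> g \<longrightarrow>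
        (\<exists>!h. h \<in> Hom C (Cod C e) x \<and> h \<bullet>\<^bsub>C\<^esub> e = e'))"

definition regular_epi :: "('o, 'a, 'm) cat_scheme \<Rightarrow> 'a \<Rightarrow> bool" where
  "regular_epi C e \<longleftrightarrow> (\<exists>f g. is_coequalizer C e f g)"

text \<open>Regularity in the sense of Barr: finite limits, coequalizers of kernel pairs, and
  pullback-stable regular epimorphisms.\<close>

definition regular_category :: "('o, 'a, 'm) cat_scheme \<Rightarrow> bool" where
  "regular_category C \<longleftrightarrow>
     (\<forall>(K :: (nat, nat) cat) (D :: (nat, nat, 'o, 'a) functr).
        category K \<and> finite (Ob K) \<and> finite (Ar K) \<and> is_functor K C D \<longrightarrow>
        (\<exists>l \<pi>. is_limit K C D l \<pi>)) \<and>
     (\<forall>f p q. is_pullback C p q f f \<longrightarrow> (\<exists>e. is_coequalizer C e p q)) \<and>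
     (\<forall>p q f e. is_pullback C p q f e \<and> regular_epi C e \<longrightarrow> regular_epi C p)"


subsection \<open>Finitely presentable objects\<close>

definition filtered :: "('k, 'l, 'm) cat_scheme \<Rightarrow> bool" where
  "filtered K \<longleftrightarrow> Ob K \<noteq> {} \<and>
     (\<forall>i \<in> Ob K. \<forall>j \<in> Ob K. \<exists>k. Hom K i k \<noteq> {} \<and> Hom K j k \<noteq> {}) \<and>
     (\<forall>i j. \<forall>s \<in> Hom K i j. \<forall>t \<in> Hom K i j. \<exists>k. \<exists>w \<in> Hom K j k.
        w \<bullet>\<^bsub>K\<^esub> s = w \<bullet>\<^bsub>K\<^esub> t)"

definition set_cat :: "('e set, 'e set \<times> 'e set \<times> ('e \<Rightarrow> 'e)) cat" where
  "set_cat = \<lparr>Ob = UNIV,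
              Ar = {(A, B, f). f \<in> A \<rightarrow>\<^sub>E B},
              Dom = (\<lambda>(A, B, f). A),
              Cod = (\<lambda>(A, B, f). B),
              idn = (\<lambda>A. (A, A, \<lambda>x \<in> A. x)),
              cmp = (\<lambda>(B, D, g) (A, B', f). (A, D, \<lambda>x \<in> A. g (f x)))\<rparr>"

definition hom_functor ::
  "('o, 'a, 'm) cat_scheme \<Rightarrow> 'o \<Rightarrow> ('o, 'a, 'a set, 'a set \<times> 'a set \<times> ('a \<Rightarrow> 'a)) functr" where
  "hom_functor C a =
     \<lparr>fob = Hom C a,
      far = (\<lambda>f. (Hom C a (Dom C f), Hom C a (Cod C f), \<lambda>h \<in> Hom C a (Dom C f). f \<bullet>\<^bsub>C\<^esub> h))\<rparr>"

definition finitely_presentable :: "'s itself \<Rightarrow> ('o, 'a, 'm) cat_scheme \<Rightarrow> 'o \<Rightarrow> bool" where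
  "finitely_presentable s C a \<longleftrightarrow> a \<in> Ob C \<and>
     (\<forall>K (D :: ('s, 's, 'o, 'a) functr) l \<iota>.
        small_category s K \<and> filtered K \<and> is_functor K C D \<and> is_colimit K C D l \<iota> \<longrightarrow>
        is_colimit K set_cat (comp_functor (hom_functor C a) D)
          (fob (hom_functor C a) l) (\<lambda>k. far (hom_functor C a) (\<iota> k)))"

definition locally_finitely_presentable :: "'s itself \<Rightarrow> ('o, 'a, 'm) cat_scheme \<Rightarrow> bool" where
  "locally_finitely_presentable s C \<longleftrightarrow>
     (\<forall>K (D :: ('s, 's, 'o, 'a) functr). small_category s K \<and> is_functor K C D \<longrightarrow>
        (\<exists>l \<iota>. is_colimit K C D l \<iota>)) \<and>
     (\<exists>A. small s A \<and> (\<forall>a \<in> A. finitely_presentable s C a) \<and>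
        (\<forall>c \<in> Ob C. \<exists>K (D :: ('s, 's, 'o, 'a) functr) \<iota>.
           small_category s K \<and> filtered K \<and> is_functor K C D \<and>
           (\<forall>k \<in> Ob K. fob D k \<in> A) \<and> is_colimit K C D c \<iota>))"

text \<open>Only the separating property is demanded of a generating family; every dense (or strong)
  generator has it.\<close>

definition fp_generating_family :: "'s itself \<Rightarrow> ('o, 'a, 'm) cat_scheme \<Rightarrow> 'o set \<Rightarrow> bool" where
  "fp_generating_family s C \<G> \<longleftrightarrow> small s \<G> \<and>
     (\<forall>g \<in> \<G>. finitely_presentable s C g) \<and>
     (\<forall>a b. \<forall>f \<in> Hom C a b. \<forall>f' \<in> Hom C a b.
        (\<forall>g \<in> \<G>. \<forall>h \<in> Hom C g a. f \<bullet>\<^bsub>C\<^esub> h = f' \<bullet>\<^bsub>C\<^esub> h) \<longrightarrow> f = f')"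


section \<open>Symmetric monoidal closed categories\<close>

record ('o, 'a) smcc = "('o, 'a) cat" +
  tob :: "'o \<Rightarrow> 'o \<Rightarrow> 'o" (infixr \<open>\<otimes>\<index>\<close> 70)
  tar :: "'a \<Rightarrow> 'a \<Rightarrow> 'a" (infixr \<open>\<odot>\<index>\<close> 70)
  unt :: "'o" (\<open>\<one>\<index>\<close>)
  asc :: "'o \<Rightarrow> 'o \<Rightarrow> 'o \<Rightarrow> 'a"
  lun :: "'o \<Rightarrow> 'a"
  run :: "'o \<Rightarrow> 'a"
  swp :: "'o \<Rightarrow> 'o \<Rightarrow> 'a"
  ihm :: "'o \<Rightarrow> 'o \<Rightarrow> 'o"
  evl :: "'o \<Rightarrow> 'o \<Rightarrow> 'a"

locale monoidal_category = category V
  for V :: "('o, 'a, 'm) smcc_scheme" (structure) +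
  assumes unt_Ob: "\<one> \<in> Ob V"
    and tob_Ob: "a \<in> Ob V \<Longrightarrow> b \<in> Ob V \<Longrightarrow> a \<otimes> b \<in> Ob V"
    and tar_Hom: "f \<in> Hom V a b \<Longrightarrow> g \<in> Hom V c d \<Longrightarrow> f \<odot> g \<in> Hom V (a \<otimes> c) (b \<otimes> d)"
    and tar_idn: "a \<in> Ob V \<Longrightarrow> b \<in> Ob V \<Longrightarrow> idn V a \<odot> idn V b = idn V (a \<otimes> b)"
    and tar_cmp: "f \<in> Hom V a b \<Longrightarrow> f' \<in> Hom V b c \<Longrightarrow> g \<in> Hom V a' b' \<Longrightarrow> g' \<in> Hom V b' c' \<Longrightarrow>
          (f' \<bullet> f) \<odot> (g' \<bullet> g) = (f' \<odot> g') \<bullet> (f \<odot> g)"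
    and asc_Hom: "a \<in> Ob V \<Longrightarrow> b \<in> Ob V \<Longrightarrow> c \<in> Ob V \<Longrightarrow>
          asc V a b c \<in> Hom V ((a \<otimes> b) \<otimes> c) (a \<otimes> (b \<otimes> c))"
    and asc_iso: "a \<in> Ob V \<Longrightarrow> b \<in> Ob V \<Longrightarrow> c \<in> Ob V \<Longrightarrow> iso V (asc V a b c)"
    and asc_nat: "f \<in> Hom V a a' \<Longrightarrow> g \<in> Hom V b b' \<Longrightarrow> h \<in> Hom V c c' \<Longrightarrow>
          asc V a' b' c' \<bullet> ((f \<odot> g) \<odot> h) = (f \<odot> (g \<odot> h)) \<bullet> asc V a b c"
    and lun_Hom: "a \<in> Ob V \<Longrightarrow> lun V a \<in> Hom V (\<one> \<otimes> a) a"
    and lun_iso: "a \<in> Ob V \<Longrightarrow> iso V (lun V a)"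
    and lun_nat: "f \<in> Hom V a b \<Longrightarrow> lun V b \<bullet> (idn V \<one> \<odot> f) = f \<bullet> lun V a"
    and run_Hom: "a \<in> Ob V \<Longrightarrow> run V a \<in> Hom V (a \<otimes> \<one>) a"
    and run_iso: "a \<in> Ob V \<Longrightarrow> iso V (run V a)"
    and run_nat: "f \<in> Hom V a b \<Longrightarrow> run V b \<bullet> (f \<odot> idn V \<one>) = f \<bullet> run V a"
    and triangle: "a \<in> Ob V \<Longrightarrow> b \<in> Ob V \<Longrightarrow>
          (idn V a \<odot> lun V b) \<bullet> asc V a \<one> b = run V a \<odot> idn V b"
    and pentagon: "a \<in> Ob V \<Longrightarrow> b \<in> Ob V \<Longrightarrow> c \<in> Ob V \<Longrightarrow> d \<in> Ob V \<Longrightarrow>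
          asc V a b (c \<otimes> d) \<bullet> asc V (a \<otimes> b) c d =
          (idn V a \<odot> asc V b c d) \<bullet> asc V a (b \<otimes> c) d \<bullet> (asc V a b c \<odot> idn V d)"

locale symmetric_monoidal_category = monoidal_category +
  assumes swp_Hom: "a \<in> Ob V \<Longrightarrow> b \<in> Ob V \<Longrightarrow> swp V a b \<in> Hom V (a \<otimes> b) (b \<otimes> a)"
    and swp_nat: "f \<in> Hom V a a' \<Longrightarrow> g \<in> Hom V b b' \<Longrightarrow>
          swp V a' b' \<bullet> (f \<odot> g) = (g \<odot> f) \<bullet> swp V a b"
    and swp_swp: "a \<in> Ob V \<Longrightarrow> b \<in> Ob V \<Longrightarrow> swp V b a \<bullet> swp V a b = idn V (a \<otimes> b)"
    and hexagon: "a \<in> Ob V \<Longrightarrow> b \<in> Ob V \<Longrightarrow> c \<in> Ob V \<Longrightarrow>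
          asc V b c a \<bullet> swp V a (b \<otimes> c) \<bullet> asc V a b c =
          (idn V b \<odot> swp V a c) \<bullet> asc V b a c \<bullet> (swp V a b \<odot> idn V c)"

locale symmetric_monoidal_closed_category = symmetric_monoidal_category +
  assumes ihm_Ob: "a \<in> Ob V \<Longrightarrow> b \<in> Ob V \<Longrightarrow> ihm V a b \<in> Ob V"
    and evl_Hom: "a \<in> Ob V \<Longrightarrow> b \<in> Ob V \<Longrightarrow> evl V a b \<in> Hom V (ihm V a b \<otimes> a) b"
    and evl_univ: "a \<in> Ob V \<Longrightarrow> b \<in> Ob V \<Longrightarrow> c \<in> Ob V \<Longrightarrow> f \<in> Hom V (c \<otimes> a) b \<Longrightarrow>
          \<exists>!g. g \<in> Hom V c (ihm V a b) \<and> evl V a b \<bullet> (g \<odot> idn V a) = f"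

definition cur :: "('o, 'a, 'm) smcc_scheme \<Rightarrow> 'o \<Rightarrow> 'o \<Rightarrow> 'o \<Rightarrow> 'a \<Rightarrow> 'a" where
  "cur V c a b f =
     (THE g. g \<in> Hom V c (ihm V a b) \<and> evl V a b \<bullet>\<^bsub>V\<^esub> (g \<odot>\<^bsub>V\<^esub> idn V a) = f)"

text \<open>Arrows \<open>a \<rightarrow> b\<close> correspond to elements \<open>\<one> \<rightarrow> [a, b]\<close>: \<open>nam\<close> and \<open>unnam\<close> are mutually inverse.\<close>

definition nam :: "('o, 'a, 'm) smcc_scheme \<Rightarrow> 'o \<Rightarrow> 'o \<Rightarrow> 'a \<Rightarrow> 'a" where
  "nam V a b f = cur V \<one>\<^bsub>V\<^esub> a b (f \<bullet>\<^bsub>V\<^esub> lun V a)"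

definition unnam :: "('o, 'a, 'm) smcc_scheme \<Rightarrow> 'o \<Rightarrow> 'o \<Rightarrow> 'a \<Rightarrow> 'a" where
  "unnam V a b e = evl V a b \<bullet>\<^bsub>V\<^esub> (e \<odot>\<^bsub>V\<^esub> idn V a) \<bullet>\<^bsub>V\<^esub> inv_ar V (lun V a)"


subsection \<open>Lax monoidal functors and monoidal adjunctions\<close>

record ('o, 'a, 'p, 'b) lax_functr = "('o, 'a, 'p, 'b) functr" +
  lxu :: "'b"
  lxm :: "'o \<Rightarrow> 'o \<Rightarrow> 'b"

locale lax_monoidal_functor =
  is_functor V U G + V: monoidal_category V + U: monoidal_category U
  for V :: "('o, 'a, 'm) smcc_scheme" and U :: "('p, 'b, 'n) smcc_scheme"
    and G :: "('o, 'a, 'p, 'b, 'f) lax_functr_scheme" +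
  assumes lxu_Hom: "lxu G \<in> Hom U \<one>\<^bsub>U\<^esub> (fob G \<one>\<^bsub>V\<^esub>)"
    and lxm_Hom: "a \<in> Ob V \<Longrightarrow> b \<in> Ob V \<Longrightarrow>
          lxm G a b \<in> Hom U (fob G a \<otimes>\<^bsub>U\<^esub> fob G b) (fob G (a \<otimes>\<^bsub>V\<^esub> b))"
    and lxm_nat: "f \<in> Hom V a a' \<Longrightarrow> g \<in> Hom V b b' \<Longrightarrow>
          lxm G a' b' \<bullet>\<^bsub>U\<^esub> (far G f \<odot>\<^bsub>U\<^esub> far G g) = far G (f \<odot>\<^bsub>V\<^esub> g) \<bullet>\<^bsub>U\<^esub> lxm G a b"
    and lax_assoc: "a \<in> Ob V \<Longrightarrow> b \<in> Ob V \<Longrightarrow> c \<in> Ob V \<Longrightarrow>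
          far G (asc V a b c) \<bullet>\<^bsub>U\<^esub> lxm G (a \<otimes>\<^bsub>V\<^esub> b) c \<bullet>\<^bsub>U\<^esub> (lxm G a b \<odot>\<^bsub>U\<^esub> idn U (fob G c)) =
          lxm G a (b \<otimes>\<^bsub>V\<^esub> c) \<bullet>\<^bsub>U\<^esub> (idn U (fob G a) \<odot>\<^bsub>U\<^esub> lxm G b c)
            \<bullet>\<^bsub>U\<^esub> asc U (fob G a) (fob G b) (fob G c)"
    and lax_lunit: "a \<in> Ob V \<Longrightarrow>
          far G (lun V a) \<bullet>\<^bsub>U\<^esub> lxm G \<one>\<^bsub>V\<^esub> a \<bullet>\<^bsub>U\<^esub> (lxu G \<odot>\<^bsub>U\<^esub> idn U (fob G a)) = lun U (fob G a)"
    and lax_runit: "a \<in> Ob V \<Longrightarrow>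
          far G (run V a) \<bullet>\<^bsub>U\<^esub> lxm G a \<one>\<^bsub>V\<^esub> \<bullet>\<^bsub>U\<^esub> (idn U (fob G a) \<odot>\<^bsub>U\<^esub> lxu G) = run U (fob G a)"

definition id_lax :: "('o, 'a, 'm) smcc_scheme \<Rightarrow> ('o, 'a, 'o, 'a) lax_functr" where
  "id_lax V = \<lparr>fob = \<lambda>x. x, far = \<lambda>f. f, lxu = idn V \<one>\<^bsub>V\<^esub>, lxm = \<lambda>a b. idn V (a \<otimes>\<^bsub>V\<^esub> b)\<rparr>"

definition comp_lax ::
  "('q, 'c, 'm) smcc_scheme \<Rightarrow> ('p, 'b, 'q, 'c, 'g) lax_functr_scheme
     \<Rightarrow> ('o, 'a, 'p, 'b, 'f) lax_functr_scheme \<Rightarrow> ('o, 'a, 'q, 'c) lax_functr" where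
  "comp_lax W G F =
     \<lparr>fob = \<lambda>x. fob G (fob F x), far = \<lambda>f. far G (far F f),
      lxu = far G (lxu F) \<bullet>\<^bsub>W\<^esub> lxu G,
      lxm = \<lambda>a b. far G (lxm F a b) \<bullet>\<^bsub>W\<^esub> lxm G (fob F a) (fob F b)\<rparr>"

definition monoidal_nat_trans ::
  "('o, 'a, 'm) smcc_scheme \<Rightarrow> ('p, 'b, 'n) smcc_scheme \<Rightarrow> ('o, 'a, 'p, 'b, 'f) lax_functr_scheme
     \<Rightarrow> ('o, 'a, 'p, 'b, 'g) lax_functr_scheme \<Rightarrow> ('o \<Rightarrow> 'b) \<Rightarrow> bool" where
  "monoidal_nat_trans V W S T \<alpha> \<longleftrightarrow> nat_trans V W S T \<alpha> \<and>
     \<alpha> \<one>\<^bsub>V\<^esub> \<bullet>\<^bsub>W\<^esub> lxu S = lxu T \<and>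
     (\<forall>a \<in> Ob V. \<forall>b \<in> Ob V.
        \<alpha> (a \<otimes>\<^bsub>V\<^esub> b) \<bullet>\<^bsub>W\<^esub> lxm S a b = lxm T a b \<bullet>\<^bsub>W\<^esub> (\<alpha> a \<odot>\<^bsub>W\<^esub> \<alpha> b))"

text \<open>An adjunction \<open>F \<stileturn> G\<close> in the 2-category of monoidal categories, lax monoidal functors and
  monoidal transformations.\<close>

locale monoidal_adjunction =
  F: lax_monoidal_functor U V F + G: lax_monoidal_functor V U G
  for U :: "('p, 'b, 'n) smcc_scheme" and V :: "('o, 'a, 'm) smcc_scheme"
    and F :: "('p, 'b, 'o, 'a) lax_functr" and G :: "('o, 'a, 'p, 'b) lax_functr"
    and \<eta> :: "'p \<Rightarrow> 'b" and \<epsilon> :: "'o \<Rightarrow> 'a" +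
  assumes unit: "monoidal_nat_trans U U (id_lax U) (comp_lax U G F) \<eta>"
    and counit: "monoidal_nat_trans V V (comp_lax V F G) (id_lax V) \<epsilon>"
    and triangle_F: "x \<in> Ob U \<Longrightarrow> \<epsilon> (fob F x) \<bullet>\<^bsub>V\<^esub> far F (\<eta> x) = idn V (fob F x)"
    and triangle_G: "y \<in> Ob V \<Longrightarrow> far G (\<epsilon> y) \<bullet>\<^bsub>U\<^esub> \<eta> (fob G y) = idn U (fob G y)"


section \<open>Enriched categories\<close>

record ('c, 'o, 'a) vcat =
  vOb :: "'c set"
  vHom :: "'c \<Rightarrow> 'c \<Rightarrow> 'o"
  vId :: "'c \<Rightarrow> 'a"
  vCmp :: "'c \<Rightarrow> 'c \<Rightarrow> 'c \<Rightarrow> 'a" \<comment> \<open>\<open>vCmp x y z : X(y,z) \<otimes> X(x,y) \<rightarrow> X(x,z)\<close>\<close>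

locale vcategory = monoidal_category V
  for V :: "('o, 'a, 'm) smcc_scheme" (structure) and X :: "('c, 'o, 'a) vcat" +
  assumes vHom_Ob: "x \<in> vOb X \<Longrightarrow> y \<in> vOb X \<Longrightarrow> vHom X x y \<in> Ob V"
    and vId_Hom: "x \<in> vOb X \<Longrightarrow> vId X x \<in> Hom V \<one> (vHom X x x)"
    and vCmp_Hom: "x \<in> vOb X \<Longrightarrow> y \<in> vOb X \<Longrightarrow> z \<in> vOb X \<Longrightarrow>
          vCmp X x y z \<in> Hom V (vHom X y z \<otimes> vHom X x y) (vHom X x z)"
    and vCmp_vId: "x \<in> vOb X \<Longrightarrow> y \<in> vOb X \<Longrightarrow>
          vCmp X x x y \<bullet> (idn V (vHom X x y) \<odot> vId X x) = run V (vHom X x y)"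
    and vId_vCmp: "x \<in> vOb X \<Longrightarrow> y \<in> vOb X \<Longrightarrow>
          vCmp X x y y \<bullet> (vId X y \<odot> idn V (vHom X x y)) = lun V (vHom X x y)"
    and vCmp_assoc: "w \<in> vOb X \<Longrightarrow> x \<in> vOb X \<Longrightarrow> y \<in> vOb X \<Longrightarrow> z \<in> vOb X \<Longrightarrow>
          vCmp X w x z \<bullet> (vCmp X x y z \<odot> idn V (vHom X w x)) =
          vCmp X w y z \<bullet> (idn V (vHom X y z) \<odot> vCmp X w x y)
            \<bullet> asc V (vHom X y z) (vHom X x y) (vHom X w x)"

definition vop :: "('o, 'a, 'm) smcc_scheme \<Rightarrow> ('c, 'o, 'a) vcat \<Rightarrow> ('c, 'o, 'a) vcat" where
  "vop V X = \<lparr>vOb = vOb X, vHom = \<lambda>x y. vHom X y x, vId = vId X,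
     vCmp = \<lambda>x y z. vCmp X z y x \<bullet>\<^bsub>V\<^esub> swp V (vHom X z y) (vHom X y x)\<rparr>"

definition self_enriched :: "('o, 'a, 'm) smcc_scheme \<Rightarrow> ('o, 'o, 'a) vcat" where
  "self_enriched V = \<lparr>vOb = Ob V, vHom = ihm V, vId = \<lambda>a. nam V a a (idn V a),
     vCmp = \<lambda>a b c. cur V (ihm V b c \<otimes>\<^bsub>V\<^esub> ihm V a b) a c
       (evl V b c \<bullet>\<^bsub>V\<^esub> (idn V (ihm V b c) \<odot>\<^bsub>V\<^esub> evl V a b)
          \<bullet>\<^bsub>V\<^esub> asc V (ihm V b c) (ihm V a b) a)\<rparr>"

text \<open>Composition of elements \<open>f : \<one> \<rightarrow> X(x,y)\<close> and \<open>g : \<one> \<rightarrow> X(y,z)\<close>.\<close>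

definition elcmp ::
  "('o, 'a, 'm) smcc_scheme \<Rightarrow> ('c, 'o, 'a) vcat \<Rightarrow> 'c \<Rightarrow> 'c \<Rightarrow> 'c \<Rightarrow> 'a \<Rightarrow> 'a \<Rightarrow> 'a" where
  "elcmp V X x y z g f = vCmp X x y z \<bullet>\<^bsub>V\<^esub> (g \<odot>\<^bsub>V\<^esub> f) \<bullet>\<^bsub>V\<^esub> inv_ar V (lun V \<one>\<^bsub>V\<^esub>)"

definition underlying ::
  "('o, 'a, 'm) smcc_scheme \<Rightarrow> ('c, 'o, 'a) vcat \<Rightarrow> ('c, 'c \<times> 'c \<times> 'a) cat" where
  "underlying V X =
     \<lparr>Ob = vOb X,
      Ar = {(x, y, f). x \<in> vOb X \<and> y \<in> vOb X \<and> f \<in> Hom V \<one>\<^bsub>V\<^esub> (vHom X x y)},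
      Dom = (\<lambda>(x, y, f). x),
      Cod = (\<lambda>(x, y, f). y),
      idn = (\<lambda>x. (x, x, vId X x)),
      cmp = (\<lambda>(y, z, g) (x, y', f). (x, z, elcmp V X x y z g f))\<rparr>"


subsection \<open>Enriched functors and natural transformations\<close>

record ('c, 'd, 'a) vfunctr =
  vfo :: "'c \<Rightarrow> 'd"
  vfa :: "'c \<Rightarrow> 'c \<Rightarrow> 'a"

locale vfunctor =
  source: vcategory V X + target: vcategory V Y
  for V :: "('o, 'a, 'm) smcc_scheme" (structure) and X :: "('c, 'o, 'a) vcat"
    and Y :: "('d, 'o, 'a) vcat" and T :: "('c, 'd, 'a) vfunctr" +
  assumes vfo_Ob: "x \<in> vOb X \<Longrightarrow> vfo T x \<in> vOb Y"
    and vfa_Hom: "x \<in> vOb X \<Longrightarrow> y \<in> vOb X \<Longrightarrow>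
          vfa T x y \<in> Hom V (vHom X x y) (vHom Y (vfo T x) (vfo T y))"
    and vfa_vId: "x \<in> vOb X \<Longrightarrow> vfa T x x \<bullet> vId X x = vId Y (vfo T x)"
    and vfa_vCmp: "x \<in> vOb X \<Longrightarrow> y \<in> vOb X \<Longrightarrow> z \<in> vOb X \<Longrightarrow>
          vfa T x z \<bullet> vCmp X x y z =
          vCmp Y (vfo T x) (vfo T y) (vfo T z) \<bullet> (vfa T y z \<odot> vfa T x y)"

definition id_vfunctor ::
  "('o, 'a, 'm) smcc_scheme \<Rightarrow> ('c, 'o, 'a) vcat \<Rightarrow> ('c, 'c, 'a) vfunctr" where
  "id_vfunctor V X = \<lparr>vfo = \<lambda>x. x, vfa = \<lambda>x y. idn V (vHom X x y)\<rparr>"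

definition comp_vfunctor ::
  "('o, 'a, 'm) smcc_scheme \<Rightarrow> ('d, 'e, 'a) vfunctr \<Rightarrow> ('c, 'd, 'a) vfunctr
     \<Rightarrow> ('c, 'e, 'a) vfunctr" where
  "comp_vfunctor V T S =
     \<lparr>vfo = \<lambda>x. vfo T (vfo S x),
      vfa = \<lambda>x y. vfa T (vfo S x) (vfo S y) \<bullet>\<^bsub>V\<^esub> vfa S x y\<rparr>"

definition vnat ::
  "('o, 'a, 'm) smcc_scheme \<Rightarrow> ('c, 'o, 'a) vcat \<Rightarrow> ('d, 'o, 'a) vcat
     \<Rightarrow> ('c, 'd, 'a) vfunctr \<Rightarrow> ('c, 'd, 'a) vfunctr \<Rightarrow> ('c \<Rightarrow> 'a) \<Rightarrow> bool" where
  "vnat V X Y S T \<alpha> \<longleftrightarrow>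
     (\<forall>x \<in> vOb X. \<alpha> x \<in> Hom V \<one>\<^bsub>V\<^esub> (vHom Y (vfo S x) (vfo T x))) \<and>
     (\<forall>x \<in> vOb X. \<forall>y \<in> vOb X.
        vCmp Y (vfo S x) (vfo S y) (vfo T y) \<bullet>\<^bsub>V\<^esub> (\<alpha> y \<odot>\<^bsub>V\<^esub> vfa S x y)
          \<bullet>\<^bsub>V\<^esub> inv_ar V (lun V (vHom X x y)) =
        vCmp Y (vfo S x) (vfo T x) (vfo T y) \<bullet>\<^bsub>V\<^esub> (vfa T x y \<odot>\<^bsub>V\<^esub> \<alpha> x)
          \<bullet>\<^bsub>V\<^esub> inv_ar V (run V (vHom X x y)))"

definition vnat_iso ::
  "('o, 'a, 'm) smcc_scheme \<Rightarrow> ('c, 'o, 'a) vcat \<Rightarrow> ('d, 'o, 'a) vcat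
     \<Rightarrow> ('c, 'd, 'a) vfunctr \<Rightarrow> ('c, 'd, 'a) vfunctr \<Rightarrow> ('c \<Rightarrow> 'a) \<Rightarrow> bool" where
  "vnat_iso V X Y S T \<alpha> \<longleftrightarrow> vnat V X Y S T \<alpha> \<and>
     (\<exists>\<beta>. vnat V X Y T S \<beta> \<and>
        (\<forall>x \<in> vOb X.
           elcmp V Y (vfo S x) (vfo T x) (vfo S x) (\<beta> x) (\<alpha> x) = vId Y (vfo S x) \<and>
           elcmp V Y (vfo T x) (vfo S x) (vfo T x) (\<alpha> x) (\<beta> x) = vId Y (vfo T x)))"

definition vequivalent ::
  "('o, 'a, 'm) smcc_scheme \<Rightarrow> ('c, 'o, 'a) vcat \<Rightarrow> ('d, 'o, 'a) vcat \<Rightarrow> bool" where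
  "vequivalent V X Y \<longleftrightarrow>
     (\<exists>S T \<alpha> \<beta>. vfunctor V X Y S \<and> vfunctor V Y X T \<and>
        vnat_iso V X X (id_vfunctor V X) (comp_vfunctor V T S) \<alpha> \<and>
        vnat_iso V Y Y (comp_vfunctor V S T) (id_vfunctor V Y) \<beta>)"

definition small_vcategory ::
  "'s itself \<Rightarrow> ('o, 'a, 'm) smcc_scheme \<Rightarrow> ('c, 'o, 'a) vcat \<Rightarrow> bool" where
  "small_vcategory s V X \<longleftrightarrow> vcategory V X \<and>
     (\<exists>Y :: ('s, 'o, 'a) vcat. vcategory V Y \<and> small s (vOb Y) \<and> vequivalent V X Y)"

text \<open>The covariant representable \<open>X(x,-)\<close>; the contravariant one \<open>X(-,x)\<close> is
  \<open>representable V (vop V X) x\<close>.\<close>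

definition representable ::
  "('o, 'a, 'm) smcc_scheme \<Rightarrow> ('c, 'o, 'a) vcat \<Rightarrow> 'c \<Rightarrow> ('c, 'o, 'a) vfunctr" where
  "representable V X x =
     \<lparr>vfo = vHom X x,
      vfa = \<lambda>y z. cur V (vHom X y z) (vHom X x y) (vHom X x z) (vCmp X x y z)\<rparr>"


subsection \<open>Conical limits\<close>

text \<open>The ordinary functor \<open>X(x,-)\<close> from the underlying category of \<open>X\<close> to \<open>V\<close>.\<close>

definition underlying_hom ::
  "('o, 'a, 'm) smcc_scheme \<Rightarrow> ('c, 'o, 'a) vcat \<Rightarrow> 'c \<Rightarrow> ('c, 'c \<times> 'c \<times> 'a, 'o, 'a) functr" where
  "underlying_hom V X x =
     \<lparr>fob = vHom X x,
      far = (\<lambda>(y, z, f). vCmp X x y z \<bullet>\<^bsub>V\<^esub> (f \<odot>\<^bsub>V\<^esub> idn V (vHom X x y))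
                           \<bullet>\<^bsub>V\<^esub> inv_ar V (lun V (vHom X x y)))\<rparr>"

definition is_conical_limit ::
  "('k, 'l, 'n) cat_scheme \<Rightarrow> ('o, 'a, 'm) smcc_scheme \<Rightarrow> ('c, 'o, 'a) vcat
     \<Rightarrow> ('k, 'l, 'c, 'c \<times> 'c \<times> 'a) functr \<Rightarrow> 'c \<Rightarrow> ('k \<Rightarrow> 'c \<times> 'c \<times> 'a) \<Rightarrow> bool" where
  "is_conical_limit K V X D l \<pi> \<longleftrightarrow> is_cone K (underlying V X) D l \<pi> \<and>
     (\<forall>x \<in> vOb X. is_limit K V (comp_functor (underlying_hom V X x) D)
        (vHom X x l) (\<lambda>k. far (underlying_hom V X x) (\<pi> k)))"

definition has_small_conical_limits ::
  "'s itself \<Rightarrow> ('o, 'a, 'm) smcc_scheme \<Rightarrow> ('c, 'o, 'a) vcat \<Rightarrow> bool" where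
  "has_small_conical_limits s V X \<longleftrightarrow>
     (\<forall>K (D :: ('s, 's, 'c, 'c \<times> 'c \<times> 'a) functr).
        small_category s K \<and> is_functor K (underlying V X) D \<longrightarrow>
        (\<exists>l \<pi>. is_conical_limit K V X D l \<pi>))"

definition has_small_conical_colimits ::
  "'s itself \<Rightarrow> ('o, 'a, 'm) smcc_scheme \<Rightarrow> ('c, 'o, 'a) vcat \<Rightarrow> bool" where
  "has_small_conical_colimits s V X \<longleftrightarrow> has_small_conical_limits s V (vop V X)"


subsection \<open>Standing assumptions on the enriching categories\<close>

definition enriching_base :: "'s itself \<Rightarrow> ('o, 'a, 'm) smcc_scheme \<Rightarrow> bool" where
  "enriching_base s W \<longleftrightarrow>
     symmetric_monoidal_closed_category W \<and>
     locally_finitely_presentable s W \<and>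
     (\<forall>x \<in> Ob W. \<forall>y \<in> Ob W. small s (Hom W x y)) \<and>
     has_small_conical_limits s W (self_enriched W) \<and>
     has_small_conical_colimits s W (self_enriched W) \<and>
     finitely_presentable s W \<one>\<^bsub>W\<^esub> \<and>
     (\<forall>a b. finitely_presentable s W a \<and> finitely_presentable s W b \<longrightarrow>
        finitely_presentable s W (a \<otimes>\<^bsub>W\<^esub> b)) \<and>
     regular_category W"


section \<open>Sieves and coverages\<close>

text \<open>
  Presheaves on a \<open>W\<close>-category \<open>X\<close> are \<open>W\<close>-functors on its opposite, and the opposite \<open>Y\<close> is
  the parameter of all definitions in this section: objects \<open>x\<close> of \<open>Y\<close> are those of \<open>X\<close>,
  \<open>vHom Y x y\<close> is \<open>X(y,x)\<close>, and \<open>representable W Y x\<close> is \<open>X(-,x)\<close>. Sieves and coverages on \<open>C\<close>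
  are obtained for \<open>Y = vop V C\<close>. For \<open>G\<^sub>*C\<close> the relevant opposite is \<open>G\<^sub>*(C\<^sup>o\<^sup>p)\<close>, the domain of
  \<open>G\<^sub>*R\<close> for a presheaf \<open>R\<close> on \<open>C\<close>; it coincides with \<open>(G\<^sub>*C)\<^sup>o\<^sup>p\<close> when \<open>G\<close> respects the symmetries
  (lemma \<open>base_change_vop\<close> below), which is not required of a lax monoidal functor.
\<close>

type_synonym ('c, 'o, 'a) presheaf_mono = "('c, 'o, 'a) vfunctr \<times> ('c \<Rightarrow> 'a)"

definition mono_into_rep ::
  "('o, 'a, 'm) smcc_scheme \<Rightarrow> ('c, 'o, 'a) vcat \<Rightarrow> 'c \<Rightarrow> ('c, 'o, 'a) presheaf_mono \<Rightarrow> bool" where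
  "mono_into_rep W Y x = (\<lambda>(R, m).
     vfunctor W Y (self_enriched W) R \<and>
     vnat W Y (self_enriched W) R (representable W Y x) m \<and>
     (\<forall>y \<in> vOb Y. monic W (unnam W (vfo R y) (vHom Y x y) (m y))))"

definition mono_equiv ::
  "('o, 'a, 'm) smcc_scheme \<Rightarrow> ('c, 'o, 'a) vcat \<Rightarrow> 'c \<Rightarrow> ('c, 'o, 'a) presheaf_mono
     \<Rightarrow> ('c, 'o, 'a) presheaf_mono \<Rightarrow> bool" where
  "mono_equiv W Y x = (\<lambda>(R, m) (S, n).
     mono_into_rep W Y x (R, m) \<and> mono_into_rep W Y x (S, n) \<and>
     (\<exists>i. vnat_iso W Y (self_enriched W) R S i \<and>
        (\<forall>y \<in> vOb Y.
           elcmp W (self_enriched W) (vfo R y) (vfo S y) (vHom Y x y) (n y) (i y) = m y)))"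

definition sieves ::
  "('o, 'a, 'm) smcc_scheme \<Rightarrow> ('c, 'o, 'a) vcat \<Rightarrow> 'c \<Rightarrow> ('c, 'o, 'a) presheaf_mono set set" where
  "sieves W Y x = {{s. mono_equiv W Y x r s} | r. mono_into_rep W Y x r}"

definition maximal_sieve ::
  "('o, 'a, 'm) smcc_scheme \<Rightarrow> ('c, 'o, 'a) vcat \<Rightarrow> 'c \<Rightarrow> ('c, 'o, 'a) presheaf_mono set" where
  "maximal_sieve W Y x =
     {s. mono_equiv W Y x (representable W Y x, \<lambda>y. nam W (vHom Y x y) (vHom Y x y) (idn W (vHom Y x y))) s}"

definition cotensor ::
  "('o, 'a, 'm) smcc_scheme \<Rightarrow> 'o \<Rightarrow> ('c, 'o, 'a) vfunctr \<Rightarrow> ('c, 'o, 'a) vfunctr" where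
  "cotensor W v B = comp_vfunctor W (representable W (self_enriched W) v) B"

definition cotensor_map ::
  "('o, 'a, 'm) smcc_scheme \<Rightarrow> 'o \<Rightarrow> ('c, 'o, 'a) vfunctr \<Rightarrow> ('c, 'o, 'a) vfunctr
     \<Rightarrow> ('c \<Rightarrow> 'a) \<Rightarrow> 'c \<Rightarrow> 'a" where
  "cotensor_map W v A B \<alpha> =
     (\<lambda>z. vfa (representable W (self_enriched W) v) (vfo A z) (vfo B z) \<bullet>\<^bsub>W\<^esub> \<alpha> z)"

text \<open>The transformation \<open>Y(y,-) \<Rightarrow> P\<close> that corresponds to \<open>e : \<one> \<rightarrow> P y\<close> under the Yoneda
  bijection; its component at \<open>z\<close> is named by
  \<open>Y(y,z) \<cong> Y(y,z) \<otimes> \<one> \<rightarrow> [P y, P z] \<otimes> P y \<rightarrow> P z\<close>.\<close>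

definition yoneda ::
  "('o, 'a, 'm) smcc_scheme \<Rightarrow> ('c, 'o, 'a) vcat \<Rightarrow> ('c, 'o, 'a) vfunctr \<Rightarrow> 'c \<Rightarrow> 'a \<Rightarrow> 'c \<Rightarrow> 'a" where
  "yoneda W Y P y e =
     (\<lambda>z. nam W (vHom Y y z) (vfo P z)
        (evl W (vfo P y) (vfo P z) \<bullet>\<^bsub>W\<^esub> (vfa P y z \<odot>\<^bsub>W\<^esub> e) \<bullet>\<^bsub>W\<^esub> inv_ar W (run W (vHom Y y z))))"

text \<open>The pullback of a sieve \<open>R\<close> on \<open>x\<close> along \<open>f : v \<rightarrow> Y(x,y)\<close>: all monomorphisms that occur as
  the left leg of a pointwise pullback of \<open>Y(y,-) \<Rightarrow> {v, Y(x,-)} \<Leftarrow> {v, S}\<close>, for a representative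
  \<open>S\<close> of \<open>R\<close>.\<close>

definition pullback_sieve ::
  "('o, 'a, 'm) smcc_scheme \<Rightarrow> ('c, 'o, 'a) vcat \<Rightarrow> 'c \<Rightarrow> 'c \<Rightarrow> 'o \<Rightarrow> 'a
     \<Rightarrow> ('c, 'o, 'a) presheaf_mono set \<Rightarrow> ('c, 'o, 'a) presheaf_mono set" where
  "pullback_sieve W Y x y v f R =
     {(P, p). mono_into_rep W Y y (P, p) \<and>
        (\<exists>(S, m) \<in> R. \<exists>q. vnat W Y (self_enriched W) P (cotensor W v S) q \<and>
           (\<forall>z \<in> vOb Y.
              is_pullback W
                (unnam W (vfo P z) (vHom Y y z) (p z))
                (unnam W (vfo P z) (ihm W v (vfo S z)) (q z))
                (unnam W (vHom Y y z) (ihm W v (vHom Y x z))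
                   (yoneda W Y (cotensor W v (representable W Y x)) y
                      (nam W v (vHom Y x y) f) z))
                (unnam W (ihm W v (vfo S z)) (ihm W v (vHom Y x z))
                   (cotensor_map W v S (representable W Y x) m z))))}"

definition coverages ::
  "('o, 'a, 'm) smcc_scheme \<Rightarrow> 'o set \<Rightarrow> ('c, 'o, 'a) vcat
     \<Rightarrow> ('c \<Rightarrow> ('c, 'o, 'a) presheaf_mono set set) set" where
  "coverages W \<G> Y =
     {J \<in> (\<Pi>\<^sub>E x \<in> vOb Y. Pow (sieves W Y x)).
        (\<forall>x \<in> vOb Y. maximal_sieve W Y x \<in> J x) \<and>
        (\<forall>x \<in> vOb Y. \<forall>y \<in> vOb Y. \<forall>R \<in> J x. \<forall>g \<in> \<G>. \<forall>f \<in> Hom W g (vHom Y x y).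
           pullback_sieve W Y x y g f R \<in> J y)}"

definition coverage_order ::
  "('o, 'a, 'm) smcc_scheme \<Rightarrow> 'o set \<Rightarrow> ('c, 'o, 'a) vcat
     \<Rightarrow> ('c \<Rightarrow> ('c, 'o, 'a) presheaf_mono set set) gorder" where
  "coverage_order W \<G> Y =
     \<lparr>carrier = coverages W \<G> Y, eq = (=), le = \<lambda>J K. \<forall>x \<in> vOb Y. J x \<subseteq> K x\<rparr>"


section \<open>Base change\<close>

definition elt_map :: "('p, 'b, 'n) smcc_scheme \<Rightarrow> ('o, 'a, 'p, 'b) lax_functr \<Rightarrow> 'a \<Rightarrow> 'b" where
  "elt_map U G f = far G f \<bullet>\<^bsub>U\<^esub> lxu G"

definition base_change ::
  "('p, 'b, 'n) smcc_scheme \<Rightarrow> ('o, 'a, 'p, 'b) lax_functr \<Rightarrow> ('c, 'o, 'a) vcat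
     \<Rightarrow> ('c, 'p, 'b) vcat" where
  "base_change U G X =
     \<lparr>vOb = vOb X, vHom = \<lambda>x y. fob G (vHom X x y), vId = \<lambda>x. elt_map U G (vId X x),
      vCmp = \<lambda>x y z. far G (vCmp X x y z) \<bullet>\<^bsub>U\<^esub> lxm G (vHom X y z) (vHom X x y)\<rparr>"

lemma base_change_vop:
  assumes G: "lax_monoidal_functor V U G" and V: "symmetric_monoidal_category V"
    and U: "symmetric_monoidal_category U" and X: "vcategory V X"
    and G_symmetric: "\<And>a b. a \<in> Ob V \<Longrightarrow> b \<in> Ob V \<Longrightarrow>
      far G (swp V a b) \<bullet>\<^bsub>U\<^esub> lxm G a b = lxm G b a \<bullet>\<^bsub>U\<^esub> swp U (fob G a) (fob G b)"
  shows "vOb (base_change U G (vop V X)) = vOb (vop U (base_change U G X))"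
    and "vHom (base_change U G (vop V X)) = vHom (vop U (base_change U G X))"
    and "vId (base_change U G (vop V X)) = vId (vop U (base_change U G X))"
    and "x \<in> vOb X \<Longrightarrow> y \<in> vOb X \<Longrightarrow> z \<in> vOb X \<Longrightarrow>
      vCmp (base_change U G (vop V X)) x y z = vCmp (vop U (base_change U G X)) x y z"
proof -
  interpret G: lax_monoidal_functor V U G by (rule G)
  interpret V: symmetric_monoidal_category V by (rule V)
  interpret U: symmetric_monoidal_category U by (rule U)
  interpret X: vcategory V X by (rule X)
  show "vOb (base_change U G (vop V X)) = vOb (vop U (base_change U G X))"
    and "vHom (base_change U G (vop V X)) = vHom (vop U (base_change U G X))"
    and "vId (base_change U G (vop V X)) = vId (vop U (base_change U G X))"
    by (simp_all add: base_change_def vop_def)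
  assume "x \<in> vOb X" "y \<in> vOb X" "z \<in> vOb X"
  then have obs: "vHom X z y \<in> Ob V" "vHom X y x \<in> Ob V"
    and c: "vCmp X z y x \<in> Hom V (vHom X y x \<otimes>\<^bsub>V\<^esub> vHom X z y) (vHom X z x)"
    by (auto intro: X.vHom_Ob X.vCmp_Hom)
  note s = V.swp_Hom[OF obs] and mm = G.lxm_Hom[OF obs] and mm' = G.lxm_Hom[OF obs(2,1)]
  note t = U.swp_Hom[OF G.fob_Ob[OF obs(1)] G.fob_Ob[OF obs(2)]]
  show "vCmp (base_change U G (vop V X)) x y z = vCmp (vop U (base_change U G X)) x y z"
    by (simp add: base_change_def vop_def G.far_cmp[OF s c] G_symmetric[OF obs]
        G.target.cmp_assoc[OF mm G.far_Hom[OF s] G.far_Hom[OF c]] G.target.cmp_assoc[OF t mm' G.far_Hom[OF c]])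
qed

definition base_change_functor ::
  "('o, 'a, 'p, 'b) lax_functr \<Rightarrow> ('c, 'd, 'a) vfunctr \<Rightarrow> ('c, 'd, 'b) vfunctr" where
  "base_change_functor G A = \<lparr>vfo = vfo A, vfa = \<lambda>x y. far G (vfa A x y)\<rparr>"


subsection \<open>The enriched right adjoint and the induced map on presheaves\<close>

text \<open>\<open>\<Phi>\<^sub>x\<^sub>y : G[F x, y] \<rightarrow> [x, G y]\<close>, the transpose of
  \<open>G[F x, y] \<otimes> x \<rightarrow> G[F x, y] \<otimes> G F x \<rightarrow> G([F x, y] \<otimes> F x) \<rightarrow> G y\<close>.\<close>

definition adj_iso ::
  "('p, 'b, 'n) smcc_scheme \<Rightarrow> ('o, 'a, 'm) smcc_scheme \<Rightarrow> ('p, 'b, 'o, 'a) lax_functr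
     \<Rightarrow> ('o, 'a, 'p, 'b) lax_functr \<Rightarrow> ('p \<Rightarrow> 'b) \<Rightarrow> 'p \<Rightarrow> 'o \<Rightarrow> 'b" where
  "adj_iso U V F G \<eta> x y =
     cur U (fob G (ihm V (fob F x) y)) x (fob G y)
       (far G (evl V (fob F x) y) \<bullet>\<^bsub>U\<^esub> lxm G (ihm V (fob F x) y) (fob F x)
          \<bullet>\<^bsub>U\<^esub> (idn U (fob G (ihm V (fob F x) y)) \<odot>\<^bsub>U\<^esub> \<eta> x))"

text \<open>Precomposition \<open>X(y,z) \<cong> X(y,z) \<otimes> \<one> \<rightarrow> X(y,z) \<otimes> X(x,y) \<rightarrow> X(x,z)\<close> with an element
  \<open>e : \<one> \<rightarrow> X(x,y)\<close>.\<close>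

definition vprecomp ::
  "('o, 'a, 'm) smcc_scheme \<Rightarrow> ('c, 'o, 'a) vcat \<Rightarrow> 'c \<Rightarrow> 'c \<Rightarrow> 'c \<Rightarrow> 'a \<Rightarrow> 'a" where
  "vprecomp V X x y z e =
     vCmp X x y z \<bullet>\<^bsub>V\<^esub> (idn V (vHom X y z) \<odot>\<^bsub>V\<^esub> e) \<bullet>\<^bsub>V\<^esub> inv_ar V (run V (vHom X y z))"

definition enriched_G ::
  "('p, 'b, 'n) smcc_scheme \<Rightarrow> ('o, 'a, 'm) smcc_scheme \<Rightarrow> ('p, 'b, 'o, 'a) lax_functr
     \<Rightarrow> ('o, 'a, 'p, 'b) lax_functr \<Rightarrow> ('p \<Rightarrow> 'b) \<Rightarrow> ('o \<Rightarrow> 'a) \<Rightarrow> ('o, 'p, 'b) vfunctr" where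
  "enriched_G U V F G \<eta> \<epsilon> =
     \<lparr>vfo = fob G,
      vfa = \<lambda>x y. adj_iso U V F G \<eta> (fob G x) y \<bullet>\<^bsub>U\<^esub>
        vprecomp U (base_change U G (self_enriched V)) (fob F (fob G x)) x y
          (elt_map U G (nam V (fob F (fob G x)) x (\<epsilon> x)))\<rparr>"

definition tilde_ob ::
  "('p, 'b, 'n) smcc_scheme \<Rightarrow> ('o, 'a, 'm) smcc_scheme \<Rightarrow> ('p, 'b, 'o, 'a) lax_functr
     \<Rightarrow> ('o, 'a, 'p, 'b) lax_functr \<Rightarrow> ('p \<Rightarrow> 'b) \<Rightarrow> ('o \<Rightarrow> 'a)
     \<Rightarrow> ('c, 'o, 'a) vfunctr \<Rightarrow> ('c, 'p, 'b) vfunctr" where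
  "tilde_ob U V F G \<eta> \<epsilon> R =
     comp_vfunctor U (enriched_G U V F G \<eta> \<epsilon>) (base_change_functor G R)"

definition tilde_ar ::
  "('p, 'b, 'n) smcc_scheme \<Rightarrow> ('o, 'a, 'm) smcc_scheme \<Rightarrow> ('p, 'b, 'o, 'a) lax_functr
     \<Rightarrow> ('o, 'a, 'p, 'b) lax_functr \<Rightarrow> ('p \<Rightarrow> 'b) \<Rightarrow> ('o \<Rightarrow> 'a)
     \<Rightarrow> ('c, 'o, 'a) vfunctr \<Rightarrow> ('c, 'o, 'a) vfunctr \<Rightarrow> ('c \<Rightarrow> 'a) \<Rightarrow> 'c \<Rightarrow> 'b" where
  "tilde_ar U V F G \<eta> \<epsilon> A B \<alpha> =
     (\<lambda>x. vfa (enriched_G U V F G \<eta> \<epsilon>) (vfo A x) (vfo B x) \<bullet>\<^bsub>U\<^esub> elt_map U G (\<alpha> x))"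

text \<open>The image of a sieve is the isomorphism class of the image of any representative; the
  codomain of that image is the image of \<open>X(-,x)\<close>, which is \<open>(G\<^sub>*X)(-,x)\<close>. The parameter \<open>Y\<close> is
  again the opposite of the \<open>V\<close>-category in question.\<close>

definition tilde_sieve ::
  "('p, 'b, 'n) smcc_scheme \<Rightarrow> ('o, 'a, 'm) smcc_scheme \<Rightarrow> ('p, 'b, 'o, 'a) lax_functr
     \<Rightarrow> ('o, 'a, 'p, 'b) lax_functr \<Rightarrow> ('p \<Rightarrow> 'b) \<Rightarrow> ('o \<Rightarrow> 'a) \<Rightarrow> ('c, 'o, 'a) vcat \<Rightarrow> 'c
     \<Rightarrow> ('c, 'o, 'a) presheaf_mono set \<Rightarrow> ('c, 'p, 'b) presheaf_mono set" where
  "tilde_sieve U V F G \<eta> \<epsilon> Y x R =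
     {s. \<exists>(S, m) \<in> R. mono_equiv U (base_change U G Y) x
           (tilde_ob U V F G \<eta> \<epsilon> S, tilde_ar U V F G \<eta> \<epsilon> S (representable V Y x) m) s}"

definition tilde_coverage ::
  "('p, 'b, 'n) smcc_scheme \<Rightarrow> ('o, 'a, 'm) smcc_scheme \<Rightarrow> ('p, 'b, 'o, 'a) lax_functr
     \<Rightarrow> ('o, 'a, 'p, 'b) lax_functr \<Rightarrow> ('p \<Rightarrow> 'b) \<Rightarrow> ('o \<Rightarrow> 'a) \<Rightarrow> ('c, 'o, 'a) vcat
     \<Rightarrow> ('c \<Rightarrow> ('c, 'o, 'a) presheaf_mono set set)
     \<Rightarrow> ('c \<Rightarrow> ('c, 'p, 'b) presheaf_mono set set)" where
  "tilde_coverage U V F G \<eta> \<epsilon> Y J = (\<lambda>x \<in> vOb Y. tilde_sieve U V F G \<eta> \<epsilon> Y x ` J x)"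

end

theory Submission
  imports Defs
begin

text \<open>
  The theorem says that transport of sieves along the monoidal adjunction \<open>F \<stileturn> G\<close> embeds the lattice of
  coverages on \<open>C\<close> into that on \<open>G\<^sub>*C\<close>. Three facts carry the proof.
  
  First, sieves can be handled pointwise. A sieve on \<open>x\<close> is a class of monomorphisms into \<open>Y(x,-)\<close>, where
  \<open>Y\<close> is the opposite of \<open>C\<close>. Because the inclusions are monic, two of them are isomorphic as soon as their
  components factor through each other (\<open>mono_equiv_iff\<close>), and the pullback of a sieve along
  \<open>f : v \<rightarrow> Y(x,y)\<close> is characterized by a condition on generalized elements: \<open>t\<close> lies in the pullback iff the
  composite of \<open>t\<close> and \<open>f\<close> lies in the sieve (\<open>mem_pullback_sieve_iff\<close>). The comparison maps are
  natural automatically, and cotensors disappear.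
  
  Second, the transport \<open>G\<close> respects these descriptions. The transported presheaf is \<open>G R\<close> with the action
  induced by the lax structure (\<open>tilde_ob_act\<close>), and the inclusion of a transported sieve is \<open>G\<close> of the inclusion
  (\<open>incl_tilde_mono\<close>). An arrow factors through \<open>G m\<close> iff its transpose factors through \<open>m\<close>
  (\<open>factors_transpose_iff\<close>). Hence pulling back a transported sieve along \<open>f : g \<rightarrow> G Y(x,y)\<close> amounts to
  pulling back the sieve along the transpose \<open>F g \<rightarrow> Y(x,y)\<close> and transporting the result
  (\<open>tilde_restricts\<close>, \<open>tilde_pullback_sieve\<close>). As the generating family of \<open>V\<close> consists of the objects \<open>F g\<close>,
  the image of a coverage is a coverage.
  
  Third, the transport of sieves is injective. If \<open>G m\<close> factors through \<open>G n\<close> for a monic \<open>n\<close>, then the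
  pullback of \<open>n\<close> along \<open>m\<close> becomes invertible under \<open>G\<close>, so it is invertible by conservativity and \<open>m\<close>
  factors through \<open>n\<close> (\<open>conservative_reflects_factors\<close>).
  
  Finally, the axioms of a coverage concern single sieves, so meets and joins of coverages are pointwise
  intersections and unions. Taking images of sets of sieves preserves unions, and it preserves intersections
  and is injective because the transport of sieves is injective.
\<close>

section \<open>Arrows and factorizations\<close>

text \<open>
  Typing is handled in terms of \<open>Ar\<close>, \<open>Dom\<close> and \<open>Cod\<close>: unlike an intermediate object in \<open>Hom C x y\<close>,
  these are computed from an arrow by rewriting, so that composability conditions are solved by the
  simplifier.
\<close>

lemma mem_Hom_iff [simp]: "f \<in> Hom C x y \<longleftrightarrow> f \<in> Ar C \<and> Dom C f = x \<and> Cod C f = y"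
  by (auto simp: Hom_def)

definition factors :: "('o, 'a, 'm) cat_scheme \<Rightarrow> 'a \<Rightarrow> 'a \<Rightarrow> bool" where
  "factors C f n \<longleftrightarrow> (\<exists>h \<in> Hom C (Dom C f) (Dom C n). n \<bullet>\<^bsub>C\<^esub> h = f)"

lemma factorsE:
  assumes "factors C f n"
  obtains h where "h \<in> Ar C" "Dom C h = Dom C f" "Cod C h = Dom C n" "n \<bullet>\<^bsub>C\<^esub> h = f"
  using assms unfolding factors_def Bex_def mem_Hom_iff by blast

lemma factorsI:
  "h \<in> Ar C \<Longrightarrow> Dom C h = Dom C f \<Longrightarrow> Cod C h = Dom C n \<Longrightarrow> n \<bullet>\<^bsub>C\<^esub> h = f \<Longrightarrow> factors C f n"
  unfolding factors_def Bex_def mem_Hom_iff by blast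

context category
begin

lemma Dom_Ob [simp]: "f \<in> Ar C \<Longrightarrow> Dom C f \<in> Ob C"
  and Cod_Ob [simp]: "f \<in> Ar C \<Longrightarrow> Cod C f \<in> Ob C"
  by (simp_all add: dom_cod)

lemma idn_simps [simp]:
  "x \<in> Ob C \<Longrightarrow> idn C x \<in> Ar C" "x \<in> Ob C \<Longrightarrow> Dom C (idn C x) = x" "x \<in> Ob C \<Longrightarrow> Cod C (idn C x) = x"
  using idn_hom by auto

lemma cmp_simps [simp]:
  assumes "f \<in> Ar C" "g \<in> Ar C" "Cod C f = Dom C g"
  shows "g \<bullet> f \<in> Ar C" "Dom C (g \<bullet> f) = Dom C f" "Cod C (g \<bullet> f) = Cod C g"
  using cmp_hom[of f "Dom C f" "Cod C f" g "Cod C g"] assms by auto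

lemma cmp_idn' [simp]: "f \<in> Ar C \<Longrightarrow> Dom C f = x \<Longrightarrow> f \<bullet> idn C x = f"
  and idn_cmp' [simp]: "f \<in> Ar C \<Longrightarrow> Cod C f = x \<Longrightarrow> idn C x \<bullet> f = f"
  using cmp_idn idn_cmp by auto

lemma cmp_assoc' [simp]:
  assumes "f \<in> Ar C" "g \<in> Ar C" "h \<in> Ar C" "Cod C f = Dom C g" "Cod C g = Dom C h"
  shows "(h \<bullet> g) \<bullet> f = h \<bullet> g \<bullet> f"
  using cmp_assoc[of f "Dom C f" "Dom C g" g "Dom C h" h "Cod C h"] assms by auto

lemma inverse_arrows_unique:
  "inverse_arrows C f g \<Longrightarrow> inverse_arrows C f h \<Longrightarrow> g = h"
proof -
  assume g: "inverse_arrows C f g" and h: "inverse_arrows C f h"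
  then have *: "f \<in> Ar C" "g \<in> Ar C" "h \<in> Ar C" "Dom C g = Cod C f" "Cod C g = Dom C f" "Dom C h = Cod C f"
    "Cod C h = Dom C f" "g \<bullet> f = idn C (Dom C f)" "f \<bullet> h = idn C (Cod C f)"
    by (auto simp: inverse_arrows_def)
  have "g = g \<bullet> f \<bullet> h" using * by simp
  also have "\<dots> = (g \<bullet> f) \<bullet> h" using *(1-7) by simp
  also have "\<dots> = h" using * by simp
  finally show "g = h" .
qed

lemma inv_ar_inverse: "iso C f \<Longrightarrow> inverse_arrows C f (inv_ar C f)"
  unfolding iso_def inv_ar_def by (rule theI') (blast intro: inverse_arrows_unique)

lemma inv_ar_simps:
  assumes "iso C f"
  shows "inv_ar C f \<in> Ar C" "Dom C (inv_ar C f) = Cod C f" "Cod C (inv_ar C f) = Dom C f"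
    "inv_ar C f \<bullet> f = idn C (Dom C f)" "f \<bullet> inv_ar C f = idn C (Cod C f)"
  using inv_ar_inverse[OF assms] by (auto simp: inverse_arrows_def)

lemma monicD:
  assumes "monic C m" "m \<bullet> f = m \<bullet> g" "f \<in> Ar C" "g \<in> Ar C" "Cod C f = Dom C m" "Cod C g = Dom C m" "Dom C f = Dom C g"
  shows "f = g"
proof -
  have "f \<in> Hom C (Dom C g) (Dom C m)" "g \<in> Hom C (Dom C g) (Dom C m)" using assms by simp_all
  then show ?thesis using assms(1,2) unfolding monic_def by blast
qed

lemma factors_trans:
  assumes "factors C f g" "factors C g h" "h \<in> Ar C"
  shows "factors C f h"
proof -
  obtain a where a: "a \<in> Ar C" "Dom C a = Dom C f" "Cod C a = Dom C g" "g \<bullet> a = f"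
    using assms(1) by (rule factorsE)
  obtain b where b: "b \<in> Ar C" "Dom C b = Dom C g" "Cod C b = Dom C h" "h \<bullet> b = g"
    using assms(2) by (rule factorsE)
  have "h \<bullet> b \<bullet> a = (h \<bullet> b) \<bullet> a" using a(1-3) b(1-3) assms(3) by simp
  then have "h \<bullet> b \<bullet> a = f" using a(4) b(4) by simp
  then show ?thesis by (rule factorsI[rotated 3]) (use a(1-3) b(1-3) in simp_all)
qed

lemma factors_refl: "f \<in> Ar C \<Longrightarrow> factors C f f"
  by (rule factorsI[of "idn C (Dom C f)"]) simp_all

lemma factors_precompose:
  assumes "factors C g n" "n \<in> Ar C" "k \<in> Ar C" "g \<in> Ar C" "Cod C k = Dom C g"
  shows "factors C (g \<bullet> k) n"
proof -
  obtain h where h: "h \<in> Ar C" "Dom C h = Dom C g" "Cod C h = Dom C n" "n \<bullet> h = g"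
    using assms(1) by (rule factorsE)
  have "n \<bullet> h \<bullet> k = (n \<bullet> h) \<bullet> k" using h(1-3) assms(2-) by simp
  then have "n \<bullet> h \<bullet> k = g \<bullet> k" unfolding h(4) .
  then show ?thesis by (rule factorsI[rotated 3]) (use h(1-3) assms(2-) in simp_all)
qed

end

section \<open>Coherence in monoidal categories\<close>

context monoidal_category
begin

declare unt_Ob [simp] tob_Ob [simp] 

lemma tar_simps [simp]:
  assumes "f \<in> Ar V" "g \<in> Ar V"
  shows "f \<odot> g \<in> Ar V" "Dom V (f \<odot> g) = Dom V f \<otimes> Dom V g" "Cod V (f \<odot> g) = Cod V f \<otimes> Cod V g"
  using tar_Hom[of f "Dom V f" "Cod V f" g "Dom V g" "Cod V g"] assms by auto

lemma tar_idn' [simp]: "a \<in> Ob V \<Longrightarrow> b \<in> Ob V \<Longrightarrow> idn V a \<odot> idn V b = idn V (a \<otimes> b)"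
  by (rule tar_idn)

lemma tar_cmp' [simp]:
  assumes "f \<in> Ar V" "f' \<in> Ar V" "Cod V f = Dom V f'" "g \<in> Ar V" "g' \<in> Ar V" "Cod V g = Dom V g'"
  shows "(f' \<odot> g') \<bullet> (f \<odot> g) = (f' \<bullet> f) \<odot> (g' \<bullet> g)"
  using tar_cmp[of f "Dom V f" "Cod V f" f' "Cod V f'" g "Dom V g" "Cod V g" g' "Cod V g'"] assms by auto

lemma tar_cmp_cmp [simp]:
  assumes "f \<in> Ar V" "f' \<in> Ar V" "Cod V f = Dom V f'" "g \<in> Ar V" "g' \<in> Ar V" "Cod V g = Dom V g'"
    "h \<in> Ar V" "Cod V h = Dom V f \<otimes> Dom V g"
  shows "(f' \<odot> g') \<bullet> (f \<odot> g) \<bullet> h = ((f' \<bullet> f) \<odot> (g' \<bullet> g)) \<bullet> h"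
  using assms by (simp flip: cmp_assoc')

lemma structure_simps [simp]:
  assumes "a \<in> Ob V"
  shows "lun V a \<in> Ar V" "Dom V (lun V a) = \<one> \<otimes> a" "Cod V (lun V a) = a"
    "run V a \<in> Ar V" "Dom V (run V a) = a \<otimes> \<one>" "Cod V (run V a) = a"
    "inv_ar V (lun V a) \<in> Ar V" "Dom V (inv_ar V (lun V a)) = a" "Cod V (inv_ar V (lun V a)) = \<one> \<otimes> a"
    "inv_ar V (run V a) \<in> Ar V" "Dom V (inv_ar V (run V a)) = a" "Cod V (inv_ar V (run V a)) = a \<otimes> \<one>"
    "inv_ar V (lun V a) \<bullet> lun V a = idn V (\<one> \<otimes> a)" "lun V a \<bullet> inv_ar V (lun V a) = idn V a"
    "inv_ar V (run V a) \<bullet> run V a = idn V (a \<otimes> \<one>)" "run V a \<bullet> inv_ar V (run V a) = idn V a"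
  using lun_Hom[OF assms] run_Hom[OF assms] lun_iso[OF assms] run_iso[OF assms]
  by (auto simp: inv_ar_simps)

lemma asc_simps [simp]:
  assumes "a \<in> Ob V" "b \<in> Ob V" "c \<in> Ob V"
  shows "asc V a b c \<in> Ar V" "Dom V (asc V a b c) = (a \<otimes> b) \<otimes> c" "Cod V (asc V a b c) = a \<otimes> b \<otimes> c"
  using asc_Hom[OF assms] by auto

lemma asc_nat':
  assumes "f \<in> Ar V" "g \<in> Ar V" "h \<in> Ar V" "Dom V f = a" "Dom V g = b" "Dom V h = c"
    "Cod V f = a'" "Cod V g = b'" "Cod V h = c'"
  shows "asc V a' b' c' \<bullet> ((f \<odot> g) \<odot> h) = (f \<odot> g \<odot> h) \<bullet> asc V a b c"
  using asc_nat assms by auto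

lemma cancel_lun:
  assumes "a \<in> Ob V" "h \<in> Ar V"
  shows "Cod V h = a \<Longrightarrow> lun V a \<bullet> inv_ar V (lun V a) \<bullet> h = h"
   "Cod V h = \<one> \<otimes> a \<Longrightarrow> inv_ar V (lun V a) \<bullet> lun V a \<bullet> h = h"
  using assms by (simp_all flip: cmp_assoc')

lemma inv_lun_nat:
  assumes "f \<in> Ar V" "Dom V f = a" "Cod V f = b"
  shows "inv_ar V (lun V b) \<bullet> f = (idn V \<one> \<odot> f) \<bullet> inv_ar V (lun V a)"
proof -
  have ob: "a \<in> Ob V" "b \<in> Ob V" using assms by auto
  have "inv_ar V (lun V b) \<bullet> f = inv_ar V (lun V b) \<bullet> (f \<bullet> lun V a) \<bullet> inv_ar V (lun V a)"
    using assms ob by simp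
  also have "f \<bullet> lun V a = lun V b \<bullet> (idn V \<one> \<odot> f)"
    using lun_nat assms by auto
  finally show ?thesis
    using assms ob by (simp add: cancel_lun)
qed

lemma inv_run_nat:
  assumes "f \<in> Ar V" "Dom V f = a" "Cod V f = b"
  shows "inv_ar V (run V b) \<bullet> f = (f \<odot> idn V \<one>) \<bullet> inv_ar V (run V a)"
proof -
  have ob: "a \<in> Ob V" "b \<in> Ob V" using assms by auto
  have "inv_ar V (run V b) \<bullet> f = inv_ar V (run V b) \<bullet> (f \<bullet> run V a) \<bullet> inv_ar V (run V a)"
    using assms ob by simp
  also have "f \<bullet> run V a = run V b \<bullet> (f \<odot> idn V \<one>)"
    using run_nat assms by auto
  also have "inv_ar V (run V b) \<bullet> (run V b \<bullet> (f \<odot> idn V \<one>)) \<bullet> inv_ar V (run V a) =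
     (inv_ar V (run V b) \<bullet> run V b) \<bullet> (f \<odot> idn V \<one>) \<bullet> inv_ar V (run V a)"
    using assms ob by (simp del: structure_simps(13-16))
  finally show ?thesis
    using assms ob by simp
qed

lemma unt_tar_cancel:
  assumes "f \<in> Ar V" "g \<in> Ar V" "Dom V f = Dom V g" "Cod V f = Cod V g" "idn V \<one> \<odot> f = idn V \<one> \<odot> g"
  shows "f = g"
proof -
  have *: "(lun V (Cod V h) \<bullet> (idn V \<one> \<odot> h)) \<bullet> inv_ar V (lun V (Dom V h)) = h" if "h \<in> Ar V" for h
    using that lun_nat[of h "Dom V h" "Cod V h"] by simp
  show ?thesis
    by (subst *[OF assms(1), symmetric], subst *[OF assms(2), symmetric]) (simp only: assms(3-5))
qed

lemma iso_cancel_right: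
  assumes "iso V e" "f \<bullet> e = g \<bullet> e" "f \<in> Ar V" "g \<in> Ar V" "Cod V e = Dom V f" "Cod V e = Dom V g"
  shows "f = g"
proof -
  have e: "e \<in> Ar V" using assms(1) by (auto simp: iso_def inverse_arrows_def)
  have *: "(h \<bullet> e) \<bullet> inv_ar V e = h" if "h \<in> Ar V" "Cod V e = Dom V h" for h
    using that assms(1) e by (simp add: inv_ar_simps)
  show ?thesis
    by (subst *[OF assms(3,5), symmetric], subst *[OF assms(4,6), symmetric]) (simp only: assms(2))
qed

lemma iso_tar:
  assumes "iso V f" "iso V g" shows "iso V (f \<odot> g)"
proof -
  have "f \<in> Ar V" "g \<in> Ar V" using assms by (auto simp: iso_def inverse_arrows_def)
  then show ?thesis using assms unfolding iso_def[of V "f \<odot> g"] inverse_arrows_def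
    by (intro exI[of _ "inv_ar V f \<odot> inv_ar V g"]) (simp add: inv_ar_simps)
qed

lemma iso_idn [simp]: "a \<in> Ob V \<Longrightarrow> iso V (idn V a)"
  unfolding iso_def inverse_arrows_def by (intro exI[of _ "idn V a"]) simp

text \<open>
  Kelly's redundancy of one of the unit axioms. Tensoring with \<open>\<one>\<close> on the left is faithful, so it is
  enough to compare the two sides after \<open>\<one> \<otimes> -\<close>; there the pentagon for \<open>\<one>, \<one>, a, b\<close> reduces the claim
  to the triangle axiom.
\<close>

lemma lun_asc:
  assumes a: "a \<in> Ob V" and b: "b \<in> Ob V"
  shows "lun V (a \<otimes> b) \<bullet> asc V \<one> a b = lun V a \<odot> idn V b"
proof (rule unt_tar_cancel)
  let ?i = "idn V \<one>" and ?P = "asc V \<one> (\<one> \<otimes> a) b" and ?Q = "asc V \<one> \<one> a \<odot> idn V b"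
  have "(?i \<odot> (lun V (a \<otimes> b) \<bullet> asc V \<one> a b)) \<bullet> ?P \<bullet> ?Q
      = (?i \<odot> lun V (a \<otimes> b)) \<bullet> (?i \<odot> asc V \<one> a b) \<bullet> ?P \<bullet> ?Q"
    using a b by simp
  also have "\<dots> = (?i \<odot> lun V (a \<otimes> b)) \<bullet> asc V \<one> \<one> (a \<otimes> b) \<bullet> asc V (\<one> \<otimes> \<one>) a b"
    using pentagon[of \<one> \<one> a b] a b by simp
  also have "\<dots> = ((?i \<odot> lun V (a \<otimes> b)) \<bullet> asc V \<one> \<one> (a \<otimes> b)) \<bullet> asc V (\<one> \<otimes> \<one>) a b"
    using a b by simp
  also have "\<dots> = (run V \<one> \<odot> idn V (a \<otimes> b)) \<bullet> asc V (\<one> \<otimes> \<one>) a b"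
    using triangle a b by simp
  also have "\<dots> = asc V \<one> a b \<bullet> ((run V \<one> \<odot> idn V a) \<odot> idn V b)"
    using asc_nat'[of "run V \<one>" "idn V a" "idn V b" "\<one> \<otimes> \<one>" a b \<one> a b] a b by simp
  also have "\<dots> = asc V \<one> a b \<bullet> (((?i \<odot> lun V a) \<bullet> asc V \<one> \<one> a) \<odot> idn V b)"
    using triangle a by simp
  also have "\<dots> = asc V \<one> a b \<bullet> ((?i \<odot> lun V a) \<odot> idn V b) \<bullet> ?Q"
    using a b by simp
  also have "\<dots> = (asc V \<one> a b \<bullet> ((?i \<odot> lun V a) \<odot> idn V b)) \<bullet> ?Q"
    using a b by (simp del: tar_cmp' tar_cmp_cmp)
  also have "\<dots> = ((?i \<odot> lun V a \<odot> idn V b) \<bullet> ?P) \<bullet> ?Q"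
    using asc_nat'[of ?i "lun V a" "idn V b" \<one> "\<one> \<otimes> a" b \<one> a b] a b by simp
  finally have "(?i \<odot> (lun V (a \<otimes> b) \<bullet> asc V \<one> a b)) \<bullet> ?P \<bullet> ?Q = (?i \<odot> lun V a \<odot> idn V b) \<bullet> ?P \<bullet> ?Q"
    using a b by simp
  then have "((?i \<odot> (lun V (a \<otimes> b) \<bullet> asc V \<one> a b)) \<bullet> ?P) \<bullet> ?Q = ((?i \<odot> lun V a \<odot> idn V b) \<bullet> ?P) \<bullet> ?Q"
    using a b by simp
  then have "(?i \<odot> (lun V (a \<otimes> b) \<bullet> asc V \<one> a b)) \<bullet> ?P = (?i \<odot> lun V a \<odot> idn V b) \<bullet> ?P"
    by (rule iso_cancel_right[rotated]) (use a b in \<open>simp_all add: iso_tar asc_iso\<close>)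
  then show "?i \<odot> (lun V (a \<otimes> b) \<bullet> asc V \<one> a b) = ?i \<odot> lun V a \<odot> idn V b"
    by (rule iso_cancel_right[rotated]) (use a b in \<open>simp_all add: asc_iso\<close>)
qed (use a b in simp_all)

lemma asc_inv_lun:
  assumes a: "a \<in> Ob V" and b: "b \<in> Ob V"
  shows "asc V \<one> a b \<bullet> (inv_ar V (lun V a) \<odot> idn V b) = inv_ar V (lun V (a \<otimes> b))"
proof -
  have "asc V \<one> a b \<bullet> (inv_ar V (lun V a) \<odot> idn V b) =
      inv_ar V (lun V (a \<otimes> b)) \<bullet> (lun V (a \<otimes> b) \<bullet> asc V \<one> a b) \<bullet> (inv_ar V (lun V a) \<odot> idn V b)"
    using a b by (simp add: cancel_lun)
  then show ?thesis using a b by (simp add: lun_asc)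
qed

lemma asc_inv_run:
  assumes a: "a \<in> Ob V" and b: "b \<in> Ob V"
  shows "asc V a \<one> b \<bullet> (inv_ar V (run V a) \<odot> idn V b) = idn V a \<odot> inv_ar V (lun V b)"
proof -
  have "asc V a \<one> b \<bullet> (inv_ar V (run V a) \<odot> idn V b) =
      (idn V a \<odot> inv_ar V (lun V b)) \<bullet> ((idn V a \<odot> lun V b) \<bullet> asc V a \<one> b) \<bullet> (inv_ar V (run V a) \<odot> idn V b)"
    using a b by simp
  then show ?thesis using a b by (simp add: triangle)
qed

end

section \<open>Enriched presheaves as actions\<close>

text \<open>
  The arrow \<open>c \<otimes> a \<rightarrow> b\<close> that corresponds to \<open>g : c \<rightarrow> [a, b]\<close>.
\<close>

definition unc :: "('o, 'a, 'm) smcc_scheme \<Rightarrow> 'o \<Rightarrow> 'o \<Rightarrow> 'a \<Rightarrow> 'a" where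
  "unc V a b g = evl V a b \<bullet>\<^bsub>V\<^esub> (g \<odot>\<^bsub>V\<^esub> idn V a)"

text \<open>
  The action \<open>Y(x,y) \<otimes> R x \<rightarrow> R y\<close> of a functor \<open>R\<close> from \<open>Y\<close> to the self-enrichment. Functoriality and
  naturality become the unit, associativity and equivariance laws of actions, in which no internal
  hom occurs; a lax monoidal functor transports these laws directly.
\<close>

definition act :: "('o, 'a, 'm) smcc_scheme \<Rightarrow> ('c, 'o, 'a) vfunctr \<Rightarrow> 'c \<Rightarrow> 'c \<Rightarrow> 'a" where
  "act V R x y = unc V (vfo R x) (vfo R y) (vfa R x y)"

definition intertwines ::
  "('o, 'a, 'm) smcc_scheme \<Rightarrow> ('c, 'o, 'a) vcat \<Rightarrow> ('c, 'o, 'a) vfunctr \<Rightarrow> ('c, 'o, 'a) vfunctr \<Rightarrow> ('c \<Rightarrow> 'a) \<Rightarrow> bool" where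
  "intertwines V Y S T h \<longleftrightarrow> (\<forall>x \<in> vOb Y. \<forall>y \<in> vOb Y.
     h y \<bullet>\<^bsub>V\<^esub> act V S x y = act V T x y \<bullet>\<^bsub>V\<^esub> (idn V (vHom Y x y) \<odot>\<^bsub>V\<^esub> h x))"

lemma self_enriched_sels [simp]:
  "vOb (self_enriched V) = Ob V" "vHom (self_enriched V) = ihm V"
  "vId (self_enriched V) a = nam V a a (idn V a)"
  by (simp_all add: self_enriched_def)

lemma representable_sels [simp]: "vfo (representable V X x) = vHom X x"
  by (simp add: representable_def)

context monoidal_category
begin

lemma vcategory_typing:
  assumes "vcategory V Y"
  shows "x \<in> vOb Y \<Longrightarrow> y \<in> vOb Y \<Longrightarrow> vHom Y x y \<in> Ob V"
    "x \<in> vOb Y \<Longrightarrow> vId Y x \<in> Ar V" "x \<in> vOb Y \<Longrightarrow> Dom V (vId Y x) = \<one>" "x \<in> vOb Y \<Longrightarrow> Cod V (vId Y x) = vHom Y x x"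
    "x \<in> vOb Y \<Longrightarrow> y \<in> vOb Y \<Longrightarrow> z \<in> vOb Y \<Longrightarrow> vCmp Y x y z \<in> Ar V"
    "x \<in> vOb Y \<Longrightarrow> y \<in> vOb Y \<Longrightarrow> z \<in> vOb Y \<Longrightarrow> Dom V (vCmp Y x y z) = vHom Y y z \<otimes> vHom Y x y"
    "x \<in> vOb Y \<Longrightarrow> y \<in> vOb Y \<Longrightarrow> z \<in> vOb Y \<Longrightarrow> Cod V (vCmp Y x y z) = vHom Y x z"
proof -
  interpret Y: vcategory V Y by fact
  show "x \<in> vOb Y \<Longrightarrow> y \<in> vOb Y \<Longrightarrow> vHom Y x y \<in> Ob V" by (rule Y.vHom_Ob)
  show "x \<in> vOb Y \<Longrightarrow> vId Y x \<in> Ar V" "x \<in> vOb Y \<Longrightarrow> Dom V (vId Y x) = \<one>" "x \<in> vOb Y \<Longrightarrow> Cod V (vId Y x) = vHom Y x x"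
    using Y.vId_Hom[of x] by simp_all
  show "x \<in> vOb Y \<Longrightarrow> y \<in> vOb Y \<Longrightarrow> z \<in> vOb Y \<Longrightarrow> vCmp Y x y z \<in> Ar V"
    "x \<in> vOb Y \<Longrightarrow> y \<in> vOb Y \<Longrightarrow> z \<in> vOb Y \<Longrightarrow> Dom V (vCmp Y x y z) = vHom Y y z \<otimes> vHom Y x y"
    "x \<in> vOb Y \<Longrightarrow> y \<in> vOb Y \<Longrightarrow> z \<in> vOb Y \<Longrightarrow> Cod V (vCmp Y x y z) = vHom Y x z"
    using Y.vCmp_Hom[of x y z] by simp_all
qed

end

context symmetric_monoidal_closed_category
begin

declare ihm_Ob [simp]

lemma evl_simps [simp]:
  assumes "a \<in> Ob V" "b \<in> Ob V"
  shows "evl V a b \<in> Ar V" "Dom V (evl V a b) = ihm V a b \<otimes> a" "Cod V (evl V a b) = b"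
  using evl_Hom[OF assms] by auto

lemma unc_simps [simp]:
  assumes "a \<in> Ob V" "b \<in> Ob V" "g \<in> Ar V" "Cod V g = ihm V a b"
  shows "unc V a b g \<in> Ar V" "Dom V (unc V a b g) = Dom V g \<otimes> a" "Cod V (unc V a b g) = b"
  using assms by (simp_all add: unc_def)

lemma unc_cmp:
  assumes "a \<in> Ob V" "b \<in> Ob V" "g \<in> Ar V" "Cod V g = ihm V a b" "k \<in> Ar V" "Cod V k = Dom V g"
  shows "unc V a b (g \<bullet> k) = unc V a b g \<bullet> (k \<odot> idn V a)"
  using assms by (simp add: unc_def)

lemma evl_tar:
  assumes "a \<in> Ob V" "b \<in> Ob V" "g \<in> Ar V" "Cod V g = ihm V a b" "f \<in> Ar V" "Cod V f = a"
  shows "evl V a b \<bullet> (g \<odot> f) = unc V a b g \<bullet> (idn V (Dom V g) \<odot> f)"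
  using assms by (simp add: unc_def)

lemma unc_inject:
  assumes "unc V a b g = unc V a b g'" "a \<in> Ob V" "b \<in> Ob V" "g \<in> Ar V" "Cod V g = ihm V a b"
    "g' \<in> Ar V" "Cod V g' = ihm V a b" "Dom V g = Dom V g'"
  shows "g = g'"
proof -
  have "unc V a b g' \<in> Hom V (Dom V g' \<otimes> a) b" using assms(2-) by simp
  then have "\<exists>!h. h \<in> Hom V (Dom V g') (ihm V a b) \<and> evl V a b \<bullet> (h \<odot> idn V a) = unc V a b g'"
    by (rule evl_univ[OF assms(2,3) Dom_Ob[OF assms(6)]])
  moreover have "g \<in> Hom V (Dom V g') (ihm V a b)" "g' \<in> Hom V (Dom V g') (ihm V a b)"
    using assms(2-) by simp_all
  ultimately show ?thesis
    using assms(1) unfolding unc_def by blast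
qed

lemma cur_simps [simp]:
  assumes "a \<in> Ob V" "b \<in> Ob V" "c \<in> Ob V" "f \<in> Ar V" "Dom V f = c \<otimes> a" "Cod V f = b"
  shows "cur V c a b f \<in> Ar V" "Dom V (cur V c a b f) = c" "Cod V (cur V c a b f) = ihm V a b"
    "unc V a b (cur V c a b f) = f"
proof -
  have "f \<in> Hom V (c \<otimes> a) b" using assms by simp
  from theI'[OF evl_univ[OF assms(1-3) this]]
  show "cur V c a b f \<in> Ar V" "Dom V (cur V c a b f) = c" "Cod V (cur V c a b f) = ihm V a b"
    "unc V a b (cur V c a b f) = f"
    unfolding cur_def unc_def by simp_all
qed

lemma nam_simps [simp]:
  assumes "f \<in> Ar V" "Dom V f = a" "Cod V f = b"
  shows "nam V a b f \<in> Ar V" "Dom V (nam V a b f) = \<one>" "Cod V (nam V a b f) = ihm V a b"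
    "unc V a b (nam V a b f) = f \<bullet> lun V a"
proof -
  have "a \<in> Ob V" "b \<in> Ob V" using assms by auto
  then show "nam V a b f \<in> Ar V" "Dom V (nam V a b f) = \<one>" "Cod V (nam V a b f) = ihm V a b"
    "unc V a b (nam V a b f) = f \<bullet> lun V a"
    using assms by (simp_all add: nam_def)
qed

lemma unnam_eq:
  assumes "e \<in> Ar V" "Dom V e = \<one>" "Cod V e = ihm V a b" "a \<in> Ob V" "b \<in> Ob V"
  shows "unnam V a b e = unc V a b e \<bullet> inv_ar V (lun V a)"
  using assms by (simp add: unnam_def unc_def)

lemma unnam_simps [simp]:
  assumes "e \<in> Ar V" "Dom V e = \<one>" "Cod V e = ihm V a b" "a \<in> Ob V" "b \<in> Ob V"
  shows "unnam V a b e \<in> Ar V" "Dom V (unnam V a b e) = a" "Cod V (unnam V a b e) = b"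
  using assms by (simp_all add: unnam_eq)

lemma unnam_nam [simp]:
  assumes "f \<in> Ar V" "Dom V f = a" "Cod V f = b"
  shows "unnam V a b (nam V a b f) = f"
proof -
  have "a \<in> Ob V" "b \<in> Ob V" using assms by auto
  then show ?thesis using assms by (simp add: unnam_eq)
qed

lemma unc_elt:
  assumes "e \<in> Ar V" "Dom V e = \<one>" "Cod V e = ihm V a b" "a \<in> Ob V" "b \<in> Ob V"
  shows "unc V a b e = unnam V a b e \<bullet> lun V a"
  using assms by (simp add: unnam_eq)

lemma self_vCmp_simps [simp]:
  assumes "a \<in> Ob V" "b \<in> Ob V" "c \<in> Ob V"
  shows "vCmp (self_enriched V) a b c \<in> Ar V"
    "Dom V (vCmp (self_enriched V) a b c) = ihm V b c \<otimes> ihm V a b"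
    "Cod V (vCmp (self_enriched V) a b c) = ihm V a c"
    "unc V a c (vCmp (self_enriched V) a b c) =
      evl V b c \<bullet> (idn V (ihm V b c) \<odot> evl V a b) \<bullet> asc V (ihm V b c) (ihm V a b) a"
  using assms by (simp_all add: self_enriched_def)

lemma unc_vCmp:
  assumes "a \<in> Ob V" "b \<in> Ob V" "c \<in> Ob V" "g \<in> Ar V" "Cod V g = ihm V b c" "f \<in> Ar V" "Cod V f = ihm V a b"
  shows "unc V a c (vCmp (self_enriched V) a b c \<bullet> (g \<odot> f)) =
    unc V b c g \<bullet> (idn V (Dom V g) \<odot> unc V a b f) \<bullet> asc V (Dom V g) (Dom V f) a"
proof -
  have "unc V a c (vCmp (self_enriched V) a b c \<bullet> (g \<odot> f)) =
      evl V b c \<bullet> (idn V (ihm V b c) \<odot> evl V a b) \<bullet> asc V (ihm V b c) (ihm V a b) a \<bullet> ((g \<odot> f) \<odot> idn V a)"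
    using assms by (simp add: unc_cmp)
  also have "asc V (ihm V b c) (ihm V a b) a \<bullet> ((g \<odot> f) \<odot> idn V a) =
      (g \<odot> f \<odot> idn V a) \<bullet> asc V (Dom V g) (Dom V f) a"
    using assms by (intro asc_nat') simp_all
  finally show ?thesis using assms by (simp add: unc_def)
qed

lemma unc_vCmp_cmp:
  assumes "a \<in> Ob V" "b \<in> Ob V" "c \<in> Ob V" "g \<in> Ar V" "Cod V g = ihm V b c" "f \<in> Ar V" "Cod V f = ihm V a b"
    "k \<in> Ar V" "Cod V k = Dom V g \<otimes> Dom V f"
  shows "unc V a c (vCmp (self_enriched V) a b c \<bullet> (g \<odot> f) \<bullet> k) =
    unc V b c g \<bullet> (idn V (Dom V g) \<odot> unc V a b f) \<bullet> asc V (Dom V g) (Dom V f) a \<bullet> (k \<odot> idn V a)"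
proof -
  have "unc V a c (vCmp (self_enriched V) a b c \<bullet> (g \<odot> f) \<bullet> k) = unc V a c ((vCmp (self_enriched V) a b c \<bullet> (g \<odot> f)) \<bullet> k)"
    using assms by simp
  also have "\<dots> = unc V a c (vCmp (self_enriched V) a b c \<bullet> (g \<odot> f)) \<bullet> (k \<odot> idn V a)"
    using assms by (subst unc_cmp) simp_all
  finally show ?thesis using assms by (simp add: unc_vCmp)
qed

text \<open>
  Each law is compared after uncurrying, where composition becomes iterated evaluation:
  associativity is the pentagon, the unit laws are the triangle axiom and its left-handed variant.
\<close>

lemma self_enriched_vcategory: "vcategory V (self_enriched V)"
proof
  fix w x y z assume ob: "w \<in> vOb (self_enriched V)" "x \<in> vOb (self_enriched V)"
    "y \<in> vOb (self_enriched V)" "z \<in> vOb (self_enriched V)"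
  let ?c = "vCmp (self_enriched V)"
  show "?c w x z \<bullet> (?c x y z \<odot> idn V (vHom (self_enriched V) w x)) =
    ?c w y z \<bullet> (idn V (vHom (self_enriched V) y z) \<odot> ?c w x y) \<bullet>
      asc V (vHom (self_enriched V) y z) (vHom (self_enriched V) x y) (vHom (self_enriched V) w x)"
  proof (rule unc_inject)
    let ?a = "ihm V y z" and ?b = "ihm V x y" and ?d = "ihm V w x"
    have "unc V w z (?c w x z \<bullet> (?c x y z \<odot> idn V ?d)) =
        evl V y z \<bullet> (idn V ?a \<odot> evl V x y) \<bullet> asc V ?a ?b x \<bullet> (idn V (?a \<otimes> ?b) \<odot> unc V w x (idn V ?d)) \<bullet> asc V (?a \<otimes> ?b) ?d w"
      using ob by (simp add: unc_vCmp)
    also have "asc V ?a ?b x \<bullet> (idn V (?a \<otimes> ?b) \<odot> unc V w x (idn V ?d)) \<bullet> asc V (?a \<otimes> ?b) ?d w =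
      (asc V ?a ?b x \<bullet> ((idn V ?a \<odot> idn V ?b) \<odot> unc V w x (idn V ?d))) \<bullet> asc V (?a \<otimes> ?b) ?d w"
      using ob by simp
    also have "\<dots> = ((idn V ?a \<odot> idn V ?b \<odot> unc V w x (idn V ?d)) \<bullet> asc V ?a ?b (?d \<otimes> w)) \<bullet> asc V (?a \<otimes> ?b) ?d w"
      using ob by (subst asc_nat'[of _ _ _ ?a ?b "?d \<otimes> w"]) simp_all
    also have "\<dots> = (idn V ?a \<odot> idn V ?b \<odot> unc V w x (idn V ?d)) \<bullet> asc V ?a ?b (?d \<otimes> w) \<bullet> asc V (?a \<otimes> ?b) ?d w"
      using ob by simp
    also have "asc V ?a ?b (?d \<otimes> w) \<bullet> asc V (?a \<otimes> ?b) ?d w =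
        (idn V ?a \<odot> asc V ?b ?d w) \<bullet> asc V ?a (?b \<otimes> ?d) w \<bullet> (asc V ?a ?b ?d \<odot> idn V w)"
      using ob by (simp add: pentagon)
    finally have l: "unc V w z (?c w x z \<bullet> (?c x y z \<odot> idn V ?d)) =
      evl V y z \<bullet> (idn V ?a \<odot> (evl V x y \<bullet> (idn V ?b \<odot> unc V w x (idn V ?d)) \<bullet> asc V ?b ?d w))
        \<bullet> asc V ?a (?b \<otimes> ?d) w \<bullet> (asc V ?a ?b ?d \<odot> idn V w)"
      using ob by simp
    have "unc V w z (?c w y z \<bullet> (idn V ?a \<odot> ?c w x y) \<bullet> asc V ?a ?b ?d) =
        evl V y z \<bullet> (idn V ?a \<odot> (evl V x y \<bullet> (idn V ?b \<odot> unc V w x (idn V ?d)) \<bullet> asc V ?b ?d w))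
        \<bullet> asc V ?a (?b \<otimes> ?d) w \<bullet> (asc V ?a ?b ?d \<odot> idn V w)"
      using ob by (simp add: unc_vCmp_cmp unc_def[of _ _ _ "idn V _"])
    then show "unc V w z (?c w x z \<bullet> (?c x y z \<odot> idn V (vHom (self_enriched V) w x))) =
      unc V w z (?c w y z \<bullet> (idn V (vHom (self_enriched V) y z) \<odot> ?c w x y) \<bullet>
      asc V (vHom (self_enriched V) y z) (vHom (self_enriched V) x y) (vHom (self_enriched V) w x))"
      by (simp add: l)
  qed (use ob in simp_all)
next
  fix x y assume ob: "x \<in> vOb (self_enriched V)" "y \<in> vOb (self_enriched V)"
  let ?c = "vCmp (self_enriched V)" and ?h = "ihm V x y"
  show "?c x x y \<bullet> (idn V (vHom (self_enriched V) x y) \<odot> vId (self_enriched V) x) = run V (vHom (self_enriched V) x y)"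
  proof (rule unc_inject)
    have "unc V x y (?c x x y \<bullet> (idn V ?h \<odot> nam V x x (idn V x))) = evl V x y \<bullet> (idn V ?h \<odot> lun V x) \<bullet> asc V ?h \<one> x"
      using ob by (simp add: unc_vCmp unc_def[of _ _ _ "idn V ?h"])
    also have "\<dots> = unc V x y (run V ?h)"
      using ob by (simp add: triangle unc_def)
    finally show "unc V x y (?c x x y \<bullet> (idn V (vHom (self_enriched V) x y) \<odot> vId (self_enriched V) x)) =
      unc V x y (run V (vHom (self_enriched V) x y))" by simp
  qed (use ob in simp_all)
  show "?c x y y \<bullet> (vId (self_enriched V) y \<odot> idn V (vHom (self_enriched V) x y)) = lun V (vHom (self_enriched V) x y)"
  proof (rule unc_inject)
    have "unc V x y (?c x y y \<bullet> (nam V y y (idn V y) \<odot> idn V ?h)) = (lun V y \<bullet> (idn V \<one> \<odot> evl V x y)) \<bullet> asc V \<one> ?h x"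
      using ob by (simp add: unc_vCmp unc_def[of _ _ _ "idn V ?h"])
    also have "lun V y \<bullet> (idn V \<one> \<odot> evl V x y) = evl V x y \<bullet> lun V (?h \<otimes> x)"
      using ob by (intro lun_nat) simp
    finally have "unc V x y (?c x y y \<bullet> (nam V y y (idn V y) \<odot> idn V ?h)) = unc V x y (lun V ?h)"
      using ob by (simp add: lun_asc unc_def)
    then show "unc V x y (?c x y y \<bullet> (vId (self_enriched V) y \<odot> idn V (vHom (self_enriched V) x y))) =
      unc V x y (lun V (vHom (self_enriched V) x y))" by simp
  qed (use ob in simp_all)
qed simp_all

lemma unnam_elcmp:
  assumes "a \<in> Ob V" "b \<in> Ob V" "c \<in> Ob V" "g \<in> Ar V" "Dom V g = \<one>" "Cod V g = ihm V b c"
    "f \<in> Ar V" "Dom V f = \<one>" "Cod V f = ihm V a b"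
  shows "elcmp V (self_enriched V) a b c g f \<in> Hom V \<one> (ihm V a c)"
    and "unnam V a c (elcmp V (self_enriched V) a b c g f) = unnam V b c g \<bullet> unnam V a b f"
proof -
  show "elcmp V (self_enriched V) a b c g f \<in> Hom V \<one> (ihm V a c)"
    using assms by (simp add: elcmp_def)
  have "unc V a c (elcmp V (self_enriched V) a b c g f) =
     unc V a c (vCmp (self_enriched V) a b c \<bullet> (g \<odot> f)) \<bullet> (inv_ar V (lun V \<one>) \<odot> idn V a)"
    using assms by (simp add: elcmp_def flip: unc_cmp)
  also have "\<dots> = unc V b c g \<bullet> (idn V \<one> \<odot> unc V a b f) \<bullet> asc V \<one> \<one> a \<bullet> (inv_ar V (lun V \<one>) \<odot> idn V a)"
    using assms by (simp add: unc_vCmp)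
  also have "asc V \<one> \<one> a \<bullet> (inv_ar V (lun V \<one>) \<odot> idn V a) = inv_ar V (lun V (\<one> \<otimes> a))"
    using assms by (simp add: asc_inv_lun)
  also have "unc V b c g \<bullet> (idn V \<one> \<odot> unc V a b f) \<bullet> inv_ar V (lun V (\<one> \<otimes> a)) = unc V b c g \<bullet> inv_ar V (lun V b) \<bullet> unc V a b f"
    using assms by (subst inv_lun_nat[of "unc V a b f" "\<one> \<otimes> a" b]) simp_all
  finally show "unnam V a c (elcmp V (self_enriched V) a b c g f) = unnam V b c g \<bullet> unnam V a b f"
    using assms by (simp add: unnam_eq elcmp_def)
qed

lemma vfunctor_typing:
  assumes "vfunctor V Y (self_enriched V) R"
  shows "x \<in> vOb Y \<Longrightarrow> vfo R x \<in> Ob V"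
    "x \<in> vOb Y \<Longrightarrow> y \<in> vOb Y \<Longrightarrow> vfa R x y \<in> Ar V"
    "x \<in> vOb Y \<Longrightarrow> y \<in> vOb Y \<Longrightarrow> Dom V (vfa R x y) = vHom Y x y"
    "x \<in> vOb Y \<Longrightarrow> y \<in> vOb Y \<Longrightarrow> Cod V (vfa R x y) = ihm V (vfo R x) (vfo R y)"
    "x \<in> vOb Y \<Longrightarrow> y \<in> vOb Y \<Longrightarrow> act V R x y \<in> Ar V"
    "x \<in> vOb Y \<Longrightarrow> y \<in> vOb Y \<Longrightarrow> Dom V (act V R x y) = vHom Y x y \<otimes> vfo R x"
    "x \<in> vOb Y \<Longrightarrow> y \<in> vOb Y \<Longrightarrow> Cod V (act V R x y) = vfo R y"
proof -
  interpret R: vfunctor V Y "self_enriched V" R by fact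
  show ob: "vfo R x \<in> Ob V" if "x \<in> vOb Y" for x using R.vfo_Ob that by simp
  show ar: "vfa R x y \<in> Ar V" "Dom V (vfa R x y) = vHom Y x y" "Cod V (vfa R x y) = ihm V (vfo R x) (vfo R y)"
    if "x \<in> vOb Y" "y \<in> vOb Y" for x y using R.vfa_Hom that by auto
  show "act V R x y \<in> Ar V" "Dom V (act V R x y) = vHom Y x y \<otimes> vfo R x" "Cod V (act V R x y) = vfo R y"
    if "x \<in> vOb Y" "y \<in> vOb Y"
    by (simp_all add: that ob ar act_def)
qed

lemma vfunctor_act:
  assumes "vfunctor V Y (self_enriched V) R" "x \<in> vOb Y"
  shows "act V R x x \<bullet> (vId Y x \<odot> idn V (vfo R x)) = lun V (vfo R x)"
    and "y \<in> vOb Y \<Longrightarrow> z \<in> vOb Y \<Longrightarrow> act V R x z \<bullet> (vCmp Y x y z \<odot> idn V (vfo R x)) =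
      act V R y z \<bullet> (idn V (vHom Y y z) \<odot> act V R x y) \<bullet> asc V (vHom Y y z) (vHom Y x y) (vfo R x)"
proof -
  interpret R: vfunctor V Y "self_enriched V" R by fact
  note s = assms(2) vfunctor_typing[OF assms(1)] vcategory_typing[OF R.source.vcategory_axioms]
  have "act V R x x \<bullet> (vId Y x \<odot> idn V (vfo R x)) = unc V (vfo R x) (vfo R x) (vfa R x x \<bullet> vId Y x)"
    by (simp add: s act_def unc_cmp)
  then show "act V R x x \<bullet> (vId Y x \<odot> idn V (vfo R x)) = lun V (vfo R x)"
    by (simp add: R.vfa_vId s)
  assume yz: "y \<in> vOb Y" "z \<in> vOb Y"
  have "act V R x z \<bullet> (vCmp Y x y z \<odot> idn V (vfo R x)) = unc V (vfo R x) (vfo R z) (vfa R x z \<bullet> vCmp Y x y z)"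
    by (simp add: s yz act_def unc_cmp)
  then show "act V R x z \<bullet> (vCmp Y x y z \<odot> idn V (vfo R x)) =
      act V R y z \<bullet> (idn V (vHom Y y z) \<odot> act V R x y) \<bullet> asc V (vHom Y y z) (vHom Y x y) (vfo R x)"
    by (simp add: R.vfa_vCmp s yz act_def unc_vCmp)
qed

lemma vfunctor_actI:
  assumes "vcategory V Y" "\<And>x. x \<in> vOb Y \<Longrightarrow> vfo R x \<in> Ob V"
    "\<And>x y. x \<in> vOb Y \<Longrightarrow> y \<in> vOb Y \<Longrightarrow> vfa R x y \<in> Hom V (vHom Y x y) (ihm V (vfo R x) (vfo R y))"
    "\<And>x. x \<in> vOb Y \<Longrightarrow> act V R x x \<bullet> (vId Y x \<odot> idn V (vfo R x)) = lun V (vfo R x)"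
    "\<And>x y z. x \<in> vOb Y \<Longrightarrow> y \<in> vOb Y \<Longrightarrow> z \<in> vOb Y \<Longrightarrow>
       act V R x z \<bullet> (vCmp Y x y z \<odot> idn V (vfo R x)) =
       act V R y z \<bullet> (idn V (vHom Y y z) \<odot> act V R x y) \<bullet> asc V (vHom Y y z) (vHom Y x y) (vfo R x)"
  shows "vfunctor V Y (self_enriched V) R"
proof -
  interpret Y: vcategory V Y by fact
  interpret S: vcategory V "self_enriched V" by (rule self_enriched_vcategory)
  note ob = assms(2)
  have ar: "vfa R u v \<in> Ar V" "Dom V (vfa R u v) = vHom Y u v" "Cod V (vfa R u v) = ihm V (vfo R u) (vfo R v)"
    if "u \<in> vOb Y" "v \<in> vOb Y" for u v using assms(3) that by auto
  note s = ob ar vcategory_typing[OF assms(1)]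
  show ?thesis
  proof
    fix x assume x: "x \<in> vOb Y"
    show "vfa R x x \<bullet> vId Y x = vId (self_enriched V) (vfo R x)"
    proof (rule unc_inject)
      have "unc V (vfo R x) (vfo R x) (vfa R x x \<bullet> vId Y x) = act V R x x \<bullet> (vId Y x \<odot> idn V (vfo R x))"
        using x by (simp add: s act_def unc_cmp)
      then show "unc V (vfo R x) (vfo R x) (vfa R x x \<bullet> vId Y x) =
          unc V (vfo R x) (vfo R x) (vId (self_enriched V) (vfo R x))"
        using x by (simp add: s assms(4))
    qed (use x in \<open>simp_all add: s\<close>)
  next
    fix x y z assume x: "x \<in> vOb Y" "y \<in> vOb Y" "z \<in> vOb Y"
    show "vfa R x z \<bullet> vCmp Y x y z = vCmp (self_enriched V) (vfo R x) (vfo R y) (vfo R z) \<bullet> (vfa R y z \<odot> vfa R x y)"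
    proof (rule unc_inject)
      have "unc V (vfo R x) (vfo R z) (vfa R x z \<bullet> vCmp Y x y z) = act V R x z \<bullet> (vCmp Y x y z \<odot> idn V (vfo R x))"
        using x by (simp add: s act_def unc_cmp)
      then show "unc V (vfo R x) (vfo R z) (vfa R x z \<bullet> vCmp Y x y z) =
          unc V (vfo R x) (vfo R z) (vCmp (self_enriched V) (vfo R x) (vfo R y) (vfo R z) \<bullet> (vfa R y z \<odot> vfa R x y))"
        using x assms(5)[OF x] by (simp add: s unc_vCmp act_def)
    qed (use x in \<open>simp_all add: s\<close>)
  qed (use assms(2,3) in simp_all)
qed

text \<open>
  Both sides of the naturality square are arrows \<open>Y(x,y) \<rightarrow> [S x, T y]\<close>; uncurried, they are the two
  ways around the equivariance square. The unit isomorphisms in the square are absorbed by the two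
  coherence laws for \<open>asc\<close> and the inverse unit isomorphisms.
\<close>

lemma vnat_iff_intertwines:
  assumes "vfunctor V Y (self_enriched V) S" "vfunctor V Y (self_enriched V) T"
  shows "vnat V Y (self_enriched V) S T \<alpha> \<longleftrightarrow>
    (\<forall>x \<in> vOb Y. \<alpha> x \<in> Hom V \<one> (ihm V (vfo S x) (vfo T x))) \<and>
    intertwines V Y S T (\<lambda>x. unnam V (vfo S x) (vfo T x) (\<alpha> x))"
proof -
  interpret S: vfunctor V Y "self_enriched V" S by fact
  have "vCmp (self_enriched V) (vfo S x) (vfo S y) (vfo T y) \<bullet> (\<alpha> y \<odot> vfa S x y) \<bullet> inv_ar V (lun V (vHom Y x y)) =
        vCmp (self_enriched V) (vfo S x) (vfo T x) (vfo T y) \<bullet> (vfa T x y \<odot> \<alpha> x) \<bullet> inv_ar V (run V (vHom Y x y))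
     \<longleftrightarrow> unnam V (vfo S y) (vfo T y) (\<alpha> y) \<bullet> act V S x y = act V T x y \<bullet> (idn V (vHom Y x y) \<odot> unnam V (vfo S x) (vfo T x) (\<alpha> x))"
    (is "?l = ?r \<longleftrightarrow> ?l' = ?r'")
    if "x \<in> vOb Y" "y \<in> vOb Y" and \<alpha>: "\<forall>x \<in> vOb Y. \<alpha> x \<in> Hom V \<one> (ihm V (vfo S x) (vfo T x))" for x y
  proof -
    note s = that(1,2) vfunctor_typing[OF assms(1)] vfunctor_typing[OF assms(2)] S.source.vHom_Ob
    have a: "\<alpha> u \<in> Ar V" "Dom V (\<alpha> u) = \<one>" "Cod V (\<alpha> u) = ihm V (vfo S u) (vfo T u)" if "u \<in> vOb Y" for u
      using \<alpha> that by auto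
    note st = s a
    have "unc V (vfo S x) (vfo T y) ?l =
      unc V (vfo S y) (vfo T y) (\<alpha> y) \<bullet> (idn V \<one> \<odot> act V S x y) \<bullet> asc V \<one> (vHom Y x y) (vfo S x) \<bullet> (inv_ar V (lun V (vHom Y x y)) \<odot> idn V (vfo S x))"
      by (simp add: st unc_vCmp_cmp act_def)
    also have "\<dots> = unc V (vfo S y) (vfo T y) (\<alpha> y) \<bullet> (idn V \<one> \<odot> act V S x y) \<bullet> inv_ar V (lun V (vHom Y x y \<otimes> vfo S x))"
      by (simp add: st asc_inv_lun)
    also have "\<dots> = unc V (vfo S y) (vfo T y) (\<alpha> y) \<bullet> inv_ar V (lun V (vfo S y)) \<bullet> act V S x y"
      by (subst inv_lun_nat[of "act V S x y" "vHom Y x y \<otimes> vfo S x" "vfo S y"]) (simp_all add: st)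
    finally have l: "unc V (vfo S x) (vfo T y) ?l = ?l'"
      by (simp add: st unnam_eq)
    have "unc V (vfo S x) (vfo T y) ?r =
      act V T x y \<bullet> (idn V (vHom Y x y) \<odot> unc V (vfo S x) (vfo T x) (\<alpha> x)) \<bullet> asc V (vHom Y x y) \<one> (vfo S x) \<bullet> (inv_ar V (run V (vHom Y x y)) \<odot> idn V (vfo S x))"
      by (simp add: st unc_vCmp_cmp act_def)
    also have "\<dots> = ?r'"
      by (simp add: st asc_inv_run unnam_eq)
    finally have r: "unc V (vfo S x) (vfo T y) ?r = ?r'" .
    have "?l = ?r \<longleftrightarrow> unc V (vfo S x) (vfo T y) ?l = unc V (vfo S x) (vfo T y) ?r"
      by (rule iffI, simp only:, erule unc_inject) (simp_all add: st)
    then show ?thesis by (simp only: l r)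
  qed
  then show ?thesis
    unfolding vnat_def intertwines_def self_enriched_sels by auto
qed

end

section \<open>Subobjects of representables\<close>

definition incl :: "('o, 'a, 'm) smcc_scheme \<Rightarrow> ('c, 'o, 'a) vcat \<Rightarrow> 'c \<Rightarrow> ('c, 'o, 'a) presheaf_mono \<Rightarrow> 'c \<Rightarrow> 'a" where
  "incl V Y x s y = unnam V (vfo (fst s) y) (vHom Y x y) (snd s y)"

text \<open>
  \<open>p\<close> is the restriction of the subobject \<open>s\<close> of \<open>Y(x,-)\<close> along \<open>f : v \<rightarrow> Y(x,y)\<close>, expressed by
  generalized elements: \<open>t\<close> lies in \<open>p\<close> iff the composite of \<open>t\<close> and \<open>f\<close> lies in \<open>s\<close>. This is the pullback of
  sieves with the cotensor and the Yoneda bijection eliminated; only the tensor product and the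
  composition of \<open>Y\<close> remain, and these are what a monoidal adjunction respects.
\<close>

definition restricts ::
  "('o, 'a, 'm) smcc_scheme \<Rightarrow> ('c, 'o, 'a) vcat \<Rightarrow> 'c \<Rightarrow> 'c \<Rightarrow> 'a
     \<Rightarrow> ('c, 'o, 'a) presheaf_mono \<Rightarrow> ('c, 'o, 'a) presheaf_mono \<Rightarrow> bool" where
  "restricts V Y x y f s p \<longleftrightarrow> (\<forall>z \<in> vOb Y. \<forall>t \<in> Ar V. Cod V t = vHom Y y z \<longrightarrow>
     (factors V t (incl V Y y p z) \<longleftrightarrow> factors V (vCmp Y x y z \<bullet>\<^bsub>V\<^esub> (t \<odot>\<^bsub>V\<^esub> f)) (incl V Y x s z)))"

context symmetric_monoidal_closed_category
begin

lemma representable_act: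
  assumes "vcategory V Y" "x \<in> vOb Y" "y \<in> vOb Y" "z \<in> vOb Y"
  shows "act V (representable V Y x) y z = vCmp Y x y z"
  using assms(2-) by (simp add: act_def representable_def vcategory_typing[OF assms(1)])

lemma representable_vfunctor:
  assumes Y: "vcategory V Y" and x: "x \<in> vOb Y"
  shows "vfunctor V Y (self_enriched V) (representable V Y x)"
proof -
  interpret Y: vcategory V Y by (rule Y)
  note s = x vcategory_typing[OF Y] representable_act[OF Y x]
  show ?thesis
  proof (rule vfunctor_actI[OF Y])
    fix y z assume "y \<in> vOb Y" "z \<in> vOb Y"
    then show "vfa (representable V Y x) y z \<in> Hom V (vHom Y y z) (ihm V (vfo (representable V Y x) y) (vfo (representable V Y x) z))"
      by (simp add: s) (simp add: s representable_def)
  next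
    fix y assume "y \<in> vOb Y"
    then show "act V (representable V Y x) y y \<bullet> (vId Y y \<odot> idn V (vfo (representable V Y x) y)) = lun V (vfo (representable V Y x) y)"
      by (simp add: s Y.vId_vCmp)
  next
    fix u y z assume "u \<in> vOb Y" "y \<in> vOb Y" "z \<in> vOb Y"
    then show "act V (representable V Y x) u z \<bullet> (vCmp Y u y z \<odot> idn V (vfo (representable V Y x) u)) =
       act V (representable V Y x) y z \<bullet> (idn V (vHom Y y z) \<odot> act V (representable V Y x) u y) \<bullet>
         asc V (vHom Y y z) (vHom Y u y) (vfo (representable V Y x) u)"
      by (simp add: s Y.vCmp_assoc)
  qed (simp add: s)
qed

lemma mono_into_rep_iff:
  assumes Y: "vcategory V Y" and x: "x \<in> vOb Y"
  shows "mono_into_rep V Y x s \<longleftrightarrow> vfunctor V Y (self_enriched V) (fst s) \<and>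
    (\<forall>y \<in> vOb Y. snd s y \<in> Hom V \<one> (ihm V (vfo (fst s) y) (vHom Y x y))) \<and>
    intertwines V Y (fst s) (representable V Y x) (incl V Y x s) \<and>
    (\<forall>y \<in> vOb Y. monic V (incl V Y x s y))"
proof (cases s)
  case (Pair R m)
  have i: "incl V Y x (R, m) = (\<lambda>y. unnam V (vfo R y) (vHom Y x y) (m y))"
    by (simp add: incl_def fun_eq_iff)
  show ?thesis
    using vnat_iff_intertwines[OF _ representable_vfunctor[OF Y x], of R m]
    unfolding Pair mono_into_rep_def fst_conv snd_conv i prod.case representable_sels by blast
qed

lemma incl_simps:
  assumes "vcategory V Y" "x \<in> vOb Y" "mono_into_rep V Y x s" "y \<in> vOb Y"
  shows "incl V Y x s y \<in> Ar V" "Dom V (incl V Y x s y) = vfo (fst s) y" "Cod V (incl V Y x s y) = vHom Y x y"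
proof -
  have s: "vfunctor V Y (self_enriched V) (fst s)" "snd s y \<in> Hom V \<one> (ihm V (vfo (fst s) y) (vHom Y x y))"
    using assms(3,4) by (auto simp: mono_into_rep_iff[OF assms(1,2)])
  show "incl V Y x s y \<in> Ar V" "Dom V (incl V Y x s y) = vfo (fst s) y" "Cod V (incl V Y x s y) = vHom Y x y"
    using s(2) assms(2,4) by (simp_all add: incl_def vfunctor_typing[OF s(1)] vcategory_typing[OF assms(1)])
qed

lemma incl_monic: "vcategory V Y \<Longrightarrow> x \<in> vOb Y \<Longrightarrow> mono_into_rep V Y x s \<Longrightarrow> y \<in> vOb Y \<Longrightarrow> monic V (incl V Y x s y)"
  by (simp add: mono_into_rep_iff)

lemma incl_natural:
  assumes "vcategory V Y" "x \<in> vOb Y" "mono_into_rep V Y x s" "y \<in> vOb Y" "z \<in> vOb Y"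
  shows "incl V Y x s z \<bullet> act V (fst s) y z = vCmp Y x y z \<bullet> (idn V (vHom Y y z) \<odot> incl V Y x s y)"
  using assms(3-) by (simp add: mono_into_rep_iff[OF assms(1,2)] intertwines_def representable_act[OF assms(1,2)])

text \<open>
  A family that becomes natural after composition with a natural monomorphism is natural: both ways
  around its square agree after the monic \<open>n z\<close>.
\<close>

lemma intertwines_through_monic:
  assumes Y: "vcategory V Y"
    and R: "vfunctor V Y (self_enriched V) R" and S: "vfunctor V Y (self_enriched V) S" and B: "vfunctor V Y (self_enriched V) B"
    and h: "\<And>y. y \<in> vOb Y \<Longrightarrow> h y \<in> Hom V (vfo R y) (vfo S y)"
    and n: "\<And>y. y \<in> vOb Y \<Longrightarrow> n y \<in> Hom V (vfo S y) (vfo B y)"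
    and monic: "\<And>y. y \<in> vOb Y \<Longrightarrow> monic V (n y)"
    and SB: "intertwines V Y S B n" and RB: "intertwines V Y R B (\<lambda>y. n y \<bullet> h y)"
  shows "intertwines V Y R S h"
  unfolding intertwines_def
proof (intro ballI)
  fix y z assume yz: "y \<in> vOb Y" "z \<in> vOb Y"
  have ty: "h u \<in> Ar V" "Dom V (h u) = vfo R u" "Cod V (h u) = vfo S u" 
    "n u \<in> Ar V" "Dom V (n u) = vfo S u" "Cod V (n u) = vfo B u" if "u \<in> vOb Y" for u
    using h n that by simp_all
  note s = yz ty vfunctor_typing[OF R] vfunctor_typing[OF S] vfunctor_typing[OF B] vcategory_typing[OF Y]
  show "h z \<bullet> act V R y z = act V S y z \<bullet> (idn V (vHom Y y z) \<odot> h y)"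
  proof (rule monicD[OF monic[OF yz(2)]])
    have "n z \<bullet> h z \<bullet> act V R y z = (n z \<bullet> h z) \<bullet> act V R y z"
      by (simp add: s)
    also have "\<dots> = act V B y z \<bullet> (idn V (vHom Y y z) \<odot> (n y \<bullet> h y))"
      using RB yz unfolding intertwines_def by blast
    also have "\<dots> = (act V B y z \<bullet> (idn V (vHom Y y z) \<odot> n y)) \<bullet> (idn V (vHom Y y z) \<odot> h y)"
      by (simp add: s)
    also have "act V B y z \<bullet> (idn V (vHom Y y z) \<odot> n y) = n z \<bullet> act V S y z"
      using SB yz unfolding intertwines_def by simp
    finally show "n z \<bullet> h z \<bullet> act V R y z = n z \<bullet> act V S y z \<bullet> (idn V (vHom Y y z) \<odot> h y)"
      by (simp add: s)
  qed (simp_all add: s)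
qed

lemma vnat_of_factorization:
  assumes Y: "vcategory V Y" and x: "x \<in> vOb Y" and s: "mono_into_rep V Y x s" and t: "mono_into_rep V Y x t"
    and h: "\<And>y. y \<in> vOb Y \<Longrightarrow> h y \<in> Hom V (vfo (fst s) y) (vfo (fst t) y) \<and> incl V Y x t y \<bullet> h y = incl V Y x s y"
  shows "vnat V Y (self_enriched V) (fst s) (fst t) (\<lambda>y. nam V (vfo (fst s) y) (vfo (fst t) y) (h y))"
proof -
  have fs: "vfunctor V Y (self_enriched V) (fst s)" and ft: "vfunctor V Y (self_enriched V) (fst t)"
    using s t by (simp_all add: mono_into_rep_iff[OF Y x])
  have "intertwines V Y (fst s) (fst t) h"
  proof (rule intertwines_through_monic[OF Y fs ft representable_vfunctor[OF Y x]])
    show "intertwines V Y (fst t) (representable V Y x) (incl V Y x t)"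
      using t by (simp add: mono_into_rep_iff[OF Y x])
    have "intertwines V Y (fst s) (representable V Y x) (incl V Y x s)"
      using s by (simp add: mono_into_rep_iff[OF Y x])
    then show "intertwines V Y (fst s) (representable V Y x) (\<lambda>y. incl V Y x t y \<bullet> h y)"
      using h by (simp add: intertwines_def)
  qed (use h in \<open>simp_all add: incl_simps[OF Y x t] incl_monic[OF Y x t]\<close>)
  then show ?thesis
    using h unfolding vnat_iff_intertwines[OF fs ft] by (auto simp: intertwines_def)
qed

text \<open>
  Isomorphism of subobjects is a pointwise matter. Components of a comparison between two monomorphisms
  into \<open>Y(x,-)\<close> exist by factorization, are natural because the target inclusion is monic, and are
  mutually inverse for the same reason. All later statements about sieves therefore only need to
  compare which arrows factor through the components.
\<close>

lemma mono_equiv_iff: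
  assumes Y: "vcategory V Y" and x: "x \<in> vOb Y"
  shows "mono_equiv V Y x s t \<longleftrightarrow> mono_into_rep V Y x s \<and> mono_into_rep V Y x t \<and>
    (\<forall>y \<in> vOb Y. factors V (incl V Y x s y) (incl V Y x t y) \<and> factors V (incl V Y x t y) (incl V Y x s y))"
    (is "?l \<longleftrightarrow> ?ms \<and> ?mt \<and> ?f")
proof -
  obtain R m where s: "s = (R, m)" by (cases s)
  obtain S n where t: "t = (S, n)" by (cases t)
  show ?thesis
  proof (cases "?ms \<and> ?mt")
    case False
    then show ?thesis by (auto simp: mono_equiv_def s t)
  next
    case True
    then have ms: ?ms and mt: ?mt by auto
    have fs: "vfunctor V Y (self_enriched V) R" and ft: "vfunctor V Y (self_enriched V) S"
      and m: "\<And>y. y \<in> vOb Y \<Longrightarrow> m y \<in> Hom V \<one> (ihm V (vfo R y) (vHom Y x y))"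
      and n: "\<And>y. y \<in> vOb Y \<Longrightarrow> n y \<in> Hom V \<one> (ihm V (vfo S y) (vHom Y x y))"
      using ms mt by (simp_all add: mono_into_rep_iff[OF Y x] s t)
    have js: "incl V Y x s y = unnam V (vfo R y) (vHom Y x y) (m y)"
      and it: "incl V Y x t y = unnam V (vfo S y) (vHom Y x y) (n y)" for y
      by (simp_all add: incl_def s t)
    have ty: "m y \<in> Ar V" "Dom V (m y) = \<one>" "Cod V (m y) = ihm V (vfo R y) (vHom Y x y)"
      "n y \<in> Ar V" "Dom V (n y) = \<one>" "Cod V (n y) = ihm V (vfo S y) (vHom Y x y)" if "y \<in> vOb Y" for y
      using m[OF that] n[OF that] by simp_all
    note st = x ty vfunctor_typing[OF fs] vfunctor_typing[OF ft] vcategory_typing[OF Y]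
    have ims: "incl V Y x s y \<in> Ar V" "Dom V (incl V Y x s y) = vfo R y" "Cod V (incl V Y x s y) = vHom Y x y"
      and imt: "incl V Y x t y \<in> Ar V" "Dom V (incl V Y x t y) = vfo S y" "Cod V (incl V Y x t y) = vHom Y x y"
      if "y \<in> vOb Y" for y
      using incl_simps[OF Y x ms that] incl_simps[OF Y x mt that] by (simp_all add: s t)
    have ?f if ?l
    proof -
      from that obtain i j where i: "vnat V Y (self_enriched V) R S i" and j: "vnat V Y (self_enriched V) S R j"
        and ij: "\<And>y. y \<in> vOb Y \<Longrightarrow> elcmp V (self_enriched V) (vfo S y) (vfo R y) (vfo S y) (i y) (j y) = vId (self_enriched V) (vfo S y)"
        and e: "\<And>y. y \<in> vOb Y \<Longrightarrow> elcmp V (self_enriched V) (vfo R y) (vfo S y) (vHom Y x y) (n y) (i y) = m y"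
        unfolding mono_equiv_def vnat_iso_def s t by blast
      show ?f
      proof
        fix y assume y: "y \<in> vOb Y"
        have "i y \<in> Hom V \<one> (ihm V (vfo R y) (vfo S y))" "j y \<in> Hom V \<one> (ihm V (vfo S y) (vfo R y))"
          using i j y unfolding vnat_def self_enriched_sels by blast+
        then have ty: "i y \<in> Ar V" "Dom V (i y) = \<one>" "Cod V (i y) = ihm V (vfo R y) (vfo S y)"
          "j y \<in> Ar V" "Dom V (j y) = \<one>" "Cod V (j y) = ihm V (vfo S y) (vfo R y)" by simp_all
        let ?i = "unnam V (vfo R y) (vfo S y) (i y)" and ?j = "unnam V (vfo S y) (vfo R y) (j y)"
        have ni: "incl V Y x t y \<bullet> ?i = incl V Y x s y"
          unfolding js it e[OF y, symmetric] using y by (subst unnam_elcmp(2)) (simp_all add: st ty)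
        have "?i \<bullet> ?j = unnam V (vfo S y) (vfo S y) (vId (self_enriched V) (vfo S y))"
          unfolding ij[OF y, symmetric] using y by (subst unnam_elcmp(2)) (simp_all add: st ty)
        then have inv: "?i \<bullet> ?j = idn V (vfo S y)" using y by (simp add: st)
        have "incl V Y x s y \<bullet> ?j = incl V Y x t y \<bullet> ?i \<bullet> ?j"
          unfolding ni[symmetric] using y by (simp add: st ty imt)
        then have mj: "incl V Y x s y \<bullet> ?j = incl V Y x t y"
          using y by (simp add: inv imt)
        show "factors V (incl V Y x s y) (incl V Y x t y) \<and> factors V (incl V Y x t y) (incl V Y x s y)"
          using factorsI[OF _ _ _ ni] factorsI[OF _ _ _ mj] y
          by (simp add: ims imt st ty)
      qed
    qed
    moreover have ?l if f: ?f
    proof -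
      have "\<exists>h. h \<in> Hom V (vfo R y) (vfo S y) \<and> incl V Y x t y \<bullet> h = incl V Y x s y" if "y \<in> vOb Y" for y
        using bspec[OF f that] unfolding factors_def ims(2)[OF that] imt(2)[OF that] by blast
      then obtain h where h: "\<And>y. y \<in> vOb Y \<Longrightarrow> h y \<in> Hom V (vfo R y) (vfo S y)"
          "\<And>y. y \<in> vOb Y \<Longrightarrow> incl V Y x t y \<bullet> h y = incl V Y x s y" by metis
      have "\<exists>h. h \<in> Hom V (vfo S y) (vfo R y) \<and> incl V Y x s y \<bullet> h = incl V Y x t y" if "y \<in> vOb Y" for y
        using bspec[OF f that] unfolding factors_def ims(2)[OF that] imt(2)[OF that] by blast
      then obtain k where k: "\<And>y. y \<in> vOb Y \<Longrightarrow> k y \<in> Hom V (vfo S y) (vfo R y)"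
          "\<And>y. y \<in> vOb Y \<Longrightarrow> incl V Y x s y \<bullet> k y = incl V Y x t y" by metis
      let ?i = "\<lambda>y. nam V (vfo R y) (vfo S y) (h y)" and ?j = "\<lambda>y. nam V (vfo S y) (vfo R y) (k y)"
      have i: "vnat V Y (self_enriched V) R S ?i"
        using vnat_of_factorization[OF Y x ms mt, of h] h by (simp add: s t)
      have j: "vnat V Y (self_enriched V) S R ?j"
        using vnat_of_factorization[OF Y x mt ms, of k] k by (simp add: s t)
      have *: "elcmp V (self_enriched V) a b c (nam V b c g) (nam V a b f) = nam V a c (g \<bullet> f)"
        if "f \<in> Hom V a b" "g \<in> Hom V b c" for a b c f g
      proof -
        have ob: "a \<in> Ob V" "b \<in> Ob V" "c \<in> Ob V" using that Dom_Ob Cod_Ob by (auto simp del: Dom_Ob Cod_Ob)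
        note el = unnam_elcmp[OF ob, of "nam V b c g" "nam V a b f"]
        show ?thesis
        proof (rule unc_inject)
          show "unc V a c (elcmp V (self_enriched V) a b c (nam V b c g) (nam V a b f)) = unc V a c (nam V a c (g \<bullet> f))"
            using el ob that by (simp add: unc_elt)
        qed (use el ob that in simp_all)
      qed
      \<comment> \<open>The comparisons are mutually inverse because the inclusions are monic.\<close>
      have hk: "h y \<bullet> k y = idn V (vfo S y)" "k y \<bullet> h y = idn V (vfo R y)" if y: "y \<in> vOb Y" for y
      proof -
        have ty: "h y \<in> Ar V" "Dom V (h y) = vfo R y" "Cod V (h y) = vfo S y"
          "k y \<in> Ar V" "Dom V (k y) = vfo S y" "Cod V (k y) = vfo R y" using h(1)[OF y] k(1)[OF y] by simp_all
        have "(incl V Y x t y \<bullet> h y) \<bullet> k y = incl V Y x t y" "(incl V Y x s y \<bullet> k y) \<bullet> h y = incl V Y x s y"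
          unfolding h(2)[OF y] k(2)[OF y] by simp_all
        then have "incl V Y x t y \<bullet> h y \<bullet> k y = incl V Y x t y \<bullet> idn V (vfo S y)"
          "incl V Y x s y \<bullet> k y \<bullet> h y = incl V Y x s y \<bullet> idn V (vfo R y)"
          using y by (simp_all add: imt ims ty)
        note eqs = this
        show "h y \<bullet> k y = idn V (vfo S y)"
          using y by (intro monicD[OF incl_monic[OF Y x mt y] eqs(1)]) (simp_all add: imt ty st)
        show "k y \<bullet> h y = idn V (vfo R y)"
          using y by (intro monicD[OF incl_monic[OF Y x ms y] eqs(2)]) (simp_all add: ims ty st)
      qed
      have iso: "vnat_iso V Y (self_enriched V) R S ?i"
        unfolding vnat_iso_def using i j h(1) k(1) hk by (intro conjI exI[of _ ?j]) (simp_all add: *)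
      have "elcmp V (self_enriched V) (vfo R y) (vfo S y) (vHom Y x y) (n y) (?i y) = m y" if y: "y \<in> vOb Y" for y
      proof (rule unc_inject)
        have ob: "vfo R y \<in> Ob V" "vfo S y \<in> Ob V" "vHom Y x y \<in> Ob V" using y by (simp_all add: st)
        have ty': "h y \<in> Ar V" "Dom V (h y) = vfo R y" "Cod V (h y) = vfo S y" using h(1)[OF y] by simp_all
        have ni: "?i y \<in> Ar V" "Dom V (?i y) = \<one>" "Cod V (?i y) = ihm V (vfo R y) (vfo S y)" using ty' by simp_all
        note el = unnam_elcmp[OF ob ty(4-6)[OF y] ni]
        show "unc V (vfo R y) (vHom Y x y) (elcmp V (self_enriched V) (vfo R y) (vfo S y) (vHom Y x y) (n y) (?i y)) =
            unc V (vfo R y) (vHom Y x y) (m y)"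
          using el ob y ty' h(2)[OF y] by (simp add: unc_elt st js it)
        show "elcmp V (self_enriched V) (vfo R y) (vfo S y) (vHom Y x y) (n y) (?i y) \<in> Ar V"
          "Cod V (elcmp V (self_enriched V) (vfo R y) (vfo S y) (vHom Y x y) (n y) (?i y)) = ihm V (vfo R y) (vHom Y x y)"
          "Dom V (elcmp V (self_enriched V) (vfo R y) (vfo S y) (vHom Y x y) (n y) (?i y)) = Dom V (m y)"
          using el y by (simp_all add: st)
      qed (use y in \<open>simp_all add: st\<close>)
      then show ?l using iso True unfolding mono_equiv_def s t by blast
    qed
    ultimately show ?thesis using True by blast
  qed
qed

lemma mono_equiv_refl:
  assumes "vcategory V Y" "x \<in> vOb Y" "mono_into_rep V Y x s"
  shows "mono_equiv V Y x s s"
  using assms(3) by (simp add: mono_equiv_iff[OF assms(1,2)] factors_refl incl_simps[OF assms])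

lemma mono_equiv_sym:
  assumes "vcategory V Y" "x \<in> vOb Y" "mono_equiv V Y x s t"
  shows "mono_equiv V Y x t s"
  using assms(3) by (auto simp: mono_equiv_iff[OF assms(1,2)])

lemma mono_equiv_trans:
  assumes Y: "vcategory V Y" and x: "x \<in> vOb Y" and st: "mono_equiv V Y x s t" and tu: "mono_equiv V Y x t u"
  shows "mono_equiv V Y x s u"
proof -
  have "mono_into_rep V Y x s" "mono_into_rep V Y x t" "mono_into_rep V Y x u"
    using st tu by (simp_all add: mono_equiv_iff[OF Y x])
  then show ?thesis
    using st tu unfolding mono_equiv_iff[OF Y x] by (blast intro: factors_trans incl_simps(1)[OF Y x])
qed

end

section \<open>Pullback of sieves\<close>

lemma comp_vfunctor_sels [simp]:
  "vfo (comp_vfunctor V T S) x = vfo T (vfo S x)"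
  "vfa (comp_vfunctor V T S) x y = vfa T (vfo S x) (vfo S y) \<bullet>\<^bsub>V\<^esub> vfa S x y"
  by (simp_all add: comp_vfunctor_def)

lemma cotensor_sels [simp]: "vfo (cotensor W v B) z = ihm W v (vfo B z)"
  by (simp add: cotensor_def)

context monoidal_category
begin

lemma comp_vfunctor_vfunctor:
  assumes "vfunctor V X Y S" "vfunctor V Y Z T"
  shows "vfunctor V X Z (comp_vfunctor V T S)"
proof -
  interpret S: vfunctor V X Y S by fact
  interpret T: vfunctor V Y Z T by fact
  note st = vcategory_typing[OF S.source.vcategory_axioms] vcategory_typing[OF S.target.vcategory_axioms]
    vcategory_typing[OF T.target.vcategory_axioms] S.vfo_Ob T.vfo_Ob
  have s: "vfa S x y \<in> Ar V" "Dom V (vfa S x y) = vHom X x y" "Cod V (vfa S x y) = vHom Y (vfo S x) (vfo S y)"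
    if "x \<in> vOb X" "y \<in> vOb X" for x y using S.vfa_Hom that by simp_all
  have t: "vfa T x y \<in> Ar V" "Dom V (vfa T x y) = vHom Y x y" "Cod V (vfa T x y) = vHom Z (vfo T x) (vfo T y)"
    if "x \<in> vOb Y" "y \<in> vOb Y" for x y using T.vfa_Hom that by simp_all
  show ?thesis
  proof
    fix x y z assume x: "x \<in> vOb X" "y \<in> vOb X" "z \<in> vOb X"
    have "vfa (comp_vfunctor V T S) x z \<bullet> vCmp X x y z = vfa T (vfo S x) (vfo S z) \<bullet> vfa S x z \<bullet> vCmp X x y z"
      using x by (simp add: st s t)
    also have "\<dots> = (vfa T (vfo S x) (vfo S z) \<bullet> vCmp Y (vfo S x) (vfo S y) (vfo S z)) \<bullet> (vfa S y z \<odot> vfa S x y)"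
      using x by (simp add: st s t S.vfa_vCmp)
    also have "\<dots> = vCmp Z (vfo T (vfo S x)) (vfo T (vfo S y)) (vfo T (vfo S z)) \<bullet>
        ((vfa T (vfo S y) (vfo S z) \<bullet> vfa S y z) \<odot> (vfa T (vfo S x) (vfo S y) \<bullet> vfa S x y))"
      using x by (simp add: st s t T.vfa_vCmp)
    finally show "vfa (comp_vfunctor V T S) x z \<bullet> vCmp X x y z =
       vCmp Z (vfo (comp_vfunctor V T S) x) (vfo (comp_vfunctor V T S) y) (vfo (comp_vfunctor V T S) z) \<bullet>
       (vfa (comp_vfunctor V T S) y z \<odot> vfa (comp_vfunctor V T S) x y)"
      by simp
  qed (simp_all add: st s t S.vfa_vId T.vfa_vId)
qed

end

context symmetric_monoidal_closed_category
begin

lemma cotensor_vfunctor: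
  assumes "vfunctor V Y (self_enriched V) S" "v \<in> Ob V"
  shows "vfunctor V Y (self_enriched V) (cotensor V v S)"
  unfolding cotensor_def
  by (rule comp_vfunctor_vfunctor[OF assms(1) representable_vfunctor[OF self_enriched_vcategory]]) (simp add: assms)

text \<open>
  In uncurried form, the action of \<open>{v, S}\<close> is the action of \<open>S\<close> with \<open>v\<close> carried along.
\<close>

lemma unc_cotensor_act:
  assumes S: "vfunctor V Y (self_enriched V) S" and v: "v \<in> Ob V" and yz: "y \<in> vOb Y" "z \<in> vOb Y"
    and k: "k \<in> Ar V" "Cod V k = ihm V v (vfo S y)" "j \<in> Ar V" "Cod V j = vHom Y y z"
  shows "unc V v (vfo S z) (act V (cotensor V v S) y z \<bullet> (j \<odot> k)) =
    act V S y z \<bullet> (j \<odot> unc V v (vfo S y) k) \<bullet> asc V (Dom V j) (Dom V k) v"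
proof -
  have "vcategory V Y" using S by (simp add: vfunctor_def)
  note s = v yz vfunctor_typing[OF S] vcategory_typing[OF this] k
  let ?a = "vfo S y" and ?b = "vfo S z"
  have "act V (cotensor V v S) y z =
    unc V (ihm V v ?a) (ihm V v ?b) (vfa (representable V (self_enriched V) v) ?a ?b) \<bullet> (vfa S y z \<odot> idn V (ihm V v ?a))"
    by (simp add: act_def cotensor_def s unc_cmp representable_def)
  also have "\<dots> = vCmp (self_enriched V) v ?a ?b \<bullet> (vfa S y z \<odot> idn V (ihm V v ?a))"
    by (simp add: s representable_def)
  finally have "act V (cotensor V v S) y z \<bullet> (j \<odot> k) = vCmp (self_enriched V) v ?a ?b \<bullet> ((vfa S y z \<bullet> j) \<odot> k)"
    by (simp add: s)
  then show ?thesis by (simp add: s unc_vCmp) (simp add: s unc_cmp act_def)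
qed

text \<open>
  The component of \<open>{v, A} \<Rightarrow> {v, B}\<close> is postcomposition \<open>[v, \<alpha>]\<close>, characterized by its effect on
  generalized elements.
\<close>

lemma unnam_cotensor_map:
  assumes "v \<in> Ob V" "a = vfo A z" "b = vfo B z" "a \<in> Ob V" "b \<in> Ob V" "\<alpha> z \<in> Hom V \<one> (ihm V a b)"
  defines "e \<equiv> unnam V (ihm V v a) (ihm V v b) (cotensor_map V v A B \<alpha> z)"
  shows "e \<in> Ar V" "Dom V e = ihm V v a" "Cod V e = ihm V v b"
    "k \<in> Ar V \<Longrightarrow> Cod V k = ihm V v a \<Longrightarrow> unc V v b (e \<bullet> k) = unnam V a b (\<alpha> z) \<bullet> unc V v a k"
proof -
  have al: "\<alpha> z \<in> Ar V" "Dom V (\<alpha> z) = \<one>" "Cod V (\<alpha> z) = ihm V a b" using assms by simp_all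
  have c: "cotensor_map V v A B \<alpha> z =
      cur V (ihm V a b) (ihm V v a) (ihm V v b) (vCmp (self_enriched V) v a b) \<bullet> \<alpha> z"
    by (simp add: cotensor_map_def representable_def flip: assms(2,3))
  have e: "e = vCmp (self_enriched V) v a b \<bullet> (\<alpha> z \<odot> idn V (ihm V v a)) \<bullet> inv_ar V (lun V (ihm V v a))"
    unfolding e_def c using assms(1,4,5) al by (simp add: unnam_eq unc_cmp)
  show "e \<in> Ar V" "Dom V e = ihm V v a" "Cod V e = ihm V v b"
    unfolding e using assms(1,4,5) al by simp_all
  assume k: "k \<in> Ar V" "Cod V k = ihm V v a"
  have "unc V v b (e \<bullet> k) = unc V v b (vCmp (self_enriched V) v a b \<bullet> (\<alpha> z \<odot> idn V (ihm V v a)) \<bullet> (inv_ar V (lun V (ihm V v a)) \<bullet> k))"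
    unfolding e using assms(1,4,5) al k by simp
  also have "inv_ar V (lun V (ihm V v a)) \<bullet> k = (idn V \<one> \<odot> k) \<bullet> inv_ar V (lun V (Dom V k))"
    using k by (intro inv_lun_nat) simp_all
  also have "vCmp (self_enriched V) v a b \<bullet> (\<alpha> z \<odot> idn V (ihm V v a)) \<bullet> (idn V \<one> \<odot> k) \<bullet> inv_ar V (lun V (Dom V k)) =
     vCmp (self_enriched V) v a b \<bullet> (\<alpha> z \<odot> k) \<bullet> inv_ar V (lun V (Dom V k))"
    using assms(1,4,5) al k by simp
  also have "unc V v b (vCmp (self_enriched V) v a b \<bullet> (\<alpha> z \<odot> k) \<bullet> inv_ar V (lun V (Dom V k))) =
     unc V a b (\<alpha> z) \<bullet> (idn V \<one> \<odot> unc V v a k) \<bullet> asc V \<one> (Dom V k) v \<bullet> (inv_ar V (lun V (Dom V k)) \<odot> idn V v)"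
    using assms(1,4,5) al k by (simp add: unc_vCmp_cmp)
  also have "\<dots> = unc V a b (\<alpha> z) \<bullet> (idn V \<one> \<odot> unc V v a k) \<bullet> inv_ar V (lun V (Dom V k \<otimes> v))"
    using assms(1) k by (simp add: asc_inv_lun)
  also have "(idn V \<one> \<odot> unc V v a k) \<bullet> inv_ar V (lun V (Dom V k \<otimes> v)) = inv_ar V (lun V a) \<bullet> unc V v a k"
    using assms(1,4) k by (intro inv_lun_nat[symmetric]) simp_all
  finally show "unc V v b (e \<bullet> k) = unnam V a b (\<alpha> z) \<bullet> unc V v a k"
    using assms(1,4,5) al k by (simp add: unnam_eq)
qed

text \<open>
  The component at \<open>z\<close> of \<open>Y(y,-) \<Rightarrow> {v, Y(x,-)}\<close> sends a generalized element \<open>k\<close> of \<open>Y(y,z)\<close> to the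
  curried composite of \<open>k\<close> and \<open>f\<close>.
\<close>

lemma unnam_yoneda_cotensor:
  assumes Y: "vcategory V Y" and ob: "x \<in> vOb Y" "y \<in> vOb Y" "z \<in> vOb Y"
    and f: "f \<in> Ar V" "Dom V f = v" "Cod V f = vHom Y x y"
  defines "e \<equiv> unnam V (vHom Y y z) (ihm V v (vHom Y x z))
    (yoneda V Y (cotensor V v (representable V Y x)) y (nam V v (vHom Y x y) f) z)"
  shows "e \<in> Ar V" "Dom V e = vHom Y y z" "Cod V e = ihm V v (vHom Y x z)"
    "k \<in> Ar V \<Longrightarrow> Cod V k = vHom Y y z \<Longrightarrow> unc V v (vHom Y x z) (e \<bullet> k) = vCmp Y x y z \<bullet> (k \<odot> f)"
proof -
  let ?P = "cotensor V v (representable V Y x)" and ?n = "nam V v (vHom Y x y) f" and ?h = "vHom Y y z"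
  have v: "v \<in> Ob V" using f by auto
  note rf = representable_vfunctor[OF Y ob(1)]
  note s = v ob f vcategory_typing[OF Y] vfunctor_typing[OF cotensor_vfunctor[OF rf v]]
  have "yoneda V Y ?P y ?n z =
      nam V ?h (ihm V v (vHom Y x z)) (evl V (vfo ?P y) (vfo ?P z) \<bullet> (vfa ?P y z \<odot> ?n) \<bullet> inv_ar V (run V ?h))"
    by (simp add: yoneda_def)
  also have "evl V (vfo ?P y) (vfo ?P z) \<bullet> (vfa ?P y z \<odot> ?n) \<bullet> inv_ar V (run V ?h) =
      (evl V (vfo ?P y) (vfo ?P z) \<bullet> (vfa ?P y z \<odot> ?n)) \<bullet> inv_ar V (run V ?h)"
    using s by simp
  also have "\<dots> = act V ?P y z \<bullet> (idn V ?h \<odot> ?n) \<bullet> inv_ar V (run V ?h)"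
    by (subst evl_tar) (use s in \<open>simp_all add: act_def\<close>)
  finally have "e = unnam V ?h (ihm V v (vHom Y x z)) (nam V ?h (ihm V v (vHom Y x z)) (act V ?P y z \<bullet> (idn V ?h \<odot> ?n) \<bullet> inv_ar V (run V ?h)))"
    unfolding e_def by simp
  then have e: "e = act V ?P y z \<bullet> (idn V ?h \<odot> ?n) \<bullet> inv_ar V (run V ?h)"
    using s by simp
  show "e \<in> Ar V" "Dom V e = vHom Y y z" "Cod V e = ihm V v (vHom Y x z)"
    unfolding e using s by simp_all
  assume k: "k \<in> Ar V" "Cod V k = vHom Y y z"
  have "e \<bullet> k = act V ?P y z \<bullet> (idn V ?h \<odot> ?n) \<bullet> inv_ar V (run V ?h) \<bullet> k"
    unfolding e using s k by simp
  also have "inv_ar V (run V ?h) \<bullet> k = (k \<odot> idn V \<one>) \<bullet> inv_ar V (run V (Dom V k))"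
    using k by (intro inv_run_nat) simp_all
  also have "act V ?P y z \<bullet> (idn V ?h \<odot> ?n) \<bullet> (k \<odot> idn V \<one>) \<bullet> inv_ar V (run V (Dom V k)) =
      (act V ?P y z \<bullet> (k \<odot> ?n)) \<bullet> inv_ar V (run V (Dom V k))"
    using s k by simp
  finally have "unc V v (vHom Y x z) (e \<bullet> k) = unc V v (vHom Y x z) (act V ?P y z \<bullet> (k \<odot> ?n)) \<bullet> (inv_ar V (run V (Dom V k)) \<odot> idn V v)"
    using s k by (simp only:) (subst unc_cmp, simp_all)
  also have "unc V v (vHom Y x z) (act V ?P y z \<bullet> (k \<odot> ?n)) = vCmp Y x y z \<bullet> (k \<odot> (f \<bullet> lun V v)) \<bullet> asc V (Dom V k) \<one> v"
    using unc_cotensor_act[OF rf v ob(2,3), of ?n k] s k by (simp add: representable_act[OF Y])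
  also have "(vCmp Y x y z \<bullet> (k \<odot> (f \<bullet> lun V v)) \<bullet> asc V (Dom V k) \<one> v) \<bullet> (inv_ar V (run V (Dom V k)) \<odot> idn V v) = vCmp Y x y z \<bullet> (k \<odot> f)"
    using s k by (simp add: asc_inv_run)
  finally show "unc V v (vHom Y x z) (e \<bullet> k) = vCmp Y x y z \<bullet> (k \<odot> f)" .
qed

lemma factorization_through_monic_unique:
  assumes "monic V m" "h \<in> Hom V a (Dom V m)" "m \<bullet> h = g"
  shows "\<exists>!h. h \<in> Hom V a (Dom V m) \<and> m \<bullet> h = g"
proof (intro ex1I[of _ h])
  fix k assume "k \<in> Hom V a (Dom V m) \<and> m \<bullet> k = g"
  then have k: "k \<in> Ar V" "Dom V k = a" "Cod V k = Dom V m" "m \<bullet> k = g" by simp_all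
  have "m \<bullet> k = m \<bullet> h" using k(4) assms(3) by simp
  then show "k = h" by (rule monicD[OF assms(1)]) (use k(1-3) assms(2) in simp_all)
qed (use assms in simp)

text \<open>
  Arrows into \<open>[v, S z]\<close> are arrows out of a tensor product with \<open>v\<close>, and commutativity of a square over
  \<open>[v, Y(x,z)]\<close> can be tested after uncurrying. Since \<open>p\<close>, \<open>s\<close> and hence \<open>[v, s]\<close> are monic, the uniqueness
  half of the universal property is automatic, and existence is a statement about factorizations.
\<close>

lemma is_pullback_restricts:
  assumes Y: "vcategory V Y" and ob: "x \<in> vOb Y" "y \<in> vOb Y" "z \<in> vOb Y"
    and f: "f \<in> Ar V" "Dom V f = v" "Cod V f = vHom Y x y"
    and s: "mono_into_rep V Y x s" and p: "mono_into_rep V Y y p"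
    and q: "q \<in> Ar V" "Dom V q = vfo (fst p) z" "Cod V q = ihm V v (vfo (fst s) z)"
  defines "\<theta> \<equiv> unnam V (vHom Y y z) (ihm V v (vHom Y x z))
       (yoneda V Y (cotensor V v (representable V Y x)) y (nam V v (vHom Y x y) f) z)"
    and "\<mu> \<equiv> unnam V (ihm V v (vfo (fst s) z)) (ihm V v (vHom Y x z))
                   (cotensor_map V v (fst s) (representable V Y x) (snd s) z)"
  shows "is_pullback V (incl V Y y p z) q \<theta> \<mu> \<longleftrightarrow>
     incl V Y x s z \<bullet> unc V v (vfo (fst s) z) q = vCmp Y x y z \<bullet> (incl V Y y p z \<odot> f) \<and>
     (\<forall>t \<in> Ar V. Cod V t = vHom Y y z \<longrightarrow> factors V (vCmp Y x y z \<bullet> (t \<odot> f)) (incl V Y x s z) \<longrightarrow> factors V t (incl V Y y p z))"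
    (is "?l \<longleftrightarrow> ?c \<and> ?r")
proof -
  let ?m = "incl V Y x s z" and ?p = "incl V Y y p z" and ?S = "vfo (fst s) z" and ?B = "vHom Y x z" and ?A = "vHom Y y z"
  have v: "v \<in> Ob V" using f by auto
  have fs: "vfunctor V Y (self_enriched V) (fst s)" and hs: "snd s z \<in> Hom V \<one> (ihm V ?S ?B)"
    using s ob by (simp_all add: mono_into_rep_iff[OF Y ob(1)])
  note th = unnam_yoneda_cotensor[OF Y ob f, folded \<theta>_def]
  have obs: "?S \<in> Ob V" "?B \<in> Ob V" "?A \<in> Ob V" using ob by (simp_all add: vfunctor_typing[OF fs] vcategory_typing[OF Y])
  have mu: "\<mu> \<in> Ar V" "Dom V \<mu> = ihm V v ?S" "Cod V \<mu> = ihm V v ?B"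
    "k \<in> Ar V \<Longrightarrow> Cod V k = ihm V v ?S \<Longrightarrow> unc V v ?B (\<mu> \<bullet> k) = ?m \<bullet> unc V v ?S k" for k
    using unnam_cotensor_map[OF v refl refl, of "fst s" z "representable V Y x" "snd s"] obs hs
    unfolding \<mu>_def incl_def representable_sels by blast+
  note ims = incl_simps[OF Y ob(1) s ob(3)] and imp = incl_simps[OF Y ob(2) p ob(3)]
  note mons = incl_monic[OF Y ob(1) s ob(3)] and monp = incl_monic[OF Y ob(2) p ob(3)]
  note st = th(1-3) mu(1-3) ims imp q obs v ob vcategory_typing[OF Y] f
  \<comment> \<open>Commutative squares over \<open>[v, Y(x,z)]\<close> in uncurried form.\<close>
  have eq: "\<theta> \<bullet> t = \<mu> \<bullet> k \<longleftrightarrow> ?m \<bullet> unc V v ?S k = vCmp Y x y z \<bullet> (t \<odot> f)"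
    if "t \<in> Ar V" "k \<in> Ar V" "Cod V t = ?A" "Cod V k = ihm V v ?S" "Dom V t = Dom V k" for t k
  proof
    assume "\<theta> \<bullet> t = \<mu> \<bullet> k"
    then have "unc V v ?B (\<theta> \<bullet> t) = unc V v ?B (\<mu> \<bullet> k)" by simp
    then show "?m \<bullet> unc V v ?S k = vCmp Y x y z \<bullet> (t \<odot> f)" using th(4)[of t] mu(4)[of k] that by simp
  next
    assume "?m \<bullet> unc V v ?S k = vCmp Y x y z \<bullet> (t \<odot> f)"
    then have *: "unc V v ?B (\<theta> \<bullet> t) = unc V v ?B (\<mu> \<bullet> k)" using th(4)[of t] mu(4)[of k] that by simp
    show "\<theta> \<bullet> t = \<mu> \<bullet> k" by (rule unc_inject[OF *]) (use that in \<open>simp_all add: st\<close>)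
  qed
  \<comment> \<open>\<open>[v, s]\<close> is monic because \<open>s\<close> is.\<close>
  have mumon: "j = k" if "\<mu> \<bullet> j = \<mu> \<bullet> k" "j \<in> Ar V" "k \<in> Ar V" "Cod V j = ihm V v ?S" "Cod V k = ihm V v ?S" "Dom V j = Dom V k" for j k
  proof (rule unc_inject)
    have "?m \<bullet> unc V v ?S j = ?m \<bullet> unc V v ?S k" using mu(4)[of j] mu(4)[of k] that(1-5) by simp
    then show "unc V v ?S j = unc V v ?S k" by (rule monicD[OF mons]) (use that(2-) in \<open>simp_all add: st\<close>)
  qed (use that(2-) in \<open>simp_all add: st\<close>)
  show ?thesis
  proof
    assume l: ?l
    have ?c using l eq[of ?p q] by (simp add: is_pullback_def st)
    moreover have "factors V t ?p" if t: "t \<in> Ar V" "Cod V t = ?A" and fa: "factors V (vCmp Y x y z \<bullet> (t \<odot> f)) ?m" for t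
    proof -
      obtain h where h: "h \<in> Ar V" "Dom V h = Dom V (vCmp Y x y z \<bullet> (t \<odot> f))" "Cod V h = Dom V ?m" "?m \<bullet> h = vCmp Y x y z \<bullet> (t \<odot> f)"
        using fa by (rule factorsE)
      have hd: "Dom V h = Dom V t \<otimes> v" unfolding h(2) using t by (simp add: st)
      let ?k = "cur V (Dom V t) v ?S h"
      have k: "?k \<in> Ar V" "Dom V ?k = Dom V t" "Cod V ?k = ihm V v ?S" "unc V v ?S ?k = h"
        using h(1,3) hd t by (simp_all add: st)
      have "\<theta> \<bullet> t = \<mu> \<bullet> ?k" using eq[of t ?k] t k h(4) by simp
      then have "\<exists>!h. h \<in> Hom V (Dom V t) (Dom V ?p) \<and> ?p \<bullet> h = t \<and> q \<bullet> h = ?k"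
        using l t k unfolding is_pullback_def by (simp add: st)
      then show ?thesis unfolding factors_def by blast
    qed
    ultimately show "?c \<and> ?r" by blast
  next
    assume "?c \<and> ?r"
    then have c: ?c and r: ?r by auto
    have tp: "\<theta> \<bullet> ?p = \<mu> \<bullet> q" using c by (subst eq) (simp_all add: st)
    have "\<exists>!h. h \<in> Hom V w (Dom V ?p) \<and> ?p \<bullet> h = t \<and> q \<bullet> h = k"
      if t: "t \<in> Hom V w (Dom V \<theta>)" and k: "k \<in> Hom V w (Dom V \<mu>)" and e: "\<theta> \<bullet> t = \<mu> \<bullet> k" for w t k
    proof -
      have t': "t \<in> Ar V" "Dom V t = w" "Cod V t = ?A" and k': "k \<in> Ar V" "Dom V k = w" "Cod V k = ihm V v ?S"
        using t k by (simp_all add: st)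
      have "?m \<bullet> unc V v ?S k = vCmp Y x y z \<bullet> (t \<odot> f)" using eq[of t k] e t' k' by simp
      then have "factors V (vCmp Y x y z \<bullet> (t \<odot> f)) ?m"
        by (rule factorsI[rotated 3]) (use t' k' in \<open>simp_all add: st\<close>)
      then have "factors V t ?p" using r t' by blast
      then obtain h where h: "h \<in> Ar V" "Dom V h = Dom V t" "Cod V h = Dom V ?p" "?p \<bullet> h = t" by (rule factorsE)
      have "\<mu> \<bullet> q \<bullet> h = (\<theta> \<bullet> ?p) \<bullet> h" unfolding tp using h(1-3) by (simp add: st)
      also have "\<dots> = \<theta> \<bullet> t" using h by (simp add: st)
      finally have "\<mu> \<bullet> q \<bullet> h = \<mu> \<bullet> k" using e by simp
      then have "q \<bullet> h = k" by (rule mumon) (use h(1-3) t' k' in \<open>simp_all add: st\<close>)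
      moreover have "\<exists>!h. h \<in> Hom V w (Dom V ?p) \<and> ?p \<bullet> h = t"
        by (rule factorization_through_monic_unique[OF monp _ h(4)]) (use h(1-3) t' in simp)
      ultimately show ?thesis using h t' by (smt (verit) mem_Hom_iff)
    qed
    note univ = this
    show ?l unfolding is_pullback_def
      by (intro conjI allI ballI impI; (rule univ, assumption+ | simp add: st tp))
  qed
qed

text \<open>
  For the converse direction the second leg has to be constructed. Taking \<open>t = p\<close> in the definition of
  \<open>restricts\<close> gives arrows \<open>P z \<otimes> v \<rightarrow> S z\<close>; their curried forms are natural because \<open>S\<close> is a
  subfunctor of \<open>Y(x,-)\<close> and composition in \<open>Y\<close> is associative.
\<close>

lemma mem_pullback_sieve_iff:
  assumes Y: "vcategory V Y" and x: "x \<in> vOb Y" and y: "y \<in> vOb Y"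
    and f: "f \<in> Hom V v (vHom Y x y)"
    and R: "\<forall>s \<in> R. mono_into_rep V Y x s"
  shows "p \<in> pullback_sieve V Y x y v f R \<longleftrightarrow>
    mono_into_rep V Y y p \<and> (\<exists>s \<in> R. restricts V Y x y f s p)"
proof -
  have f': "f \<in> Ar V" "Dom V f = v" "Cod V f = vHom Y x y" using f by simp_all
  have v: "v \<in> Ob V" using f' by auto
  have "(\<exists>q. vnat V Y (self_enriched V) (fst p) (cotensor V v (fst s)) q \<and>
           (\<forall>z \<in> vOb Y. is_pullback V (incl V Y y p z)
                (unnam V (vfo (fst p) z) (ihm V v (vfo (fst s) z)) (q z))
                (unnam V (vHom Y y z) (ihm V v (vHom Y x z))
                   (yoneda V Y (cotensor V v (representable V Y x)) y (nam V v (vHom Y x y) f) z))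
                (unnam V (ihm V v (vfo (fst s) z)) (ihm V v (vHom Y x z))
                   (cotensor_map V v (fst s) (representable V Y x) (snd s) z))))
      \<longleftrightarrow> restricts V Y x y f s p" (is "(\<exists>q. ?n q \<and> ?pb q) \<longleftrightarrow> ?r")
    if p: "mono_into_rep V Y y p" and s: "mono_into_rep V Y x s" for s
  proof -
    have fs: "vfunctor V Y (self_enriched V) (fst s)" and fp: "vfunctor V Y (self_enriched V) (fst p)"
      using s p by (simp_all add: mono_into_rep_iff[OF Y] x y)
    note fc = cotensor_vfunctor[OF fs v]
    note ims = incl_simps[OF Y x s] and imp = incl_simps[OF Y y p]
    note ty = x y v f' vcategory_typing[OF Y] vfunctor_typing[OF fs] vfunctor_typing[OF fp] vfunctor_typing[OF fc] ims imp
    note pb = is_pullback_restricts[OF Y x y _ f' s p]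
    show ?thesis
    proof
      assume "\<exists>q. ?n q \<and> ?pb q"
      then obtain q where n: "?n q" and q: "?pb q" by blast
      have qt: "q z \<in> Ar V" "Dom V (q z) = \<one>" "Cod V (q z) = ihm V (vfo (fst p) z) (ihm V v (vfo (fst s) z))" if "z \<in> vOb Y" for z
        using n that by (simp_all add: vnat_iff_intertwines[OF fp fc])
      show ?r unfolding restricts_def
      proof (intro ballI impI iffI)
        fix z t assume z: "z \<in> vOb Y" and t: "t \<in> Ar V" "Cod V t = vHom Y y z"
        let ?q = "unnam V (vfo (fst p) z) (ihm V v (vfo (fst s) z)) (q z)"
        have q': "?q \<in> Ar V" "Dom V ?q = vfo (fst p) z" "Cod V ?q = ihm V v (vfo (fst s) z)"
          using z by (simp_all add: qt ty)
        note b = iffD1[OF pb[OF z q'] bspec[OF q z]]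
        show "factors V (vCmp Y x y z \<bullet> (t \<odot> f)) (incl V Y x s z) \<Longrightarrow> factors V t (incl V Y y p z)"
          using b t by blast
        assume "factors V t (incl V Y y p z)"
        then obtain h where h: "h \<in> Ar V" "Dom V h = Dom V t" "Cod V h = Dom V (incl V Y y p z)" "incl V Y y p z \<bullet> h = t"
          by (rule factorsE)
        have "incl V Y x s z \<bullet> unc V v (vfo (fst s) z) ?q \<bullet> (h \<odot> idn V v) =
          (incl V Y x s z \<bullet> unc V v (vfo (fst s) z) ?q) \<bullet> (h \<odot> idn V v)"
          using z q' h(1-3) by (simp add: ty)
        also have "\<dots> = (vCmp Y x y z \<bullet> (incl V Y y p z \<odot> f)) \<bullet> (h \<odot> idn V v)"
          using b by simp
        also have "\<dots> = vCmp Y x y z \<bullet> (t \<odot> f)"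
          using z h t by (simp add: ty)
        finally show "factors V (vCmp Y x y z \<bullet> (t \<odot> f)) (incl V Y x s z)"
          by (rule factorsI[rotated 3]) (use z q' h(1-3) t in \<open>simp_all add: ty\<close>)
      qed
    next
      assume r: ?r
      have "\<exists>k. k \<in> Ar V \<and> Dom V k = vfo (fst p) z \<otimes> v \<and> Cod V k = vfo (fst s) z \<and>
          incl V Y x s z \<bullet> k = vCmp Y x y z \<bullet> (incl V Y y p z \<odot> f)" if z: "z \<in> vOb Y" for z
      proof -
        have "factors V (vCmp Y x y z \<bullet> (incl V Y y p z \<odot> f)) (incl V Y x s z)"
          using r z factors_refl[of "incl V Y y p z"] unfolding restricts_def by (simp add: ty)
        then obtain k where k: "k \<in> Ar V" "Dom V k = Dom V (vCmp Y x y z \<bullet> (incl V Y y p z \<odot> f))"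
          "Cod V k = Dom V (incl V Y x s z)" "incl V Y x s z \<bullet> k = vCmp Y x y z \<bullet> (incl V Y y p z \<odot> f)"
          by (rule factorsE)
        have "Dom V k = vfo (fst p) z \<otimes> v" unfolding k(2) using z by (simp add: ty)
        then show ?thesis using k z by (auto simp: ty)
      qed
      then obtain k where k: "\<And>z. z \<in> vOb Y \<Longrightarrow> k z \<in> Ar V" "\<And>z. z \<in> vOb Y \<Longrightarrow> Dom V (k z) = vfo (fst p) z \<otimes> v"
        "\<And>z. z \<in> vOb Y \<Longrightarrow> Cod V (k z) = vfo (fst s) z"
        and km: "\<And>z. z \<in> vOb Y \<Longrightarrow> incl V Y x s z \<bullet> k z = vCmp Y x y z \<bullet> (incl V Y y p z \<odot> f)"
        by metis
      define c where "c z = cur V (vfo (fst p) z) v (vfo (fst s) z) (k z)" for z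
      have c: "c z \<in> Ar V" "Dom V (c z) = vfo (fst p) z" "Cod V (c z) = ihm V v (vfo (fst s) z)"
        "unc V v (vfo (fst s) z) (c z) = k z" if "z \<in> vOb Y" for z
        using that k[OF that] by (simp_all add: c_def ty)
      let ?q = "\<lambda>z. nam V (vfo (fst p) z) (ihm V v (vfo (fst s) z)) (c z)"
      \<comment> \<open>Naturality of the second leg, tested after uncurrying and composition with the monic inclusion of \<open>s\<close>.\<close>
      have nat: "c z \<bullet> act V (fst p) w z = act V (cotensor V v (fst s)) w z \<bullet> (idn V (vHom Y w z) \<odot> c w)"
        if w: "w \<in> vOb Y" and z: "z \<in> vOb Y" for w z
      proof (rule unc_inject)
        let ?h = "vHom Y w z" and ?P = "vfo (fst p) w"
        have nm: "incl V Y x s z \<bullet> act V (fst s) w z = vCmp Y x w z \<bullet> (idn V ?h \<odot> incl V Y x s w)"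
          by (rule incl_natural[OF Y x s w z])
        have np: "incl V Y y p z \<bullet> act V (fst p) w z = vCmp Y y w z \<bullet> (idn V ?h \<odot> incl V Y y p w)"
          by (rule incl_natural[OF Y y p w z])
        have as: "vCmp Y x y z \<bullet> (vCmp Y y w z \<odot> idn V (vHom Y x y)) =
          vCmp Y x w z \<bullet> (idn V ?h \<odot> vCmp Y x y w) \<bullet> asc V ?h (vHom Y y w) (vHom Y x y)"
          using vcategory.vCmp_assoc[OF Y x y w z] .
        have "k z \<bullet> (act V (fst p) w z \<odot> idn V v) = act V (fst s) w z \<bullet> (idn V ?h \<odot> k w) \<bullet> asc V ?h ?P v"
        proof (rule monicD[OF incl_monic[OF Y x s z]])
          have "incl V Y x s z \<bullet> k z \<bullet> (act V (fst p) w z \<odot> idn V v) = (incl V Y x s z \<bullet> k z) \<bullet> (act V (fst p) w z \<odot> idn V v)"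
            using w z by (simp add: ty k)
          also have "\<dots> = vCmp Y x y z \<bullet> ((incl V Y y p z \<bullet> act V (fst p) w z) \<odot> f)"
            using w z unfolding km[OF z] by (simp add: ty)
          also have "\<dots> = (vCmp Y x y z \<bullet> (vCmp Y y w z \<odot> idn V (vHom Y x y))) \<bullet> ((idn V ?h \<odot> incl V Y y p w) \<odot> f)"
            using w z unfolding np by (simp add: ty)
          also have "\<dots> = vCmp Y x w z \<bullet> (idn V ?h \<odot> vCmp Y x y w) \<bullet> (asc V ?h (vHom Y y w) (vHom Y x y) \<bullet> ((idn V ?h \<odot> incl V Y y p w) \<odot> f))"
            using w z unfolding as by (simp add: ty)
          also have "asc V ?h (vHom Y y w) (vHom Y x y) \<bullet> ((idn V ?h \<odot> incl V Y y p w) \<odot> f) = (idn V ?h \<odot> incl V Y y p w \<odot> f) \<bullet> asc V ?h ?P v"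
            using w z by (intro asc_nat') (simp_all add: ty)
          also have "vCmp Y x w z \<bullet> (idn V ?h \<odot> vCmp Y x y w) \<bullet> (idn V ?h \<odot> incl V Y y p w \<odot> f) \<bullet> asc V ?h ?P v =
             vCmp Y x w z \<bullet> (idn V ?h \<odot> (vCmp Y x y w \<bullet> (incl V Y y p w \<odot> f))) \<bullet> asc V ?h ?P v"
            using w z by (simp add: ty)
          also have "\<dots> = vCmp Y x w z \<bullet> (idn V ?h \<odot> (incl V Y x s w \<bullet> k w)) \<bullet> asc V ?h ?P v"
            unfolding km[OF w] ..
          also have "\<dots> = (vCmp Y x w z \<bullet> (idn V ?h \<odot> incl V Y x s w)) \<bullet> (idn V ?h \<odot> k w) \<bullet> asc V ?h ?P v"
            using w z by (simp add: ty k)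
          also have "\<dots> = incl V Y x s z \<bullet> act V (fst s) w z \<bullet> (idn V ?h \<odot> k w) \<bullet> asc V ?h ?P v"
            unfolding nm[symmetric] using w z by (simp add: ty k)
          finally show "incl V Y x s z \<bullet> k z \<bullet> (act V (fst p) w z \<odot> idn V v) =
             incl V Y x s z \<bullet> act V (fst s) w z \<bullet> (idn V ?h \<odot> k w) \<bullet> asc V ?h ?P v" .
        qed (use w z in \<open>simp_all add: ty k\<close>)
        then show "unc V v (vfo (fst s) z) (c z \<bullet> act V (fst p) w z) =
          unc V v (vfo (fst s) z) (act V (cotensor V v (fst s)) w z \<bullet> (idn V ?h \<odot> c w))"
          using w z c by (subst unc_cotensor_act[OF fs v w z]) (simp_all add: unc_cmp ty)
      qed (use w z c in \<open>simp_all add: ty\<close>)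
      have "?n ?q" unfolding vnat_iff_intertwines[OF fp fc] intertwines_def
        using nat c by (simp add: ty)
      moreover have "?pb ?q"
      proof
        fix z assume z: "z \<in> vOb Y"
        have "is_pullback V (incl V Y y p z) (c z)
                (unnam V (vHom Y y z) (ihm V v (vHom Y x z))
                   (yoneda V Y (cotensor V v (representable V Y x)) y (nam V v (vHom Y x y) f) z))
                (unnam V (ihm V v (vfo (fst s) z)) (ihm V v (vHom Y x z))
                   (cotensor_map V v (fst s) (representable V Y x) (snd s) z))"
          unfolding pb[OF z c(1-3)[OF z]] c(4)[OF z] using r z km[OF z] unfolding restricts_def by blast
        then show "is_pullback V (incl V Y y p z)
                (unnam V (vfo (fst p) z) (ihm V v (vfo (fst s) z)) (?q z))
                (unnam V (vHom Y y z) (ihm V v (vHom Y x z))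
                   (yoneda V Y (cotensor V v (representable V Y x)) y (nam V v (vHom Y x y) f) z))
                (unnam V (ihm V v (vfo (fst s) z)) (ihm V v (vHom Y x z))
                   (cotensor_map V v (fst s) (representable V Y x) (snd s) z))"
          using c(1-3)[OF z] by simp
      qed
      ultimately show "\<exists>q. ?n q \<and> ?pb q" by blast
    qed
  qed
  note key = this
  have "p \<in> pullback_sieve V Y x y v f R \<longleftrightarrow> mono_into_rep V Y y p \<and> (\<exists>s \<in> R.
      \<exists>q. vnat V Y (self_enriched V) (fst p) (cotensor V v (fst s)) q \<and>
           (\<forall>z \<in> vOb Y. is_pullback V (incl V Y y p z)
                (unnam V (vfo (fst p) z) (ihm V v (vfo (fst s) z)) (q z))
                (unnam V (vHom Y y z) (ihm V v (vHom Y x z))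
                   (yoneda V Y (cotensor V v (representable V Y x)) y (nam V v (vHom Y x y) f) z))
                (unnam V (ihm V v (vfo (fst s) z)) (ihm V v (vHom Y x z))
                   (cotensor_map V v (fst s) (representable V Y x) (snd s) z))))"
    unfolding pullback_sieve_def incl_def by (cases p) (simp add: case_prod_beta)
  then show ?thesis using key R by blast
qed

lemma restricts_cong:
  assumes Y: "vcategory V Y" and x: "x \<in> vOb Y" and y: "y \<in> vOb Y"
    and s: "mono_equiv V Y x s s'" and p: "mono_equiv V Y y p p'" and r: "restricts V Y x y f s p"
  shows "restricts V Y x y f s' p'"
proof -
  have m: "mono_into_rep V Y x s" "mono_into_rep V Y x s'" "mono_into_rep V Y y p" "mono_into_rep V Y y p'"
    using s p by (simp_all add: mono_equiv_iff[OF Y] x y)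
  have "factors V g (incl V Y x s z) \<longleftrightarrow> factors V g (incl V Y x s' z)"
    "factors V g (incl V Y y p z) \<longleftrightarrow> factors V g (incl V Y y p' z)" if z: "z \<in> vOb Y" for g z
    using s p z m unfolding mono_equiv_iff[OF Y x] mono_equiv_iff[OF Y y]
    by (blast intro: factors_trans incl_simps(1)[OF Y x _ z] incl_simps(1)[OF Y y _ z])+
  then show ?thesis using r by (simp add: restricts_def)
qed

lemma restricts_unique:
  assumes Y: "vcategory V Y" and y: "y \<in> vOb Y"
    and p: "mono_into_rep V Y y p" and p': "mono_into_rep V Y y p'"
    and r: "restricts V Y x y f s p" and r': "restricts V Y x y f s p'"
  shows "mono_equiv V Y y p p'"
proof -
  have "factors V t (incl V Y y p z) \<longleftrightarrow> factors V t (incl V Y y p' z)"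
    if "z \<in> vOb Y" "t \<in> Ar V" "Cod V t = vHom Y y z" for z t
    using r r' that by (simp add: restricts_def)
  then show ?thesis
    using p p' by (simp add: mono_equiv_iff[OF Y y]) (metis factors_refl incl_simps(1,3)[OF Y y])
qed

end

section \<open>Base change along a lax monoidal functor\<close>

context is_functor
begin

lemma fob_simps [simp]: "x \<in> Ob C \<Longrightarrow> fob F x \<in> Ob D"
  by (rule fob_Ob)

lemma far_simps [simp]:
  assumes "f \<in> Ar C"
  shows "far F f \<in> Ar D" "Dom D (far F f) = fob F (Dom C f)" "Cod D (far F f) = fob F (Cod C f)"
  using far_Hom[of f "Dom C f" "Cod C f"] assms by simp_all

lemma far_idn' [simp]: "x \<in> Ob C \<Longrightarrow> far F (idn C x) = idn D (fob F x)"
  by (rule far_idn)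

lemma far_cmp':
  "f \<in> Ar C \<Longrightarrow> g \<in> Ar C \<Longrightarrow> Cod C f = Dom C g \<Longrightarrow> far F (g \<bullet>\<^bsub>C\<^esub> f) = far F g \<bullet>\<^bsub>D\<^esub> far F f"
  using far_cmp[of f "Dom C f" "Cod C f" g "Cod C g"] by simp

end

context lax_monoidal_functor
begin

lemma lxu_simps [simp]: "lxu G \<in> Ar U" "Dom U (lxu G) = \<one>\<^bsub>U\<^esub>" "Cod U (lxu G) = fob G \<one>\<^bsub>V\<^esub>"
  using lxu_Hom by simp_all

lemma lxm_simps [simp]:
  assumes "a \<in> Ob V" "b \<in> Ob V"
  shows "lxm G a b \<in> Ar U" "Dom U (lxm G a b) = fob G a \<otimes>\<^bsub>U\<^esub> fob G b" "Cod U (lxm G a b) = fob G (a \<otimes>\<^bsub>V\<^esub> b)"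
  using lxm_Hom[OF assms] by simp_all

text \<open>
  Naturality of the tensor comparison in the shape in which it occurs below, with further arrows on
  both ends.
\<close>

lemma lxm_nat_extend:
  assumes "f \<in> Ar V" "g \<in> Ar V" "Dom V f = a" "Dom V g = b" "Cod V f = a'" "Cod V g = b'"
    "h \<in> Ar V" "Dom V h = a' \<otimes>\<^bsub>V\<^esub> b'"
    "k \<in> Ar U" "Cod U k = fob G a" "l \<in> Ar U" "Cod U l = fob G b"
  shows "far G h \<bullet>\<^bsub>U\<^esub> lxm G a' b' \<bullet>\<^bsub>U\<^esub> ((far G f \<bullet>\<^bsub>U\<^esub> k) \<odot>\<^bsub>U\<^esub> (far G g \<bullet>\<^bsub>U\<^esub> l)) =
    far G (h \<bullet>\<^bsub>V\<^esub> (f \<odot>\<^bsub>V\<^esub> g)) \<bullet>\<^bsub>U\<^esub> lxm G a b \<bullet>\<^bsub>U\<^esub> (k \<odot>\<^bsub>U\<^esub> l)"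
proof -
  have ob: "a \<in> Ob V" "b \<in> Ob V" "a' \<in> Ob V" "b' \<in> Ob V" using assms by auto
  have "far G h \<bullet>\<^bsub>U\<^esub> lxm G a' b' \<bullet>\<^bsub>U\<^esub> ((far G f \<bullet>\<^bsub>U\<^esub> k) \<odot>\<^bsub>U\<^esub> (far G g \<bullet>\<^bsub>U\<^esub> l)) =
    far G h \<bullet>\<^bsub>U\<^esub> (lxm G a' b' \<bullet>\<^bsub>U\<^esub> (far G f \<odot>\<^bsub>U\<^esub> far G g)) \<bullet>\<^bsub>U\<^esub> (k \<odot>\<^bsub>U\<^esub> l)"
    using assms ob by simp
  also have "lxm G a' b' \<bullet>\<^bsub>U\<^esub> (far G f \<odot>\<^bsub>U\<^esub> far G g) = far G (f \<odot>\<^bsub>V\<^esub> g) \<bullet>\<^bsub>U\<^esub> lxm G a b"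
    using assms by (intro lxm_nat) simp_all
  finally show ?thesis using assms ob by (simp add: far_cmp')
qed

lemma lxm_inv_lun:
  assumes "a \<in> Ob V"
  shows "lxm G \<one>\<^bsub>V\<^esub> a \<bullet>\<^bsub>U\<^esub> (lxu G \<odot>\<^bsub>U\<^esub> idn U (fob G a)) \<bullet>\<^bsub>U\<^esub> inv_ar U (lun U (fob G a)) = far G (inv_ar V (lun V a))"
proof -
  have "lxm G \<one>\<^bsub>V\<^esub> a \<bullet>\<^bsub>U\<^esub> (lxu G \<odot>\<^bsub>U\<^esub> idn U (fob G a)) \<bullet>\<^bsub>U\<^esub> inv_ar U (lun U (fob G a)) =
    far G (inv_ar V (lun V a) \<bullet>\<^bsub>V\<^esub> lun V a) \<bullet>\<^bsub>U\<^esub> lxm G \<one>\<^bsub>V\<^esub> a \<bullet>\<^bsub>U\<^esub> (lxu G \<odot>\<^bsub>U\<^esub> idn U (fob G a)) \<bullet>\<^bsub>U\<^esub> inv_ar U (lun U (fob G a))"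
    using assms by simp
  also have "\<dots> = far G (inv_ar V (lun V a)) \<bullet>\<^bsub>U\<^esub> (far G (lun V a) \<bullet>\<^bsub>U\<^esub> lxm G \<one>\<^bsub>V\<^esub> a \<bullet>\<^bsub>U\<^esub> (lxu G \<odot>\<^bsub>U\<^esub> idn U (fob G a))) \<bullet>\<^bsub>U\<^esub> inv_ar U (lun U (fob G a))"
    using assms by (simp add: far_cmp' del: V.structure_simps(13-16))
  finally show ?thesis using assms by (simp add: lax_lunit)
qed

lemma lxm_inv_run:
  assumes "a \<in> Ob V"
  shows "lxm G a \<one>\<^bsub>V\<^esub> \<bullet>\<^bsub>U\<^esub> (idn U (fob G a) \<odot>\<^bsub>U\<^esub> lxu G) \<bullet>\<^bsub>U\<^esub> inv_ar U (run U (fob G a)) = far G (inv_ar V (run V a))"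
proof -
  have "lxm G a \<one>\<^bsub>V\<^esub> \<bullet>\<^bsub>U\<^esub> (idn U (fob G a) \<odot>\<^bsub>U\<^esub> lxu G) \<bullet>\<^bsub>U\<^esub> inv_ar U (run U (fob G a)) =
    far G (inv_ar V (run V a) \<bullet>\<^bsub>V\<^esub> run V a) \<bullet>\<^bsub>U\<^esub> lxm G a \<one>\<^bsub>V\<^esub> \<bullet>\<^bsub>U\<^esub> (idn U (fob G a) \<odot>\<^bsub>U\<^esub> lxu G) \<bullet>\<^bsub>U\<^esub> inv_ar U (run U (fob G a))"
    using assms by simp
  also have "\<dots> = far G (inv_ar V (run V a)) \<bullet>\<^bsub>U\<^esub> (far G (run V a) \<bullet>\<^bsub>U\<^esub> lxm G a \<one>\<^bsub>V\<^esub> \<bullet>\<^bsub>U\<^esub> (idn U (fob G a) \<odot>\<^bsub>U\<^esub> lxu G)) \<bullet>\<^bsub>U\<^esub> inv_ar U (run U (fob G a))"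
    using assms by (simp add: far_cmp' del: V.structure_simps(13-16))
  finally show ?thesis using assms by (simp add: lax_runit)
qed

text \<open>
  Stated for a general action so that it serves presheaves on \<open>Y\<close> as well as composition in \<open>Y\<close> itself, the
  action on representables. It is naturality of the tensor comparison followed by the unit axiom of \<open>G\<close>.
\<close>

lemma lax_action_unit:
  assumes "e \<in> Ar V" "Dom V e = \<one>\<^bsub>V\<^esub>" "Cod V e = a" "b \<in> Ob V" "h \<in> Ar V" "Dom V h = a \<otimes>\<^bsub>V\<^esub> b"
    and "h \<bullet>\<^bsub>V\<^esub> (e \<odot>\<^bsub>V\<^esub> idn V b) = lun V b"
  shows "(far G h \<bullet>\<^bsub>U\<^esub> lxm G a b) \<bullet>\<^bsub>U\<^esub> ((far G e \<bullet>\<^bsub>U\<^esub> lxu G) \<odot>\<^bsub>U\<^esub> idn U (fob G b)) = lun U (fob G b)"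
proof -
  have a: "a \<in> Ob V" using assms by auto
  have "(far G h \<bullet>\<^bsub>U\<^esub> lxm G a b) \<bullet>\<^bsub>U\<^esub> ((far G e \<bullet>\<^bsub>U\<^esub> lxu G) \<odot>\<^bsub>U\<^esub> idn U (fob G b)) =
     far G h \<bullet>\<^bsub>U\<^esub> lxm G a b \<bullet>\<^bsub>U\<^esub> ((far G e \<bullet>\<^bsub>U\<^esub> lxu G) \<odot>\<^bsub>U\<^esub> (far G (idn V b) \<bullet>\<^bsub>U\<^esub> idn U (fob G b)))"
    using assms(1-6) a by simp
  also have "\<dots> = far G (h \<bullet>\<^bsub>V\<^esub> (e \<odot>\<^bsub>V\<^esub> idn V b)) \<bullet>\<^bsub>U\<^esub> lxm G \<one>\<^bsub>V\<^esub> b \<bullet>\<^bsub>U\<^esub> (lxu G \<odot>\<^bsub>U\<^esub> idn U (fob G b))"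
    by (rule lxm_nat_extend) (use assms a in simp_all)
  finally show ?thesis using assms(4,7) lax_lunit by simp
qed

text \<open>
  The tensor comparison is compatible with the associators, so that \<open>G\<close> preserves the associativity law of
  an action; composition in a category is included as the action on representables.
\<close>

lemma lax_action_assoc:
  assumes ob: "a \<in> Ob V" "b \<in> Ob V" "c \<in> Ob V"
    and c: "c1 \<in> Hom V (a \<otimes>\<^bsub>V\<^esub> b) ab" and h1: "h1 \<in> Hom V (ab \<otimes>\<^bsub>V\<^esub> c) d"
    and h2: "h2 \<in> Hom V (b \<otimes>\<^bsub>V\<^esub> c) bc" and h3: "h3 \<in> Hom V (a \<otimes>\<^bsub>V\<^esub> bc) d"
    and eq: "h1 \<bullet>\<^bsub>V\<^esub> (c1 \<odot>\<^bsub>V\<^esub> idn V c) = h3 \<bullet>\<^bsub>V\<^esub> (idn V a \<odot>\<^bsub>V\<^esub> h2) \<bullet>\<^bsub>V\<^esub> asc V a b c"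
  shows "(far G h1 \<bullet>\<^bsub>U\<^esub> lxm G ab c) \<bullet>\<^bsub>U\<^esub> ((far G c1 \<bullet>\<^bsub>U\<^esub> lxm G a b) \<odot>\<^bsub>U\<^esub> idn U (fob G c)) =
    (far G h3 \<bullet>\<^bsub>U\<^esub> lxm G a bc) \<bullet>\<^bsub>U\<^esub> (idn U (fob G a) \<odot>\<^bsub>U\<^esub> (far G h2 \<bullet>\<^bsub>U\<^esub> lxm G b c)) \<bullet>\<^bsub>U\<^esub> asc U (fob G a) (fob G b) (fob G c)"
proof -
  have ty: "c1 \<in> Ar V" "Dom V c1 = a \<otimes>\<^bsub>V\<^esub> b" "Cod V c1 = ab" "h1 \<in> Ar V" "Dom V h1 = ab \<otimes>\<^bsub>V\<^esub> c" "Cod V h1 = d"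
    "h2 \<in> Ar V" "Dom V h2 = b \<otimes>\<^bsub>V\<^esub> c" "Cod V h2 = bc" "h3 \<in> Ar V" "Dom V h3 = a \<otimes>\<^bsub>V\<^esub> bc" "Cod V h3 = d"
    using c h1 h2 h3 by simp_all
  then have ob': "ab \<in> Ob V" "bc \<in> Ob V" by auto
  note s = ob ob' ty
  have "(far G h1 \<bullet>\<^bsub>U\<^esub> lxm G ab c) \<bullet>\<^bsub>U\<^esub> ((far G c1 \<bullet>\<^bsub>U\<^esub> lxm G a b) \<odot>\<^bsub>U\<^esub> idn U (fob G c)) =
    far G h1 \<bullet>\<^bsub>U\<^esub> lxm G ab c \<bullet>\<^bsub>U\<^esub> ((far G c1 \<bullet>\<^bsub>U\<^esub> lxm G a b) \<odot>\<^bsub>U\<^esub> (far G (idn V c) \<bullet>\<^bsub>U\<^esub> idn U (fob G c)))"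
    using s by simp
  also have "\<dots> = far G (h1 \<bullet>\<^bsub>V\<^esub> (c1 \<odot>\<^bsub>V\<^esub> idn V c)) \<bullet>\<^bsub>U\<^esub> lxm G (a \<otimes>\<^bsub>V\<^esub> b) c \<bullet>\<^bsub>U\<^esub> (lxm G a b \<odot>\<^bsub>U\<^esub> idn U (fob G c))"
    by (rule lxm_nat_extend) (use s in simp_all)
  also have "\<dots> = far G (h3 \<bullet>\<^bsub>V\<^esub> (idn V a \<odot>\<^bsub>V\<^esub> h2)) \<bullet>\<^bsub>U\<^esub> (far G (asc V a b c) \<bullet>\<^bsub>U\<^esub> lxm G (a \<otimes>\<^bsub>V\<^esub> b) c \<bullet>\<^bsub>U\<^esub> (lxm G a b \<odot>\<^bsub>U\<^esub> idn U (fob G c)))"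
    unfolding eq using s by (simp add: far_cmp')
  also have "\<dots> = far G (h3 \<bullet>\<^bsub>V\<^esub> (idn V a \<odot>\<^bsub>V\<^esub> h2)) \<bullet>\<^bsub>U\<^esub> lxm G a (b \<otimes>\<^bsub>V\<^esub> c) \<bullet>\<^bsub>U\<^esub> (idn U (fob G a) \<odot>\<^bsub>U\<^esub> lxm G b c) \<bullet>\<^bsub>U\<^esub> asc U (fob G a) (fob G b) (fob G c)"
    using s by (simp add: lax_assoc)
  also have "\<dots> = (far G (h3 \<bullet>\<^bsub>V\<^esub> (idn V a \<odot>\<^bsub>V\<^esub> h2)) \<bullet>\<^bsub>U\<^esub> lxm G a (b \<otimes>\<^bsub>V\<^esub> c) \<bullet>\<^bsub>U\<^esub> (idn U (fob G a) \<odot>\<^bsub>U\<^esub> lxm G b c)) \<bullet>\<^bsub>U\<^esub> asc U (fob G a) (fob G b) (fob G c)"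
    using s by simp
  also have "far G (h3 \<bullet>\<^bsub>V\<^esub> (idn V a \<odot>\<^bsub>V\<^esub> h2)) \<bullet>\<^bsub>U\<^esub> lxm G a (b \<otimes>\<^bsub>V\<^esub> c) \<bullet>\<^bsub>U\<^esub> (idn U (fob G a) \<odot>\<^bsub>U\<^esub> lxm G b c) =
    far G h3 \<bullet>\<^bsub>U\<^esub> lxm G a bc \<bullet>\<^bsub>U\<^esub> ((far G (idn V a) \<bullet>\<^bsub>U\<^esub> idn U (fob G a)) \<odot>\<^bsub>U\<^esub> (far G h2 \<bullet>\<^bsub>U\<^esub> lxm G b c))"
    by (rule lxm_nat_extend[symmetric]) (use s in simp_all)
  finally show ?thesis using s by simp
qed

end

lemma base_change_vcategory:
  assumes "lax_monoidal_functor V U G" and Y: "vcategory V Y"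
  shows "vcategory U (base_change U G Y)"
proof -
  interpret lax_monoidal_functor V U G by fact
  interpret Y: vcategory V Y by (rule Y)
  note s = V.vcategory_typing[OF Y]
  show ?thesis
  proof
    fix x y assume x: "x \<in> vOb (base_change U G Y)" "y \<in> vOb (base_change U G Y)"
    then have x: "x \<in> vOb Y" "y \<in> vOb Y" by (simp_all add: base_change_def)
    have "(far G (vCmp Y x y y) \<bullet>\<^bsub>U\<^esub> lxm G (vHom Y y y) (vHom Y x y)) \<bullet>\<^bsub>U\<^esub> ((far G (vId Y y) \<bullet>\<^bsub>U\<^esub> lxu G) \<odot>\<^bsub>U\<^esub> idn U (fob G (vHom Y x y)))
        = lun U (fob G (vHom Y x y))"
      by (rule lax_action_unit) (use x in \<open>simp_all add: s Y.vId_vCmp\<close>)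
    then show "vCmp (base_change U G Y) x y y \<bullet>\<^bsub>U\<^esub> (vId (base_change U G Y) y \<odot>\<^bsub>U\<^esub> idn U (vHom (base_change U G Y) x y)) =
      lun U (vHom (base_change U G Y) x y)"
      by (simp add: base_change_def elt_map_def)
    have "far G (vCmp Y x x y) \<bullet>\<^bsub>U\<^esub> lxm G (vHom Y x y) (vHom Y x x) \<bullet>\<^bsub>U\<^esub>
        ((far G (idn V (vHom Y x y)) \<bullet>\<^bsub>U\<^esub> idn U (fob G (vHom Y x y))) \<odot>\<^bsub>U\<^esub> (far G (vId Y x) \<bullet>\<^bsub>U\<^esub> lxu G)) =
        far G (vCmp Y x x y \<bullet>\<^bsub>V\<^esub> (idn V (vHom Y x y) \<odot>\<^bsub>V\<^esub> vId Y x)) \<bullet>\<^bsub>U\<^esub> lxm G (vHom Y x y) \<one>\<^bsub>V\<^esub> \<bullet>\<^bsub>U\<^esub> (idn U (fob G (vHom Y x y)) \<odot>\<^bsub>U\<^esub> lxu G)"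
      by (rule lxm_nat_extend) (use x in \<open>simp_all add: s\<close>)
    then show "vCmp (base_change U G Y) x x y \<bullet>\<^bsub>U\<^esub> (idn U (vHom (base_change U G Y) x y) \<odot>\<^bsub>U\<^esub> vId (base_change U G Y) x) =
      run U (vHom (base_change U G Y) x y)"
      using x by (simp add: base_change_def elt_map_def s Y.vCmp_vId lax_runit)
  next
    fix w x y z assume "w \<in> vOb (base_change U G Y)" "x \<in> vOb (base_change U G Y)" "y \<in> vOb (base_change U G Y)" "z \<in> vOb (base_change U G Y)"
    then have x: "w \<in> vOb Y" "x \<in> vOb Y" "y \<in> vOb Y" "z \<in> vOb Y" by (simp_all add: base_change_def)
    show "vCmp (base_change U G Y) w x z \<bullet>\<^bsub>U\<^esub> (vCmp (base_change U G Y) x y z \<odot>\<^bsub>U\<^esub> idn U (vHom (base_change U G Y) w x)) =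
       vCmp (base_change U G Y) w y z \<bullet>\<^bsub>U\<^esub>
       (idn U (vHom (base_change U G Y) y z) \<odot>\<^bsub>U\<^esub> vCmp (base_change U G Y) w x y) \<bullet>\<^bsub>U\<^esub>
       asc U (vHom (base_change U G Y) y z) (vHom (base_change U G Y) x y) (vHom (base_change U G Y) w x)"
      using lax_action_assoc[of "vHom Y y z" "vHom Y x y" "vHom Y w x" "vCmp Y x y z" "vHom Y x z" "vCmp Y w x z" "vHom Y w z"
          "vCmp Y w x y" "vHom Y w y" "vCmp Y w y z"] x
      by (simp add: base_change_def s Y.vCmp_assoc)
  qed (simp_all add: base_change_def s elt_map_def)
qed

locale closed_monoidal_adjunction =
  U: symmetric_monoidal_closed_category U + V: symmetric_monoidal_closed_category V +
  monoidal_adjunction U V F G \<eta> \<epsilon>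
  for U :: "('p, 'b, 'n) smcc_scheme" and V :: "('o, 'a, 'm) smcc_scheme"
    and F :: "('p, 'b, 'o, 'a) lax_functr" and G :: "('o, 'a, 'p, 'b) lax_functr"
    and \<eta> :: "'p \<Rightarrow> 'b" and \<epsilon> :: "'o \<Rightarrow> 'a"
begin

lemma unit_simps [simp]:
  assumes "a \<in> Ob U" shows "\<eta> a \<in> Ar U" "Dom U (\<eta> a) = a" "Cod U (\<eta> a) = fob G (fob F a)"
  using unit assms by (simp_all add: monoidal_nat_trans_def nat_trans_def id_lax_def comp_lax_def)

lemma counit_simps [simp]:
  assumes "a \<in> Ob V" shows "\<epsilon> a \<in> Ar V" "Dom V (\<epsilon> a) = fob F (fob G a)" "Cod V (\<epsilon> a) = a"
  using counit assms by (simp_all add: monoidal_nat_trans_def nat_trans_def id_lax_def comp_lax_def)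

lemma unit_nat:
  assumes "f \<in> Ar U" "Dom U f = a" "Cod U f = b"
  shows "far G (far F f) \<bullet>\<^bsub>U\<^esub> \<eta> a = \<eta> b \<bullet>\<^bsub>U\<^esub> f"
  using unit assms by (auto simp: monoidal_nat_trans_def nat_trans_def id_lax_def comp_lax_def)

lemma counit_nat:
  assumes "f \<in> Ar V" "Dom V f = a" "Cod V f = b"
  shows "\<epsilon> b \<bullet>\<^bsub>V\<^esub> far F (far G f) = f \<bullet>\<^bsub>V\<^esub> \<epsilon> a"
  using counit assms by (auto simp: monoidal_nat_trans_def nat_trans_def id_lax_def comp_lax_def)

lemma counit_monoidal:
  assumes "a \<in> Ob V" "b \<in> Ob V"
  shows "\<epsilon> (a \<otimes>\<^bsub>V\<^esub> b) \<bullet>\<^bsub>V\<^esub> far F (lxm G a b) \<bullet>\<^bsub>V\<^esub> lxm F (fob G a) (fob G b) = \<epsilon> a \<odot>\<^bsub>V\<^esub> \<epsilon> b"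
  using counit assms by (simp add: monoidal_nat_trans_def id_lax_def comp_lax_def)

end

section \<open>Transport of presheaves and subobjects\<close>

lemma base_change_sels [simp]:
  "vOb (base_change U G Y) = vOb Y" "vHom (base_change U G Y) x y = fob G (vHom Y x y)"
  "vId (base_change U G Y) x = far G (vId Y x) \<bullet>\<^bsub>U\<^esub> lxu G"
  "vCmp (base_change U G Y) x y z = far G (vCmp Y x y z) \<bullet>\<^bsub>U\<^esub> lxm G (vHom Y y z) (vHom Y x y)"
  by (simp_all add: base_change_def elt_map_def)

lemma tilde_ob_sels [simp]:
  "vfo (tilde_ob U V F G \<eta> \<epsilon> R) x = fob G (vfo R x)"
  "vfa (tilde_ob U V F G \<eta> \<epsilon> R) x y =
    vfa (enriched_G U V F G \<eta> \<epsilon>) (vfo R x) (vfo R y) \<bullet>\<^bsub>U\<^esub> far G (vfa R x y)"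
  by (simp_all add: tilde_ob_def base_change_functor_def comp_vfunctor_def enriched_G_def)

definition tilde_mono ::
  "('p, 'b, 'n) smcc_scheme \<Rightarrow> ('o, 'a, 'm) smcc_scheme \<Rightarrow> ('p, 'b, 'o, 'a) lax_functr
     \<Rightarrow> ('o, 'a, 'p, 'b) lax_functr \<Rightarrow> ('p \<Rightarrow> 'b) \<Rightarrow> ('o \<Rightarrow> 'a) \<Rightarrow> ('c, 'o, 'a) vcat \<Rightarrow> 'c
     \<Rightarrow> ('c, 'o, 'a) presheaf_mono \<Rightarrow> ('c, 'p, 'b) presheaf_mono" where
  "tilde_mono U V F G \<eta> \<epsilon> Y x s =
     (tilde_ob U V F G \<eta> \<epsilon> (fst s), tilde_ar U V F G \<eta> \<epsilon> (fst s) (representable V Y x) (snd s))"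

context closed_monoidal_adjunction
begin

text \<open>
  The functor \<open>G\<^sup>U\<close> is defined through the adjunction isomorphism and precomposition with the counit. Here
  the two cancel by a triangle identity: uncurried, \<open>G[x, y] \<rightarrow> [G x, G y]\<close> is \<open>G\<close> of the evaluation,
  precomposed with the tensor comparison.
\<close>

lemma enriched_G_hom:
  assumes xy: "x \<in> Ob V" "y \<in> Ob V"
  defines "e \<equiv> vfa (enriched_G U V F G \<eta> \<epsilon>) x y"
  shows "e \<in> Ar U" "Dom U e = fob G (ihm V x y)" "Cod U e = ihm U (fob G x) (fob G y)"
    "unc U (fob G x) (fob G y) e = far G (evl V x y) \<bullet>\<^bsub>U\<^esub> lxm G (ihm V x y) x"
proof -
  let ?Gx = "fob G x" and ?FGx = "fob F (fob G x)" and ?h = "ihm V x y" and ?S = "self_enriched V"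
  let ?n = "nam V ?FGx x (\<epsilon> x)" and ?k = "ihm V ?FGx y" and ?c = "vCmp (self_enriched V) ?FGx x y"
  have ob: "?Gx \<in> Ob U" "?FGx \<in> Ob V" "fob G y \<in> Ob U" "?h \<in> Ob V" "?k \<in> Ob V" "ihm V ?FGx x \<in> Ob V" using xy by simp_all
  \<comment> \<open>The adjunction isomorphism is the curried form of \<open>?\<phi>\<close>; \<open>?\<rho> : [x, y] \<rightarrow> [F G x, y]\<close> is precomposition with the counit.\<close>
  let ?\<phi> = "far G (evl V ?FGx y) \<bullet>\<^bsub>U\<^esub> lxm G ?k ?FGx \<bullet>\<^bsub>U\<^esub> (idn U (fob G ?k) \<odot>\<^bsub>U\<^esub> \<eta> ?Gx)"
  let ?\<rho> = "?c \<bullet>\<^bsub>V\<^esub> (idn V ?h \<odot>\<^bsub>V\<^esub> ?n) \<bullet>\<^bsub>V\<^esub> inv_ar V (run V ?h)"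
  have \<rho>: "?\<rho> \<in> Ar V" "Dom V ?\<rho> = ?h" "Cod V ?\<rho> = ?k" using xy ob by simp_all
  have \<phi>: "?\<phi> \<in> Ar U" "Dom U ?\<phi> = fob G ?k \<otimes>\<^bsub>U\<^esub> ?Gx" "Cod U ?\<phi> = fob G y" using xy ob by simp_all
  have "vprecomp U (base_change U G ?S) ?FGx x y (elt_map U G ?n) =
    (far G ?c \<bullet>\<^bsub>U\<^esub> lxm G ?h (ihm V ?FGx x)) \<bullet>\<^bsub>U\<^esub> (idn U (fob G ?h) \<odot>\<^bsub>U\<^esub> (far G ?n \<bullet>\<^bsub>U\<^esub> lxu G)) \<bullet>\<^bsub>U\<^esub> inv_ar U (run U (fob G ?h))"
    by (simp add: vprecomp_def elt_map_def)
  also have "\<dots> = (far G ?c \<bullet>\<^bsub>U\<^esub> lxm G ?h (ihm V ?FGx x) \<bullet>\<^bsub>U\<^esub>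
       ((far G (idn V ?h) \<bullet>\<^bsub>U\<^esub> idn U (fob G ?h)) \<odot>\<^bsub>U\<^esub> (far G ?n \<bullet>\<^bsub>U\<^esub> lxu G))) \<bullet>\<^bsub>U\<^esub> inv_ar U (run U (fob G ?h))"
    using xy ob by simp
  also have "far G ?c \<bullet>\<^bsub>U\<^esub> lxm G ?h (ihm V ?FGx x) \<bullet>\<^bsub>U\<^esub>
       ((far G (idn V ?h) \<bullet>\<^bsub>U\<^esub> idn U (fob G ?h)) \<odot>\<^bsub>U\<^esub> (far G ?n \<bullet>\<^bsub>U\<^esub> lxu G)) =
       far G (?c \<bullet>\<^bsub>V\<^esub> (idn V ?h \<odot>\<^bsub>V\<^esub> ?n)) \<bullet>\<^bsub>U\<^esub> lxm G ?h \<one>\<^bsub>V\<^esub> \<bullet>\<^bsub>U\<^esub> (idn U (fob G ?h) \<odot>\<^bsub>U\<^esub> lxu G)"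
    by (rule G.lxm_nat_extend) (use xy ob in simp_all)
  also have "(far G (?c \<bullet>\<^bsub>V\<^esub> (idn V ?h \<odot>\<^bsub>V\<^esub> ?n)) \<bullet>\<^bsub>U\<^esub> lxm G ?h \<one>\<^bsub>V\<^esub> \<bullet>\<^bsub>U\<^esub> (idn U (fob G ?h) \<odot>\<^bsub>U\<^esub> lxu G)) \<bullet>\<^bsub>U\<^esub> inv_ar U (run U (fob G ?h)) =
       far G (?c \<bullet>\<^bsub>V\<^esub> (idn V ?h \<odot>\<^bsub>V\<^esub> ?n)) \<bullet>\<^bsub>U\<^esub> far G (inv_ar V (run V ?h))"
    unfolding G.lxm_inv_run[OF ob(4), symmetric] using xy ob by simp
  also have "\<dots> = far G ?\<rho>" using xy ob by (simp add: G.far_cmp')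
  finally have e: "e = cur U (fob G ?k) ?Gx (fob G y) ?\<phi> \<bullet>\<^bsub>U\<^esub> far G ?\<rho>"
    by (simp add: e_def enriched_G_def adj_iso_def)
  have "unc V ?FGx y ?\<rho> = unc V x y (idn V ?h) \<bullet>\<^bsub>V\<^esub> (idn V ?h \<odot>\<^bsub>V\<^esub> (\<epsilon> x \<bullet>\<^bsub>V\<^esub> lun V ?FGx)) \<bullet>\<^bsub>V\<^esub> asc V ?h \<one>\<^bsub>V\<^esub> ?FGx \<bullet>\<^bsub>V\<^esub> (inv_ar V (run V ?h) \<odot>\<^bsub>V\<^esub> idn V ?FGx)"
    using xy ob by (simp add: V.unc_vCmp_cmp)
  also have "\<dots> = evl V x y \<bullet>\<^bsub>V\<^esub> (idn V ?h \<odot>\<^bsub>V\<^esub> \<epsilon> x)"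
    using xy ob by (simp add: V.asc_inv_run unc_def)
  finally have u: "evl V ?FGx y \<bullet>\<^bsub>V\<^esub> (?\<rho> \<odot>\<^bsub>V\<^esub> idn V ?FGx) = evl V x y \<bullet>\<^bsub>V\<^esub> (idn V ?h \<odot>\<^bsub>V\<^esub> \<epsilon> x)"
    by (simp only: unc_def)
  show "e \<in> Ar U" "Dom U e = fob G (ihm V x y)" "Cod U e = ihm U (fob G x) (fob G y)"
    unfolding e using xy ob \<rho> \<phi> by simp_all
  have "unc U (fob G x) (fob G y) e = ?\<phi> \<bullet>\<^bsub>U\<^esub> (far G ?\<rho> \<odot>\<^bsub>U\<^esub> idn U ?Gx)"
    unfolding e using xy ob \<rho> \<phi> by (subst U.unc_cmp) (simp_all del: U.cmp_assoc' V.cmp_simps U.cmp_simps)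
  also have "\<dots> = far G (evl V ?FGx y) \<bullet>\<^bsub>U\<^esub> lxm G ?k ?FGx \<bullet>\<^bsub>U\<^esub>
     ((far G ?\<rho> \<bullet>\<^bsub>U\<^esub> idn U (fob G ?h)) \<odot>\<^bsub>U\<^esub> (far G (idn V ?FGx) \<bullet>\<^bsub>U\<^esub> \<eta> ?Gx))"
    using xy ob \<rho> by (simp del: V.cmp_simps)
  also have "\<dots> = far G (evl V ?FGx y \<bullet>\<^bsub>V\<^esub> (?\<rho> \<odot>\<^bsub>V\<^esub> idn V ?FGx)) \<bullet>\<^bsub>U\<^esub> lxm G ?h ?FGx \<bullet>\<^bsub>U\<^esub> (idn U (fob G ?h) \<odot>\<^bsub>U\<^esub> \<eta> ?Gx)"
    by (rule G.lxm_nat_extend) (use xy ob \<rho> in \<open>simp_all del: V.cmp_simps\<close>)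
  also have "\<dots> = far G (evl V x y) \<bullet>\<^bsub>U\<^esub> lxm G ?h x \<bullet>\<^bsub>U\<^esub> ((far G (idn V ?h) \<bullet>\<^bsub>U\<^esub> idn U (fob G ?h)) \<odot>\<^bsub>U\<^esub> (far G (\<epsilon> x) \<bullet>\<^bsub>U\<^esub> \<eta> ?Gx))"
    unfolding u by (rule G.lxm_nat_extend[symmetric]) (use xy ob in simp_all)
  \<comment> \<open>The last factor is \<open>G \<epsilon> \<bullet> \<eta>\<close>, the identity of \<open>G x\<close>.\<close>
  finally show "unc U (fob G x) (fob G y) e = far G (evl V x y) \<bullet>\<^bsub>U\<^esub> lxm G (ihm V x y) x"
    using xy ob by (simp add: triangle_G)
qed

lemma unc_enriched_G:
  assumes "x \<in> Ob V" "y \<in> Ob V" "f \<in> Ar V" "Cod V f = ihm V x y" "k \<in> Ar U" "Cod U k = fob G (Dom V f)"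
  shows "unc U (fob G x) (fob G y) (vfa (enriched_G U V F G \<eta> \<epsilon>) x y \<bullet>\<^bsub>U\<^esub> far G f \<bullet>\<^bsub>U\<^esub> k) =
    far G (unc V x y f) \<bullet>\<^bsub>U\<^esub> lxm G (Dom V f) x \<bullet>\<^bsub>U\<^esub> (k \<odot>\<^bsub>U\<^esub> idn U (fob G x))"
proof -
  note e = enriched_G_hom[OF assms(1,2)]
  have "unc U (fob G x) (fob G y) (vfa (enriched_G U V F G \<eta> \<epsilon>) x y \<bullet>\<^bsub>U\<^esub> far G f \<bullet>\<^bsub>U\<^esub> k) =
    (far G (evl V x y) \<bullet>\<^bsub>U\<^esub> lxm G (ihm V x y) x) \<bullet>\<^bsub>U\<^esub> ((far G f \<bullet>\<^bsub>U\<^esub> k) \<odot>\<^bsub>U\<^esub> idn U (fob G x))"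
    using assms e by (simp add: U.unc_cmp)
  also have "\<dots> = far G (evl V x y) \<bullet>\<^bsub>U\<^esub> lxm G (ihm V x y) x \<bullet>\<^bsub>U\<^esub> ((far G f \<bullet>\<^bsub>U\<^esub> k) \<odot>\<^bsub>U\<^esub> (far G (idn V x) \<bullet>\<^bsub>U\<^esub> idn U (fob G x)))"
    using assms by simp
  also have "\<dots> = far G (evl V x y \<bullet>\<^bsub>V\<^esub> (f \<odot>\<^bsub>V\<^esub> idn V x)) \<bullet>\<^bsub>U\<^esub> lxm G (Dom V f) x \<bullet>\<^bsub>U\<^esub> (k \<odot>\<^bsub>U\<^esub> idn U (fob G x))"
    by (rule G.lxm_nat_extend) (use assms in simp_all)
  finally show ?thesis by (simp only: unc_def)
qed

lemma tilde_ob_act: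
  assumes R: "vfunctor V Y (self_enriched V) R" and xy: "x \<in> vOb Y" "y \<in> vOb Y"
  shows "act U (tilde_ob U V F G \<eta> \<epsilon> R) x y = far G (act V R x y) \<bullet>\<^bsub>U\<^esub> lxm G (vHom Y x y) (vfo R x)"
proof -
  have Y: "vcategory V Y" using R by (simp add: vfunctor_def)
  note s = xy V.vfunctor_typing[OF R] V.vcategory_typing[OF Y]
  show ?thesis
    using unc_enriched_G[of "vfo R x" "vfo R y" "vfa R x y" "idn U (fob G (vHom Y x y))"]
    by (simp add: s act_def)
qed

lemma tilde_ob_vfunctor:
  assumes R: "vfunctor V Y (self_enriched V) R"
  shows "vfunctor U (base_change U G Y) (self_enriched U) (tilde_ob U V F G \<eta> \<epsilon> R)"
proof -
  have Y: "vcategory V Y" using R by (simp add: vfunctor_def)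
  note s = V.vfunctor_typing[OF R] V.vcategory_typing[OF Y] tilde_ob_act[OF R]
  show ?thesis
  proof (rule U.vfunctor_actI)
    show "vcategory U (base_change U G Y)"
      by (rule base_change_vcategory[OF G.lax_monoidal_functor_axioms Y])
  next
    fix x y assume "x \<in> vOb (base_change U G Y)" "y \<in> vOb (base_change U G Y)"
    then show "vfa (tilde_ob U V F G \<eta> \<epsilon> R) x y \<in> Hom U (vHom (base_change U G Y) x y)
            (ihm U (vfo (tilde_ob U V F G \<eta> \<epsilon> R) x) (vfo (tilde_ob U V F G \<eta> \<epsilon> R) y))"
      by (simp add: s enriched_G_hom)
  next
    fix x assume "x \<in> vOb (base_change U G Y)"
    then show "act U (tilde_ob U V F G \<eta> \<epsilon> R) x x \<bullet>\<^bsub>U\<^esub>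
         (vId (base_change U G Y) x \<odot>\<^bsub>U\<^esub> idn U (vfo (tilde_ob U V F G \<eta> \<epsilon> R) x)) =
         lun U (vfo (tilde_ob U V F G \<eta> \<epsilon> R) x)"
      using G.lax_action_unit[of "vId Y x" "vHom Y x x" "vfo R x" "act V R x x"] V.vfunctor_act(1)[OF R]
      by (simp add: s)
  next
    fix x y z assume "x \<in> vOb (base_change U G Y)" "y \<in> vOb (base_change U G Y)" "z \<in> vOb (base_change U G Y)"
    then show "act U (tilde_ob U V F G \<eta> \<epsilon> R) x z \<bullet>\<^bsub>U\<^esub>
         (vCmp (base_change U G Y) x y z \<odot>\<^bsub>U\<^esub> idn U (vfo (tilde_ob U V F G \<eta> \<epsilon> R) x)) =
         act U (tilde_ob U V F G \<eta> \<epsilon> R) y z \<bullet>\<^bsub>U\<^esub>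
         (idn U (vHom (base_change U G Y) y z) \<odot>\<^bsub>U\<^esub> act U (tilde_ob U V F G \<eta> \<epsilon> R) x y) \<bullet>\<^bsub>U\<^esub>
         asc U (vHom (base_change U G Y) y z) (vHom (base_change U G Y) x y) (vfo (tilde_ob U V F G \<eta> \<epsilon> R) x)"
      using G.lax_action_assoc[of "vHom Y y z" "vHom Y x y" "vfo R x" "vCmp Y x y z" "vHom Y x z" "act V R x z" "vfo R z"
          "act V R x y" "vfo R y" "act V R y z"] V.vfunctor_act(2)[OF R]
      by (simp add: s)
  qed (simp add: s)
qed

text \<open>
  On underlying arrows the enriched right adjoint is just \<open>G\<close>.
\<close>

lemma unnam_tilde_ar:
  assumes "vfo A x \<in> Ob V" "vfo B x \<in> Ob V" "\<alpha> x \<in> Hom V \<one>\<^bsub>V\<^esub> (ihm V (vfo A x) (vfo B x))"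
  shows "tilde_ar U V F G \<eta> \<epsilon> A B \<alpha> x \<in> Hom U \<one>\<^bsub>U\<^esub> (ihm U (fob G (vfo A x)) (fob G (vfo B x)))"
    "unnam U (fob G (vfo A x)) (fob G (vfo B x)) (tilde_ar U V F G \<eta> \<epsilon> A B \<alpha> x) = far G (unnam V (vfo A x) (vfo B x) (\<alpha> x))"
proof -
  let ?a = "vfo A x" and ?b = "vfo B x"
  note e = enriched_G_hom[OF assms(1,2)]
  have al: "\<alpha> x \<in> Ar V" "Dom V (\<alpha> x) = \<one>\<^bsub>V\<^esub>" "Cod V (\<alpha> x) = ihm V ?a ?b" using assms(3) by simp_all
  have t: "tilde_ar U V F G \<eta> \<epsilon> A B \<alpha> x = vfa (enriched_G U V F G \<eta> \<epsilon>) ?a ?b \<bullet>\<^bsub>U\<^esub> far G (\<alpha> x) \<bullet>\<^bsub>U\<^esub> lxu G"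
    by (simp add: tilde_ar_def elt_map_def)
  show ty: "tilde_ar U V F G \<eta> \<epsilon> A B \<alpha> x \<in> Hom U \<one>\<^bsub>U\<^esub> (ihm U (fob G ?a) (fob G ?b))"
    unfolding t using e al by simp
  have "unnam U (fob G ?a) (fob G ?b) (tilde_ar U V F G \<eta> \<epsilon> A B \<alpha> x) =
     unc U (fob G ?a) (fob G ?b) (tilde_ar U V F G \<eta> \<epsilon> A B \<alpha> x) \<bullet>\<^bsub>U\<^esub> inv_ar U (lun U (fob G ?a))"
    using ty assms(1,2) by (intro U.unnam_eq) simp_all
  also have "unc U (fob G ?a) (fob G ?b) (tilde_ar U V F G \<eta> \<epsilon> A B \<alpha> x) =
     far G (unc V ?a ?b (\<alpha> x)) \<bullet>\<^bsub>U\<^esub> lxm G \<one>\<^bsub>V\<^esub> ?a \<bullet>\<^bsub>U\<^esub> (lxu G \<odot>\<^bsub>U\<^esub> idn U (fob G ?a))"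
    unfolding t using unc_enriched_G[OF assms(1,2) al(1,3), of "lxu G"] al by simp
  also have "(far G (unc V ?a ?b (\<alpha> x)) \<bullet>\<^bsub>U\<^esub> lxm G \<one>\<^bsub>V\<^esub> ?a \<bullet>\<^bsub>U\<^esub> (lxu G \<odot>\<^bsub>U\<^esub> idn U (fob G ?a))) \<bullet>\<^bsub>U\<^esub> inv_ar U (lun U (fob G ?a)) =
     far G (unc V ?a ?b (\<alpha> x)) \<bullet>\<^bsub>U\<^esub> far G (inv_ar V (lun V ?a))"
    unfolding G.lxm_inv_lun[OF assms(1), symmetric] using assms(1,2) al by simp
  finally show "unnam U (fob G ?a) (fob G ?b) (tilde_ar U V F G \<eta> \<epsilon> A B \<alpha> x) = far G (unnam V ?a ?b (\<alpha> x))"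
    using assms(1,2) al by (simp add: V.unnam_eq G.far_cmp')
qed

text \<open>
  The adjunction \<open>F \<stileturn> G\<close> on hom-sets: \<open>\<epsilon> b \<bullet> F t\<close> is the transpose of \<open>t : a \<rightarrow> G b\<close>.
\<close>

lemma transpose_inverse:
  assumes "t \<in> Ar U" "Cod U t = fob G b" "b \<in> Ob V"
  shows "far G (\<epsilon> b \<bullet>\<^bsub>V\<^esub> far F t) \<bullet>\<^bsub>U\<^esub> \<eta> (Dom U t) = t"
proof -
  have "far G (\<epsilon> b \<bullet>\<^bsub>V\<^esub> far F t) \<bullet>\<^bsub>U\<^esub> \<eta> (Dom U t) = far G (\<epsilon> b) \<bullet>\<^bsub>U\<^esub> far G (far F t) \<bullet>\<^bsub>U\<^esub> \<eta> (Dom U t)"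
    using assms by (simp add: G.far_cmp')
  also have "far G (far F t) \<bullet>\<^bsub>U\<^esub> \<eta> (Dom U t) = \<eta> (fob G b) \<bullet>\<^bsub>U\<^esub> t"
    using assms by (intro unit_nat) simp_all
  also have "far G (\<epsilon> b) \<bullet>\<^bsub>U\<^esub> \<eta> (fob G b) \<bullet>\<^bsub>U\<^esub> t = (far G (\<epsilon> b) \<bullet>\<^bsub>U\<^esub> \<eta> (fob G b)) \<bullet>\<^bsub>U\<^esub> t"
    using assms by simp
  finally show ?thesis using assms by (simp add: triangle_G)
qed

text \<open>
  Factorizations of \<open>t\<close> through \<open>G m\<close> and of its transpose through \<open>m\<close> correspond under the adjunction.
  Together with the pointwise description of subobjects this turns questions about \<open>G s\<close> in \<open>U\<close> into
  questions about \<open>s\<close> in \<open>V\<close>.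
\<close>

lemma factors_transpose_iff:
  assumes t: "t \<in> Ar U" "Cod U t = fob G b" and m: "m \<in> Ar V" "Cod V m = b"
  shows "factors U t (far G m) \<longleftrightarrow> factors V (\<epsilon> b \<bullet>\<^bsub>V\<^esub> far F t) m"
proof
  have b: "b \<in> Ob V" using m by auto
  assume "factors U t (far G m)"
  then obtain h where h: "h \<in> Ar U" "Dom U h = Dom U t" "Cod U h = Dom U (far G m)" "far G m \<bullet>\<^bsub>U\<^esub> h = t"
    by (rule factorsE)
  have "m \<bullet>\<^bsub>V\<^esub> \<epsilon> (Dom V m) \<bullet>\<^bsub>V\<^esub> far F h = (\<epsilon> b \<bullet>\<^bsub>V\<^esub> far F (far G m)) \<bullet>\<^bsub>V\<^esub> far F h"
    using h(1-3) m b by (simp add: counit_nat)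
  also have "\<dots> = \<epsilon> b \<bullet>\<^bsub>V\<^esub> far F (far G m \<bullet>\<^bsub>U\<^esub> h)"
    using h(1-3) m b by (simp add: F.far_cmp')
  finally have "m \<bullet>\<^bsub>V\<^esub> \<epsilon> (Dom V m) \<bullet>\<^bsub>V\<^esub> far F h = \<epsilon> b \<bullet>\<^bsub>V\<^esub> far F t" unfolding h(4) .
  then show "factors V (\<epsilon> b \<bullet>\<^bsub>V\<^esub> far F t) m"
    by (rule factorsI[rotated 3]) (use h(1-3) m b t in simp_all)
next
  have b: "b \<in> Ob V" using m by auto
  assume "factors V (\<epsilon> b \<bullet>\<^bsub>V\<^esub> far F t) m"
  then obtain h where h: "h \<in> Ar V" "Dom V h = Dom V (\<epsilon> b \<bullet>\<^bsub>V\<^esub> far F t)" "Cod V h = Dom V m" "m \<bullet>\<^bsub>V\<^esub> h = \<epsilon> b \<bullet>\<^bsub>V\<^esub> far F t"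
    by (rule factorsE)
  have hd: "Dom V h = fob F (Dom U t)" unfolding h(2) using t b by simp
  have "far G m \<bullet>\<^bsub>U\<^esub> far G h \<bullet>\<^bsub>U\<^esub> \<eta> (Dom U t) = far G (m \<bullet>\<^bsub>V\<^esub> h) \<bullet>\<^bsub>U\<^esub> \<eta> (Dom U t)"
    using h(1,3) hd m t by (simp add: G.far_cmp')
  also have "\<dots> = t" unfolding h(4) by (rule transpose_inverse[OF t b])
  finally show "factors U t (far G m)"
    by (rule factorsI[rotated 3]) (use h(1,3) hd m b t in simp_all)
qed

text \<open>
  Right adjoints preserve monomorphisms: transpose both arrows and cancel \<open>m\<close>.
\<close>

lemma far_G_monic:
  assumes "monic V m"
  shows "monic U (far G m)"
proof -
  have m: "m \<in> Ar V" using assms by (simp add: monic_def)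
  have "g = h" if gh: "g \<in> Hom U a (Dom U (far G m))" "h \<in> Hom U a (Dom U (far G m))"
    and eq: "far G m \<bullet>\<^bsub>U\<^esub> g = far G m \<bullet>\<^bsub>U\<^esub> h" for a g h
  proof -
    have g: "g \<in> Ar U" "Dom U g = a" "Cod U g = fob G (Dom V m)" and h: "h \<in> Ar U" "Dom U h = a" "Cod U h = fob G (Dom V m)"
      using gh m by simp_all
    have tr: "m \<bullet>\<^bsub>V\<^esub> \<epsilon> (Dom V m) \<bullet>\<^bsub>V\<^esub> far F k = \<epsilon> (Cod V m) \<bullet>\<^bsub>V\<^esub> far F (far G m \<bullet>\<^bsub>U\<^esub> k)"
      if "k \<in> Ar U" "Cod U k = fob G (Dom V m)" for k
    proof -
      have "m \<bullet>\<^bsub>V\<^esub> \<epsilon> (Dom V m) \<bullet>\<^bsub>V\<^esub> far F k = (\<epsilon> (Cod V m) \<bullet>\<^bsub>V\<^esub> far F (far G m)) \<bullet>\<^bsub>V\<^esub> far F k"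
        using that m by (simp add: counit_nat)
      then show ?thesis using that m by (simp add: F.far_cmp')
    qed
    have "m \<bullet>\<^bsub>V\<^esub> \<epsilon> (Dom V m) \<bullet>\<^bsub>V\<^esub> far F g = m \<bullet>\<^bsub>V\<^esub> \<epsilon> (Dom V m) \<bullet>\<^bsub>V\<^esub> far F h"
      unfolding tr[OF g(1,3)] tr[OF h(1,3)] eq ..
    then have *: "\<epsilon> (Dom V m) \<bullet>\<^bsub>V\<^esub> far F g = \<epsilon> (Dom V m) \<bullet>\<^bsub>V\<^esub> far F h"
      by (rule V.monicD[OF assms]) (use g h m in simp_all)
    have "g = far G (\<epsilon> (Dom V m) \<bullet>\<^bsub>V\<^esub> far F g) \<bullet>\<^bsub>U\<^esub> \<eta> a"
      using transpose_inverse[of g "Dom V m"] g m by simp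
    also have "\<dots> = h"
      unfolding * using transpose_inverse[of h "Dom V m"] h m by simp
    finally show ?thesis .
  qed
  then show ?thesis using m unfolding monic_def by (simp only: G.far_simps) blast
qed

lemma incl_tilde_mono:
  assumes Y: "vcategory V Y" and x: "x \<in> vOb Y" and s: "mono_into_rep V Y x s" and y: "y \<in> vOb Y"
  shows "incl U (base_change U G Y) x (tilde_mono U V F G \<eta> \<epsilon> Y x s) y = far G (incl V Y x s y)"
proof -
  have fs: "vfunctor V Y (self_enriched V) (fst s)" "snd s y \<in> Hom V \<one>\<^bsub>V\<^esub> (ihm V (vfo (fst s) y) (vHom Y x y))"
    using s y by (simp_all add: V.mono_into_rep_iff[OF Y x])
  show ?thesis
    using unnam_tilde_ar(2)[of "fst s" y "representable V Y x" "snd s"] fs(2) x y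
    by (simp add: incl_def tilde_mono_def V.vfunctor_typing[OF fs(1)] V.vcategory_typing[OF Y])
qed

lemma tilde_mono_into_rep:
  assumes Y: "vcategory V Y" and x: "x \<in> vOb Y" and s: "mono_into_rep V Y x s"
  shows "mono_into_rep U (base_change U G Y) x (tilde_mono U V F G \<eta> \<epsilon> Y x s)"
proof -
  let ?GY = "base_change U G Y" and ?t = "tilde_mono U V F G \<eta> \<epsilon> Y x s"
  have GY: "vcategory U ?GY" by (rule base_change_vcategory[OF G.lax_monoidal_functor_axioms Y])
  have fs: "vfunctor V Y (self_enriched V) (fst s)"
    and ss: "\<And>y. y \<in> vOb Y \<Longrightarrow> snd s y \<in> Hom V \<one>\<^bsub>V\<^esub> (ihm V (vfo (fst s) y) (vHom Y x y))"
    using s by (simp_all add: V.mono_into_rep_iff[OF Y x])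
  note st = x V.vfunctor_typing[OF fs] V.vcategory_typing[OF Y] V.incl_simps[OF Y x s] incl_tilde_mono[OF Y x s] tilde_ob_act[OF fs]
  have ft: "fst ?t = tilde_ob U V F G \<eta> \<epsilon> (fst s)" by (simp add: tilde_mono_def)
  show ?thesis
  proof (subst U.mono_into_rep_iff[OF GY], simp add: x, intro conjI ballI)
    show "vfunctor U ?GY (self_enriched U) (fst ?t)" unfolding ft by (rule tilde_ob_vfunctor[OF fs])
    fix y assume y: "y \<in> vOb ?GY"
    then have y: "y \<in> vOb Y" by simp
    show "monic U (incl U ?GY x ?t y)"
      using y by (simp add: st far_G_monic V.incl_monic[OF Y x s])
    show "snd ?t y \<in> Hom U \<one>\<^bsub>U\<^esub> (ihm U (vfo (fst ?t) y) (vHom ?GY x y))"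
      unfolding tilde_mono_def using unnam_tilde_ar(1)[of "fst s" y "representable V Y x" "snd s"] ss[OF y] y
      by (simp add: st)
  next
    show "intertwines U ?GY (fst ?t) (representable U ?GY x) (incl U ?GY x ?t)"
      unfolding intertwines_def
    proof (intro ballI)
      fix y z assume "y \<in> vOb ?GY" "z \<in> vOb ?GY"
      then have yz: "y \<in> vOb Y" "z \<in> vOb Y" by simp_all
      let ?i = "incl V Y x s" and ?S = "vfo (fst s)"
      have "incl U ?GY x ?t z \<bullet>\<^bsub>U\<^esub> act U (fst ?t) y z =
         far G (?i z \<bullet>\<^bsub>V\<^esub> act V (fst s) y z) \<bullet>\<^bsub>U\<^esub> lxm G (vHom Y y z) (?S y)"
        unfolding ft using yz by (simp add: st G.far_cmp')
      also have "\<dots> = far G (vCmp Y x y z \<bullet>\<^bsub>V\<^esub> (idn V (vHom Y y z) \<odot>\<^bsub>V\<^esub> ?i y)) \<bullet>\<^bsub>U\<^esub> lxm G (vHom Y y z) (?S y) \<bullet>\<^bsub>U\<^esub>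
          (idn U (fob G (vHom Y y z)) \<odot>\<^bsub>U\<^esub> idn U (fob G (?S y)))"
        unfolding V.incl_natural[OF Y x s yz] using yz by (simp add: st)
      also have "\<dots> = far G (vCmp Y x y z) \<bullet>\<^bsub>U\<^esub> lxm G (vHom Y y z) (vHom Y x y) \<bullet>\<^bsub>U\<^esub>
          ((far G (idn V (vHom Y y z)) \<bullet>\<^bsub>U\<^esub> idn U (fob G (vHom Y y z))) \<odot>\<^bsub>U\<^esub> (far G (?i y) \<bullet>\<^bsub>U\<^esub> idn U (fob G (?S y))))"
        by (rule G.lxm_nat_extend[symmetric]) (use yz in \<open>simp_all add: st\<close>)
      also have "\<dots> = act U (representable U ?GY x) y z \<bullet>\<^bsub>U\<^esub> (idn U (vHom ?GY y z) \<odot>\<^bsub>U\<^esub> incl U ?GY x ?t y)"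
        using yz by (simp add: st U.representable_act[OF GY])
      finally show "incl U ?GY x ?t z \<bullet>\<^bsub>U\<^esub> act U (fst ?t) y z =
         act U (representable U ?GY x) y z \<bullet>\<^bsub>U\<^esub> (idn U (vHom ?GY y z) \<odot>\<^bsub>U\<^esub> incl U ?GY x ?t y)" .
    qed
  qed
qed

text \<open>
  Restriction along \<open>f : g \<rightarrow> G Y(x,y)\<close> of a transported subobject is the transport of the restriction
  along the transpose \<open>F g \<rightarrow> Y(x,y)\<close>. By adjunction, \<open>t\<close> lies in \<open>G p\<close> iff its transpose \<open>t'\<close> lies in \<open>p\<close>, that
  is, iff the composite of \<open>t'\<close> and \<open>f'\<close> lies in \<open>s\<close>. It remains to compare this composite, defined on
  \<open>F a \<otimes> F g\<close>, with the composite of \<open>t\<close> and \<open>f\<close> in \<open>G\<^sub>*Y\<close>, defined on \<open>a \<otimes> g\<close>: each is obtained from the other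
  by transposing and restricting along the tensor comparisons of \<open>F\<close> and \<open>G\<close>, by monoidality of the
  counit in one direction and by naturality in the other. This is the reason for taking
  \<open>F ` \<G>\<close> as the generating family of \<open>V\<close>.
\<close>

lemma tilde_restricts:
  assumes Y: "vcategory V Y" and x: "x \<in> vOb Y" and y: "y \<in> vOb Y"
    and s: "mono_into_rep V Y x s" and p: "mono_into_rep V Y y p"
    and f: "f \<in> Ar U" "Cod U f = fob G (vHom Y x y)"
    and r: "restricts V Y x y (\<epsilon> (vHom Y x y) \<bullet>\<^bsub>V\<^esub> far F f) s p"
  shows "restricts U (base_change U G Y) x y f (tilde_mono U V F G \<eta> \<epsilon> Y x s) (tilde_mono U V F G \<eta> \<epsilon> Y y p)"
  unfolding restricts_def
proof (intro ballI impI)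
  let ?GY = "base_change U G Y"
  fix z t assume "z \<in> vOb ?GY" and t: "t \<in> Ar U" "Cod U t = vHom ?GY y z"
  then have z: "z \<in> vOb Y" and t: "t \<in> Ar U" "Cod U t = fob G (vHom Y y z)" by simp_all
  let ?a = "vHom Y y z" and ?b = "vHom Y x y" and ?c = "vCmp Y x y z" and ?i = "incl V Y x s z"
  note st = x y z f t V.vcategory_typing[OF Y] V.incl_simps[OF Y x s] V.incl_simps[OF Y y p]
  define t' where "t' = \<epsilon> ?a \<bullet>\<^bsub>V\<^esub> far F t"
  define f' where "f' = \<epsilon> ?b \<bullet>\<^bsub>V\<^esub> far F f"
  have t': "t' \<in> Ar V" "Dom V t' = fob F (Dom U t)" "Cod V t' = ?a"
    and f': "f' \<in> Ar V" "Dom V f' = fob F (Dom U f)" "Cod V f' = ?b" by (simp_all add: t'_def f'_def st)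
  have tt: "far G t' \<bullet>\<^bsub>U\<^esub> \<eta> (Dom U t) = t" "far G f' \<bullet>\<^bsub>U\<^esub> \<eta> (Dom U f) = f"
    unfolding t'_def f'_def by (rule transpose_inverse; simp add: st)+
  let ?w = "(far G ?c \<bullet>\<^bsub>U\<^esub> lxm G ?a ?b) \<bullet>\<^bsub>U\<^esub> (t \<odot>\<^bsub>U\<^esub> f)"
  have w: "?w \<in> Ar U" "Dom U ?w = Dom U t \<otimes>\<^bsub>U\<^esub> Dom U f" "Cod U ?w = fob G (vHom Y x z)" by (simp_all add: st)
  \<comment> \<open>The transpose of the composite in \<open>G\<^sub>*Y\<close>, restricted along the tensor comparison of \<open>F\<close>, is the composite of the transposes.\<close>
  have transpose: "(\<epsilon> (vHom Y x z) \<bullet>\<^bsub>V\<^esub> far F ?w) \<bullet>\<^bsub>V\<^esub> lxm F (Dom U t) (Dom U f) = ?c \<bullet>\<^bsub>V\<^esub> (t' \<odot>\<^bsub>V\<^esub> f')"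
  proof -
    have "(\<epsilon> (vHom Y x z) \<bullet>\<^bsub>V\<^esub> far F ?w) \<bullet>\<^bsub>V\<^esub> lxm F (Dom U t) (Dom U f) =
       (\<epsilon> (vHom Y x z) \<bullet>\<^bsub>V\<^esub> far F (far G ?c)) \<bullet>\<^bsub>V\<^esub> far F (lxm G ?a ?b) \<bullet>\<^bsub>V\<^esub> (far F (t \<odot>\<^bsub>U\<^esub> f) \<bullet>\<^bsub>V\<^esub> lxm F (Dom U t) (Dom U f))"
      by (simp add: st F.far_cmp')
    also have "\<epsilon> (vHom Y x z) \<bullet>\<^bsub>V\<^esub> far F (far G ?c) = ?c \<bullet>\<^bsub>V\<^esub> \<epsilon> (?a \<otimes>\<^bsub>V\<^esub> ?b)"
      by (rule counit_nat) (simp_all add: st)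
    also have "far F (t \<odot>\<^bsub>U\<^esub> f) \<bullet>\<^bsub>V\<^esub> lxm F (Dom U t) (Dom U f) = lxm F (fob G ?a) (fob G ?b) \<bullet>\<^bsub>V\<^esub> (far F t \<odot>\<^bsub>V\<^esub> far F f)"
      by (rule F.lxm_nat[symmetric]) (simp_all add: st)
    also have "(?c \<bullet>\<^bsub>V\<^esub> \<epsilon> (?a \<otimes>\<^bsub>V\<^esub> ?b)) \<bullet>\<^bsub>V\<^esub> far F (lxm G ?a ?b) \<bullet>\<^bsub>V\<^esub> lxm F (fob G ?a) (fob G ?b) \<bullet>\<^bsub>V\<^esub> (far F t \<odot>\<^bsub>V\<^esub> far F f) =
       ?c \<bullet>\<^bsub>V\<^esub> (\<epsilon> (?a \<otimes>\<^bsub>V\<^esub> ?b) \<bullet>\<^bsub>V\<^esub> far F (lxm G ?a ?b) \<bullet>\<^bsub>V\<^esub> lxm F (fob G ?a) (fob G ?b)) \<bullet>\<^bsub>V\<^esub> (far F t \<odot>\<^bsub>V\<^esub> far F f)"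
      by (simp add: st)
    finally show ?thesis by (simp add: counit_monoidal st t'_def f'_def)
  qed
  have "factors U ?w (far G ?i) \<longleftrightarrow> factors V (?c \<bullet>\<^bsub>V\<^esub> (t' \<odot>\<^bsub>V\<^esub> f')) ?i"
  proof
    assume "factors U ?w (far G ?i)"
    then have "factors V (\<epsilon> (vHom Y x z) \<bullet>\<^bsub>V\<^esub> far F ?w) ?i"
      by (subst (asm) factors_transpose_iff[OF w(1,3)]) (simp_all add: st)
    then show "factors V (?c \<bullet>\<^bsub>V\<^esub> (t' \<odot>\<^bsub>V\<^esub> f')) ?i"
      unfolding transpose[symmetric] by (rule V.factors_precompose) (use w in \<open>simp_all add: st\<close>)
  next
    assume "factors V (?c \<bullet>\<^bsub>V\<^esub> (t' \<odot>\<^bsub>V\<^esub> f')) ?i"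
    then obtain k where k: "k \<in> Ar V" "Dom V k = Dom V (?c \<bullet>\<^bsub>V\<^esub> (t' \<odot>\<^bsub>V\<^esub> f'))" "Cod V k = Dom V ?i" "?i \<bullet>\<^bsub>V\<^esub> k = ?c \<bullet>\<^bsub>V\<^esub> (t' \<odot>\<^bsub>V\<^esub> f')"
      by (rule factorsE)
    have kd: "Dom V k = fob F (Dom U t) \<otimes>\<^bsub>V\<^esub> fob F (Dom U f)" unfolding k(2) by (simp add: st t' f')
    \<comment> \<open>Conversely, a factorization of the composite of the transposes is moved to \<open>a \<otimes> g\<close> by the units and the tensor comparison of \<open>G\<close>.\<close>
    let ?l = "lxm G (fob F (Dom U t)) (fob F (Dom U f)) \<bullet>\<^bsub>U\<^esub> (\<eta> (Dom U t) \<odot>\<^bsub>U\<^esub> \<eta> (Dom U f))"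
    have "far G ?i \<bullet>\<^bsub>U\<^esub> far G k \<bullet>\<^bsub>U\<^esub> ?l = far G (?i \<bullet>\<^bsub>V\<^esub> k) \<bullet>\<^bsub>U\<^esub> ?l"
      using k(1,3) kd by (simp add: G.far_cmp' st)
    also have "\<dots> = far G ?c \<bullet>\<^bsub>U\<^esub> lxm G ?a ?b \<bullet>\<^bsub>U\<^esub> ((far G t' \<bullet>\<^bsub>U\<^esub> \<eta> (Dom U t)) \<odot>\<^bsub>U\<^esub> (far G f' \<bullet>\<^bsub>U\<^esub> \<eta> (Dom U f)))"
      unfolding k(4) by (rule G.lxm_nat_extend[symmetric]) (simp_all add: st t' f')
    also have "\<dots> = ?w" unfolding tt by (simp add: st)
    finally show "factors U ?w (far G ?i)"
      by (rule factorsI[rotated 3]) (use k(1,3) kd w in \<open>simp_all add: st\<close>)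
  qed
  moreover have "factors U t (far G (incl V Y y p z)) \<longleftrightarrow> factors V t' (incl V Y y p z)"
    unfolding t'_def by (rule factors_transpose_iff) (simp_all add: st)
  moreover have "factors V t' (incl V Y y p z) \<longleftrightarrow> factors V (?c \<bullet>\<^bsub>V\<^esub> (t' \<odot>\<^bsub>V\<^esub> f')) ?i"
    using r z t' unfolding restricts_def f'_def by blast
  ultimately show "factors U t (incl U ?GY y (tilde_mono U V F G \<eta> \<epsilon> Y y p) z) \<longleftrightarrow>
     factors U (vCmp ?GY x y z \<bullet>\<^bsub>U\<^esub> (t \<odot>\<^bsub>U\<^esub> f)) (incl U ?GY x (tilde_mono U V F G \<eta> \<epsilon> Y x s) z)"
    by (simp only: incl_tilde_mono[OF Y x s z] incl_tilde_mono[OF Y y p z] base_change_sels)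
qed

end

section \<open>Reflection of factorizations\<close>

text \<open>
  The shape \<open>0 \<rightarrow> 2 \<leftarrow> 1\<close> of a cospan: \<open>3\<close> and \<open>4\<close> encode the two non-identity arrows, and every object encodes
  its identity.
\<close>

definition cospan_cat :: "(nat, nat) cat" where
  "cospan_cat = \<lparr>Ob = {0, 1, 2}, Ar = {0, 1, 2, 3, 4}, Dom = \<lambda>k. if k = 3 then 0 else if k = 4 then 1 else k,
     Cod = \<lambda>k. if 3 \<le> k then 2 else k, idn = \<lambda>k. k, cmp = \<lambda>l k. if k < 3 then l else k\<rparr>"

definition cospan :: "('o, 'a, 'm) cat_scheme \<Rightarrow> 'a \<Rightarrow> 'a \<Rightarrow> (nat, nat, 'o, 'a) functr" where
  "cospan C f g =
     \<lparr>fob = \<lambda>k. if k = 0 then Dom C f else if k = 1 then Dom C g else Cod C f,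
      far = \<lambda>k. if k = 3 then f else if k = 4 then g
        else idn C (if k = 0 then Dom C f else if k = 1 then Dom C g else Cod C f)\<rparr>"

lemma category_cospan_cat: "category cospan_cat"
  by unfold_locales (auto simp: cospan_cat_def split: if_splits)

context category
begin

lemma cospan_functor:
  assumes "f \<in> Ar C" "g \<in> Ar C" "Cod C f = Cod C g"
  shows "is_functor cospan_cat C (cospan C f g)"
proof -
  interpret K: category cospan_cat by (rule category_cospan_cat)
  show ?thesis
    by unfold_locales (use assms in \<open>auto simp: cospan_cat_def cospan_def split: if_splits\<close>)
qed

lemma regular_category_pullback:
  assumes reg: "regular_category C" and f: "f \<in> Ar C" and g: "g \<in> Ar C" and fg: "Cod C f = Cod C g"
  shows "\<exists>p q. is_pullback C p q f g"
proof -
  let ?D = "cospan C f g"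
  have "finite (Ob cospan_cat)" "finite (Ar cospan_cat)" by (simp_all add: cospan_cat_def)
  then obtain l \<pi> where lim: "is_limit cospan_cat C ?D l \<pi>"
    using reg category_cospan_cat cospan_functor[OF f g fg] unfolding regular_category_def by blast
  have cone: "is_cone cospan_cat C ?D l' \<pi>' \<longleftrightarrow> l' \<in> Ob C \<and> \<pi>' 0 \<in> Hom C l' (Dom C f) \<and> \<pi>' 1 \<in> Hom C l' (Dom C g) \<and>
      \<pi>' 2 \<in> Hom C l' (Cod C f) \<and> f \<bullet> \<pi>' 0 = \<pi>' 2 \<and> g \<bullet> \<pi>' 1 = \<pi>' 2" for l' \<pi>'
  proof -
    have "(\<forall>j k. \<forall>t \<in> Hom cospan_cat j k. P j k t) \<longleftrightarrow> P 0 0 0 \<and> P 1 1 1 \<and> P 2 2 2 \<and> P 0 2 3 \<and> P 1 2 (4::nat)" for P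
      by (auto simp: cospan_cat_def)
    then show ?thesis
      using f g fg unfolding is_cone_def by (auto simp: cospan_cat_def cospan_def)
  qed
  have \<pi>: "l \<in> Ob C" "\<pi> 0 \<in> Ar C" "Dom C (\<pi> 0) = l" "Cod C (\<pi> 0) = Dom C f"
    "\<pi> 1 \<in> Ar C" "Dom C (\<pi> 1) = l" "Cod C (\<pi> 1) = Dom C g" "f \<bullet> \<pi> 0 = g \<bullet> \<pi> 1"
    using lim unfolding is_limit_def cone by simp_all
  have univ: "\<exists>!h. h \<in> Hom C w l \<and> \<pi> 0 \<bullet> h = p \<and> \<pi> 1 \<bullet> h = q"
    if p: "p \<in> Hom C w (Dom C f)" and q: "q \<in> Hom C w (Dom C g)" and pq: "f \<bullet> p = g \<bullet> q" for w p q
  proof -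
    \<comment> \<open>The leg of a cone at the vertex \<open>2\<close> is forced.\<close>
    let ?\<tau> = "\<lambda>k::nat. if k = 0 then p else if k = 1 then q else f \<bullet> p"
    have w: "w \<in> Ob C" using p by auto
    have "is_cone cospan_cat C ?D w ?\<tau>"
      unfolding cone using p q pq f g w fg by simp
    then have "\<exists>!h. h \<in> Hom C w l \<and> (\<forall>k \<in> Ob cospan_cat. \<pi> k \<bullet> h = ?\<tau> k)"
      using lim unfolding is_limit_def by blast
    moreover have "(\<forall>k \<in> Ob cospan_cat. \<pi> k \<bullet> h = ?\<tau> k) \<longleftrightarrow> \<pi> 0 \<bullet> h = p \<and> \<pi> 1 \<bullet> h = q" if h: "h \<in> Hom C w l" for h
    proof -
      have "\<pi> 2 \<bullet> h = f \<bullet> \<pi> 0 \<bullet> h"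
        using lim h f \<pi>(1-7) unfolding is_limit_def cone by (metis cmp_assoc' mem_Hom_iff)
      then show ?thesis by (auto simp: cospan_cat_def)
    qed
    ultimately show ?thesis by (metis (no_types, lifting))
  qed
  have "is_pullback C (\<pi> 0) (\<pi> 1) f g"
    unfolding is_pullback_def
    by (intro conjI allI ballI impI; (subst \<pi>(3), rule univ, assumption+ | simp add: \<pi> f g fg del: One_nat_def))
  then show ?thesis by blast
qed

end

context closed_monoidal_adjunction
begin

text \<open>
  Let \<open>p, q\<close> be the pullback of \<open>m, n\<close>. If \<open>G m\<close> factors through \<open>G n\<close>, then the transpose of \<open>G m\<close>, which is
  \<open>m \<bullet> \<epsilon>\<close>, factors through \<open>n\<close>, so that \<open>\<epsilon>\<close> lifts along \<open>p\<close>; transposing back splits \<open>G p\<close>. Being also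
  monic, \<open>G p\<close> is invertible, hence so is \<open>p\<close>, and \<open>q \<bullet> inv p\<close> is the factorization of \<open>m\<close>.
\<close>

lemma conservative_reflects_factors:
  assumes G: "conservative V U G" and reg: "regular_category V"
    and m: "m \<in> Ar V" and n: "monic V n" and mn: "Cod V m = Cod V n"
    and fac: "factors U (far G m) (far G n)"
  shows "factors V m n"
proof -
  have n': "n \<in> Ar V" using n by (simp add: monic_def)
  obtain p q where pb: "is_pullback V p q m n"
    using V.regular_category_pullback[OF reg m n' mn] by blast
  then have ty: "p \<in> Ar V" "Cod V p = Dom V m" "q \<in> Ar V" "Dom V q = Dom V p" "Cod V q = Dom V n"
    and sq: "m \<bullet>\<^bsub>V\<^esub> p = n \<bullet>\<^bsub>V\<^esub> q"
    unfolding is_pullback_def using m by (auto simp: mn)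
  have univ: "\<exists>!h. h \<in> Hom V x (Dom V p) \<and> p \<bullet>\<^bsub>V\<^esub> h = p' \<and> q \<bullet>\<^bsub>V\<^esub> h = q'"
    if "p' \<in> Hom V x (Dom V m)" "q' \<in> Hom V x (Dom V n)" "m \<bullet>\<^bsub>V\<^esub> p' = n \<bullet>\<^bsub>V\<^esub> q'" for x p' q'
    using pb that unfolding is_pullback_def by blast
  have pmono: "monic V p"
    unfolding monic_def
  proof (intro conjI allI ballI impI)
    fix x g h assume g: "g \<in> Hom V x (Dom V p)" and h: "h \<in> Hom V x (Dom V p)" and eq: "p \<bullet>\<^bsub>V\<^esub> g = p \<bullet>\<^bsub>V\<^esub> h"
    have qn: "n \<bullet>\<^bsub>V\<^esub> q \<bullet>\<^bsub>V\<^esub> k = m \<bullet>\<^bsub>V\<^esub> p \<bullet>\<^bsub>V\<^esub> k" if "k \<in> Hom V x (Dom V p)" for k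
    proof -
      have "n \<bullet>\<^bsub>V\<^esub> q \<bullet>\<^bsub>V\<^esub> k = (n \<bullet>\<^bsub>V\<^esub> q) \<bullet>\<^bsub>V\<^esub> k" using that ty n' by simp
      also have "\<dots> = m \<bullet>\<^bsub>V\<^esub> p \<bullet>\<^bsub>V\<^esub> k" unfolding sq[symmetric] using that ty m by simp
      finally show ?thesis .
    qed
    have "n \<bullet>\<^bsub>V\<^esub> q \<bullet>\<^bsub>V\<^esub> g = n \<bullet>\<^bsub>V\<^esub> q \<bullet>\<^bsub>V\<^esub> h" unfolding qn[OF g] qn[OF h] eq ..
    then have qq: "q \<bullet>\<^bsub>V\<^esub> g = q \<bullet>\<^bsub>V\<^esub> h"
      by (rule V.monicD[OF n]) (use g h ty in simp_all)
    have "m \<bullet>\<^bsub>V\<^esub> p \<bullet>\<^bsub>V\<^esub> g = n \<bullet>\<^bsub>V\<^esub> q \<bullet>\<^bsub>V\<^esub> g" by (rule qn[OF g, symmetric])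
    then have "\<exists>!k. k \<in> Hom V x (Dom V p) \<and> p \<bullet>\<^bsub>V\<^esub> k = p \<bullet>\<^bsub>V\<^esub> g \<and> q \<bullet>\<^bsub>V\<^esub> k = q \<bullet>\<^bsub>V\<^esub> g"
      by (intro univ) (use g ty in simp_all)
    then show "g = h" using g h eq qq by (metis (no_types, lifting))
  qed (rule ty)
  let ?s = "Dom V m" and ?b = "Cod V m"
  have "factors V (\<epsilon> ?b \<bullet>\<^bsub>V\<^esub> far F (far G m)) n"
    using fac m n' mn by (subst factors_transpose_iff[symmetric]) simp_all
  then have "factors V (m \<bullet>\<^bsub>V\<^esub> \<epsilon> ?s) n" using m by (simp add: counit_nat)
  then obtain h where h: "h \<in> Ar V" "Dom V h = Dom V (m \<bullet>\<^bsub>V\<^esub> \<epsilon> ?s)" "Cod V h = Dom V n" "n \<bullet>\<^bsub>V\<^esub> h = m \<bullet>\<^bsub>V\<^esub> \<epsilon> ?s"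
    by (rule factorsE)
  have hd: "Dom V h = fob F (fob G ?s)" unfolding h(2) using m by simp
  have "\<exists>!k. k \<in> Hom V (fob F (fob G ?s)) (Dom V p) \<and> p \<bullet>\<^bsub>V\<^esub> k = \<epsilon> ?s \<and> q \<bullet>\<^bsub>V\<^esub> k = h"
    by (rule univ) (use h(1,3,4) hd m in simp_all)
  then obtain k where k: "k \<in> Ar V" "Dom V k = fob F (fob G ?s)" "Cod V k = Dom V p" "p \<bullet>\<^bsub>V\<^esub> k = \<epsilon> ?s" by auto
  \<comment> \<open>The transpose of the lift of the counit, a section of \<open>G p\<close>.\<close>
  let ?r = "far G k \<bullet>\<^bsub>U\<^esub> \<eta> (fob G ?s)"
  have r: "?r \<in> Ar U" "Dom U ?r = fob G ?s" "Cod U ?r = fob G (Dom V p)" using k m by simp_all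
  have "far G p \<bullet>\<^bsub>U\<^esub> ?r = far G (p \<bullet>\<^bsub>V\<^esub> k) \<bullet>\<^bsub>U\<^esub> \<eta> (fob G ?s)"
    using k(1-3) ty m by (simp add: G.far_cmp')
  then have pr: "far G p \<bullet>\<^bsub>U\<^esub> ?r = idn U (fob G ?s)"
    unfolding k(4) using m by (simp add: triangle_G)
  have "far G p \<bullet>\<^bsub>U\<^esub> ?r \<bullet>\<^bsub>U\<^esub> far G p = (far G p \<bullet>\<^bsub>U\<^esub> ?r) \<bullet>\<^bsub>U\<^esub> far G p"
    using r ty by (simp del: U.cmp_simps)
  also have "\<dots> = far G p \<bullet>\<^bsub>U\<^esub> idn U (fob G (Dom V p))"
    unfolding pr using ty by simp
  finally have "?r \<bullet>\<^bsub>U\<^esub> far G p = idn U (fob G (Dom V p))"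
    by (rule U.monicD[OF far_G_monic[OF pmono]]) (use k(1-3) ty m in simp_all)
  then have "iso U (far G p)"
    unfolding iso_def inverse_arrows_def using pr r ty by (intro exI[of _ ?r]) simp
  then have iso: "iso V p" using G ty unfolding conservative_def by blast
  have "n \<bullet>\<^bsub>V\<^esub> q \<bullet>\<^bsub>V\<^esub> inv_ar V p = (n \<bullet>\<^bsub>V\<^esub> q) \<bullet>\<^bsub>V\<^esub> inv_ar V p"
    using ty n' by (simp add: V.inv_ar_simps[OF iso])
  also have "\<dots> = m"
    unfolding sq[symmetric] using ty m by (simp add: V.inv_ar_simps[OF iso])
  finally show ?thesis
    by (rule factorsI[rotated 3]) (use ty n' in \<open>simp_all add: V.inv_ar_simps[OF iso]\<close>)
qed

end

section \<open>Transport of sieves and coverages\<close>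

definition sieve_class :: "('o, 'a, 'm) smcc_scheme \<Rightarrow> ('c, 'o, 'a) vcat \<Rightarrow> 'c \<Rightarrow> ('c, 'o, 'a) presheaf_mono
     \<Rightarrow> ('c, 'o, 'a) presheaf_mono set" where
  "sieve_class W Y x r = {s. mono_equiv W Y x r s}"

lemma mem_sieves_iff: "R \<in> sieves W Y x \<longleftrightarrow> (\<exists>r. mono_into_rep W Y x r \<and> R = sieve_class W Y x r)"
  by (auto simp: sieves_def sieve_class_def)

abbreviation identity_mono where
  "identity_mono W Y x \<equiv> (representable W Y x, \<lambda>y. nam W (vHom Y x y) (vHom Y x y) (idn W (vHom Y x y)))"

lemma maximal_sieve_eq: "maximal_sieve W Y x = sieve_class W Y x (identity_mono W Y x)"
  by (simp add: maximal_sieve_def sieve_class_def)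

context symmetric_monoidal_closed_category
begin

lemma sieve_class_eq_iff:
  assumes "vcategory V Y" "x \<in> vOb Y" "mono_into_rep V Y x r" "mono_into_rep V Y x s"
  shows "sieve_class V Y x r = sieve_class V Y x s \<longleftrightarrow> mono_equiv V Y x r s"
  unfolding sieve_class_def
  using mono_equiv_refl[OF assms(1,2,4)] mono_equiv_sym[OF assms(1,2)] mono_equiv_trans[OF assms(1,2)] by blast

lemma sieve_representative:
  assumes "vcategory V Y" "x \<in> vOb Y" "R \<in> sieves V Y x"
  obtains r where "r \<in> R"
    and "\<And>s. s \<in> R \<Longrightarrow> mono_into_rep V Y x s \<and> R = sieve_class V Y x s"
proof -
  obtain r where r: "mono_into_rep V Y x r" "R = sieve_class V Y x r"
    using assms(3) by (auto simp: mem_sieves_iff)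
  have "r \<in> R" using r mono_equiv_refl[OF assms(1,2)] by (simp add: sieve_class_def)
  moreover have "mono_into_rep V Y x s \<and> R = sieve_class V Y x s" if s: "s \<in> R" for s
  proof -
    have e: "mono_equiv V Y x r s" using s r(2) by (simp add: sieve_class_def)
    then have "mono_into_rep V Y x s" by (simp add: mono_equiv_iff[OF assms(1,2)])
    then show ?thesis using e r sieve_class_eq_iff[OF assms(1,2)] by simp
  qed
  ultimately show ?thesis using that by blast
qed

lemma incl_identity_mono:
  assumes "vcategory V Y" "x \<in> vOb Y" "y \<in> vOb Y"
  shows "incl V Y x (identity_mono V Y x) y = idn V (vHom Y x y)"
  using assms(2,3) by (simp add: incl_def vcategory_typing[OF assms(1)])

lemma identity_mono_into_rep:
  assumes Y: "vcategory V Y" and x: "x \<in> vOb Y"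
  shows "mono_into_rep V Y x (identity_mono V Y x)"
  unfolding mono_into_rep_iff[OF Y x]
  using x by (auto simp: representable_vfunctor[OF Y x] incl_identity_mono[OF Y x] vcategory_typing[OF Y]
      intertwines_def representable_act[OF Y x] monic_def)

text \<open>
  A restriction is unique up to isomorphism of subobjects, and it does not depend on the representative;
  so the pullback of a sieve is the class of any one restriction.
\<close>

lemma pullback_sieve_class:
  assumes Y: "vcategory V Y" and x: "x \<in> vOb Y" and y: "y \<in> vOb Y"
    and f: "f \<in> Hom V v (vHom Y x y)"
    and s: "mono_into_rep V Y x s" and p: "mono_into_rep V Y y p" and r: "restricts V Y x y f s p"
  shows "pullback_sieve V Y x y v f (sieve_class V Y x s) = sieve_class V Y y p"
proof -
  have R: "\<forall>s' \<in> sieve_class V Y x s. mono_into_rep V Y x s'"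
    by (simp add: sieve_class_def mono_equiv_iff[OF Y x])
  have "p' \<in> pullback_sieve V Y x y v f (sieve_class V Y x s) \<longleftrightarrow> mono_equiv V Y y p p'" for p'
    unfolding mem_pullback_sieve_iff[OF Y x y f R]
  proof
    assume "mono_into_rep V Y y p' \<and> (\<exists>s' \<in> sieve_class V Y x s. restricts V Y x y f s' p')"
    then obtain s' where p': "mono_into_rep V Y y p'" and s': "mono_equiv V Y x s s'" "restricts V Y x y f s' p'"
      by (auto simp: sieve_class_def)
    have "restricts V Y x y f s' p"
      by (rule restricts_cong[OF Y x y s'(1) mono_equiv_refl[OF Y y p] r])
    then show "mono_equiv V Y y p p'" by (rule restricts_unique[OF Y y p p' _ s'(2)])
  next
    assume e: "mono_equiv V Y y p p'"
    have "restricts V Y x y f s p'"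
      by (rule restricts_cong[OF Y x y mono_equiv_refl[OF Y x s] e r])
    then show "mono_into_rep V Y y p' \<and> (\<exists>s' \<in> sieve_class V Y x s. restricts V Y x y f s' p')"
      using e mono_equiv_refl[OF Y x s] unfolding sieve_class_def mono_equiv_iff[OF Y y] by blast
  qed
  then show ?thesis by (auto simp: sieve_class_def)
qed

end

text \<open>
  A coverage contains the maximal sieves, and representatives of sieves are functors on \<open>Y\<close>. For
  \<open>Y = vop V C\<close> this yields the category laws of the opposite without a calculation with symmetries.
\<close>

lemma coverage_vcategory:
  assumes "J \<in> coverages W \<G> Y" "x \<in> vOb Y"
  shows "vcategory W Y"
proof -
  have "maximal_sieve W Y x \<in> sieves W Y x" using assms by (auto simp: coverages_def)
  then obtain R m where "vfunctor W Y (self_enriched W) R" by (auto simp: mem_sieves_iff mono_into_rep_def)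
  then show ?thesis by (simp add: vfunctor_def)
qed

context closed_monoidal_adjunction
begin

lemma tilde_mono_equiv:
  assumes Y: "vcategory V Y" and x: "x \<in> vOb Y" and e: "mono_equiv V Y x r s"
  shows "mono_equiv U (base_change U G Y) x (tilde_mono U V F G \<eta> \<epsilon> Y x r) (tilde_mono U V F G \<eta> \<epsilon> Y x s)"
proof -
  have r: "mono_into_rep V Y x r" and s: "mono_into_rep V Y x s" using e by (simp_all add: V.mono_equiv_iff[OF Y x])
  have GY: "vcategory U (base_change U G Y)" by (rule base_change_vcategory[OF G.lax_monoidal_functor_axioms Y])
  have *: "factors U (far G m) (far G n)" if mn: "factors V m n" "n \<in> Ar V" for m n
  proof -
    obtain h where h: "h \<in> Ar V" "Dom V h = Dom V m" "Cod V h = Dom V n" "n \<bullet>\<^bsub>V\<^esub> h = m" using mn(1) by (rule factorsE)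
    have "n \<bullet>\<^bsub>V\<^esub> h \<in> Ar V" using mn(2) h(1,3) by simp
    then have "m \<in> Ar V" unfolding h(4) .
    moreover have "far G n \<bullet>\<^bsub>U\<^esub> far G h = far G m"
      unfolding h(4)[symmetric] using h(1,3) mn(2) by (simp add: G.far_cmp')
    ultimately show ?thesis
      using h(1-3) mn(2) by (intro factorsI[of "far G h"]) simp_all
  qed
  show ?thesis
    using e x by (simp add: U.mono_equiv_iff[OF GY] V.mono_equiv_iff[OF Y x] tilde_mono_into_rep[OF Y x] r s
        incl_tilde_mono[OF Y x] * V.incl_simps(1)[OF Y x])
qed

lemma tilde_sieve_class:
  assumes Y: "vcategory V Y" and x: "x \<in> vOb Y" and r: "mono_into_rep V Y x r"
  shows "tilde_sieve U V F G \<eta> \<epsilon> Y x (sieve_class V Y x r) =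
    sieve_class U (base_change U G Y) x (tilde_mono U V F G \<eta> \<epsilon> Y x r)"
proof -
  have GY: "vcategory U (base_change U G Y)" by (rule base_change_vcategory[OF G.lax_monoidal_functor_axioms Y])
  have Gx: "x \<in> vOb (base_change U G Y)" using x by simp
  have "tilde_sieve U V F G \<eta> \<epsilon> Y x (sieve_class V Y x r) =
     {t. \<exists>s. mono_equiv V Y x r s \<and> mono_equiv U (base_change U G Y) x (tilde_mono U V F G \<eta> \<epsilon> Y x s) t}"
    by (auto simp: tilde_sieve_def sieve_class_def tilde_mono_def)
  also have "\<dots> = sieve_class U (base_change U G Y) x (tilde_mono U V F G \<eta> \<epsilon> Y x r)"
    unfolding sieve_class_def
    using tilde_mono_equiv[OF Y x] V.mono_equiv_refl[OF Y x r] U.mono_equiv_trans[OF GY Gx] by blast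
  finally show ?thesis .
qed

lemma tilde_maximal_sieve:
  assumes Y: "vcategory V Y" and x: "x \<in> vOb Y"
  shows "tilde_sieve U V F G \<eta> \<epsilon> Y x (maximal_sieve V Y x) = maximal_sieve U (base_change U G Y) x"
proof -
  let ?GY = "base_change U G Y"
  have GY: "vcategory U ?GY" by (rule base_change_vcategory[OF G.lax_monoidal_functor_axioms Y])
  have Gx: "x \<in> vOb ?GY" using x by simp
  note m = V.identity_mono_into_rep[OF Y x] and mG = U.identity_mono_into_rep[OF GY Gx]
  have "mono_equiv U ?GY x (tilde_mono U V F G \<eta> \<epsilon> Y x (identity_mono V Y x)) (identity_mono U ?GY x)"
    unfolding U.mono_equiv_iff[OF GY Gx]
  proof (intro conjI ballI tilde_mono_into_rep[OF Y x m] mG)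
    fix y assume "y \<in> vOb ?GY"
    then have y: "y \<in> vOb Y" "y \<in> vOb ?GY" by simp_all
    have "incl U ?GY x (tilde_mono U V F G \<eta> \<epsilon> Y x (identity_mono V Y x)) y = incl U ?GY x (identity_mono U ?GY x) y"
      unfolding incl_tilde_mono[OF Y x m y(1)] V.incl_identity_mono[OF Y x y(1)] U.incl_identity_mono[OF GY Gx y(2)]
      using x y by (simp add: V.vcategory_typing[OF Y])
    then show "factors U (incl U ?GY x (tilde_mono U V F G \<eta> \<epsilon> Y x (identity_mono V Y x)) y) (incl U ?GY x (identity_mono U ?GY x) y)"
      "factors U (incl U ?GY x (identity_mono U ?GY x) y) (incl U ?GY x (tilde_mono U V F G \<eta> \<epsilon> Y x (identity_mono V Y x)) y)"
      using U.factors_refl[OF U.incl_simps(1)[OF GY Gx mG y(2)]] by simp_all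
  qed
  then show ?thesis
    unfolding maximal_sieve_eq tilde_sieve_class[OF Y x m] U.sieve_class_eq_iff[OF GY Gx tilde_mono_into_rep[OF Y x m] mG] .
qed

text \<open>
  The hypothesis that the pullback in \<open>V\<close> is a sieve provides a
  representative of it, that is, a presheaf that realizes the pointwise pullback. A coverage on \<open>Y\<close>
  satisfies it by definition.
\<close>

lemma tilde_pullback_sieve:
  assumes Y: "vcategory V Y" and x: "x \<in> vOb Y" and y: "y \<in> vOb Y"
    and R: "R \<in> sieves V Y x" and f: "f \<in> Hom U g (fob G (vHom Y x y))"
    and P: "pullback_sieve V Y x y (fob F g) (\<epsilon> (vHom Y x y) \<bullet>\<^bsub>V\<^esub> far F f) R \<in> sieves V Y y"
  shows "pullback_sieve U (base_change U G Y) x y g f (tilde_sieve U V F G \<eta> \<epsilon> Y x R) =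
    tilde_sieve U V F G \<eta> \<epsilon> Y y (pullback_sieve V Y x y (fob F g) (\<epsilon> (vHom Y x y) \<bullet>\<^bsub>V\<^esub> far F f) R)"
proof -
  let ?GY = "base_change U G Y" and ?f = "\<epsilon> (vHom Y x y) \<bullet>\<^bsub>V\<^esub> far F f"
  let ?t = "tilde_mono U V F G \<eta> \<epsilon> Y"
  have GY: "vcategory U ?GY" by (rule base_change_vcategory[OF G.lax_monoidal_functor_axioms Y])
  have f': "?f \<in> Hom V (fob F g) (vHom Y x y)" using f x y by (simp add: V.vcategory_typing[OF Y])
  have mR: "mono_into_rep V Y x s" and cR: "R = sieve_class V Y x s" if "s \<in> R" for s
    using V.sieve_representative[OF Y x R] that by metis+
  obtain p where "p \<in> pullback_sieve V Y x y (fob F g) ?f R" using V.sieve_representative[OF Y y P] by metis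
  then obtain s where p: "mono_into_rep V Y y p" and s: "s \<in> R" and r: "restricts V Y x y ?f s p"
    using V.mem_pullback_sieve_iff[OF Y x y f', of R p] mR by blast
  have "restricts U ?GY x y f (?t x s) (?t y p)"
    by (rule tilde_restricts[OF Y x y mR[OF s] p _ _ r]) (use f in simp_all)
  then have "pullback_sieve U ?GY x y g f (sieve_class U ?GY x (?t x s)) = sieve_class U ?GY y (?t y p)"
    by (intro U.pullback_sieve_class[OF GY] tilde_mono_into_rep[OF Y] mR[OF s] p) (use x y f in simp_all)
  then show ?thesis
    unfolding cR[OF s] V.pullback_sieve_class[OF Y x y f' mR[OF s] p r] tilde_sieve_class[OF Y x mR[OF s]] tilde_sieve_class[OF Y y p] .
qed

text \<open>
  Equality of transported sieves means mutual factorization of the \<open>G\<close>-images of the inclusions, which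
  is reflected to the inclusions themselves.
\<close>

lemma tilde_sieve_inj:
  assumes "conservative V U G" "regular_category V" and Y: "vcategory V Y" and x: "x \<in> vOb Y"
  shows "inj_on (tilde_sieve U V F G \<eta> \<epsilon> Y x) (sieves V Y x)"
proof (rule inj_onI)
  let ?GY = "base_change U G Y" and ?t = "tilde_mono U V F G \<eta> \<epsilon> Y x"
  have GY: "vcategory U ?GY" by (rule base_change_vcategory[OF G.lax_monoidal_functor_axioms Y])
  have Gx: "x \<in> vOb ?GY" using x by simp
  fix R S assume "R \<in> sieves V Y x" "S \<in> sieves V Y x"
    and eq: "tilde_sieve U V F G \<eta> \<epsilon> Y x R = tilde_sieve U V F G \<eta> \<epsilon> Y x S"
  then obtain r s where r: "mono_into_rep V Y x r" "R = sieve_class V Y x r" and s: "mono_into_rep V Y x s" "S = sieve_class V Y x s"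
    by (auto simp: mem_sieves_iff)
  have "mono_equiv U ?GY x (?t r) (?t s)"
    using eq unfolding r(2) s(2) tilde_sieve_class[OF Y x r(1)] tilde_sieve_class[OF Y x s(1)]
    by (subst (asm) U.sieve_class_eq_iff[OF GY Gx]) (rule tilde_mono_into_rep[OF Y x] r(1) s(1))+
  then have f: "factors U (far G (incl V Y x r y)) (far G (incl V Y x s y))" "factors U (far G (incl V Y x s y)) (far G (incl V Y x r y))"
    if "y \<in> vOb Y" for y
    using that unfolding U.mono_equiv_iff[OF GY Gx] by (simp_all add: incl_tilde_mono[OF Y x] r(1) s(1))
  have "mono_equiv V Y x r s"
    unfolding V.mono_equiv_iff[OF Y x]
  proof (intro conjI ballI r(1) s(1))
    fix y assume y: "y \<in> vOb Y"
    show "factors V (incl V Y x r y) (incl V Y x s y)" "factors V (incl V Y x s y) (incl V Y x r y)"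
      by (intro conservative_reflects_factors[OF assms(1,2)] f y;
          simp add: V.incl_simps[OF Y x _ y] V.incl_monic[OF Y x _ y] r(1) s(1))+
  qed
  then show "R = S" unfolding r(2) s(2) V.sieve_class_eq_iff[OF Y x r(1) s(1)] .
qed

text \<open>
  Stability under pullback along \<open>f : g \<rightarrow> G Y(x,y)\<close> with \<open>g \<in> \<G>\<close> is inherited from stability of \<open>J\<close> along the
  transpose of \<open>f\<close>, whose domain \<open>F g\<close> belongs to the generating family of \<open>V\<close>.
\<close>

lemma tilde_coverage_mem:
  assumes J: "J \<in> coverages V (fob F ` \<G>) Y"
  shows "tilde_coverage U V F G \<eta> \<epsilon> Y J \<in> coverages U \<G> (base_change U G Y)"
proof -
  let ?GY = "base_change U G Y" and ?t = "tilde_sieve U V F G \<eta> \<epsilon> Y"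
  have Y: "vcategory V Y" if "x \<in> vOb Y" for x using coverage_vcategory[OF J that] .
  have sub: "J x \<subseteq> sieves V Y x" "maximal_sieve V Y x \<in> J x" if "x \<in> vOb Y" for x
    using J that by (auto simp: coverages_def)
  have pull: "pullback_sieve V Y x y (fob F g) f R \<in> J y"
    if "x \<in> vOb Y" "y \<in> vOb Y" "R \<in> J x" "g \<in> \<G>" "f \<in> Hom V (fob F g) (vHom Y x y)" for x y R g f
    using J that unfolding coverages_def by blast
  have "tilde_coverage U V F G \<eta> \<epsilon> Y J \<in> (\<Pi>\<^sub>E x \<in> vOb ?GY. Pow (sieves U ?GY x))"
  proof (rule PiE_I)
    fix x assume "x \<in> vOb ?GY"
    then have x: "x \<in> vOb Y" by simp
    have "?t x R \<in> sieves U ?GY x" if R: "R \<in> J x" for R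
    proof -
      have "R \<in> sieves V Y x" using sub x R by blast
      then obtain r where r: "mono_into_rep V Y x r" "R = sieve_class V Y x r" by (auto simp: mem_sieves_iff)
      show ?thesis unfolding r(2) tilde_sieve_class[OF Y[OF x] x r(1)]
        unfolding mem_sieves_iff using tilde_mono_into_rep[OF Y[OF x] x r(1)] by blast
    qed
    then show "tilde_coverage U V F G \<eta> \<epsilon> Y J x \<in> Pow (sieves U ?GY x)" using x by (auto simp: tilde_coverage_def)
  qed (simp add: tilde_coverage_def)
  moreover have "maximal_sieve U ?GY x \<in> tilde_coverage U V F G \<eta> \<epsilon> Y J x" if "x \<in> vOb ?GY" for x
  proof -
    have x: "x \<in> vOb Y" using that by simp
    have "?t x (maximal_sieve V Y x) \<in> ?t x ` J x" using sub(2)[OF x] by blast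
    then show ?thesis using x by (simp add: tilde_coverage_def tilde_maximal_sieve[OF Y[OF x] x])
  qed
  moreover have "pullback_sieve U ?GY x y g f S \<in> tilde_coverage U V F G \<eta> \<epsilon> Y J y"
    if xy: "x \<in> vOb ?GY" "y \<in> vOb ?GY" and S: "S \<in> tilde_coverage U V F G \<eta> \<epsilon> Y J x"
      and g: "g \<in> \<G>" and f: "f \<in> Hom U g (vHom ?GY x y)" for x y S g f
  proof -
    have x: "x \<in> vOb Y" and y: "y \<in> vOb Y" using xy by simp_all
    obtain R where R: "R \<in> J x" and SR: "S = ?t x R" using S x by (auto simp: tilde_coverage_def)
    let ?P = "pullback_sieve V Y x y (fob F g) (\<epsilon> (vHom Y x y) \<bullet>\<^bsub>V\<^esub> far F f) R"
    have P: "?P \<in> J y" by (rule pull[OF x y R g]) (use f x y in \<open>simp add: V.vcategory_typing[OF Y[OF x]]\<close>)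
    have "pullback_sieve U ?GY x y g f S = ?t y ?P"
      unfolding SR by (rule tilde_pullback_sieve[OF Y[OF x] x y]) (use P R sub x y f in auto)
    then show ?thesis using P y by (simp add: tilde_coverage_def)
  qed
  ultimately show ?thesis unfolding coverages_def by blast
qed

end

section \<open>The lattice of coverages\<close>

definition pointwise :: "('x set \<Rightarrow> 'x set \<Rightarrow> 'x set) \<Rightarrow> 'c set \<Rightarrow> ('c \<Rightarrow> 'x set) \<Rightarrow> ('c \<Rightarrow> 'x set) \<Rightarrow> 'c \<Rightarrow> 'x set" where
  "pointwise op A J K = (\<lambda>x \<in> A. op (J x) (K x))"

text \<open>
  Both axioms of a coverage make an assertion about one sieve at a time, so they survive unions as
  well as intersections. Joins in the lattice of coverages are thus computed pointwise, too.
\<close>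

lemma coverages_pointwise:
  assumes "J \<in> coverages W \<G> Y" "K \<in> coverages W \<G> Y"
  shows "pointwise (\<union>) (vOb Y) J K \<in> coverages W \<G> Y" "pointwise (\<inter>) (vOb Y) J K \<in> coverages W \<G> Y"
proof -
  have "J x \<subseteq> sieves W Y x \<and> K x \<subseteq> sieves W Y x" if "x \<in> vOb Y" for x
    using assms that by (auto simp: coverages_def)
  then have "pointwise (\<union>) (vOb Y) J K \<in> (\<Pi>\<^sub>E x \<in> vOb Y. Pow (sieves W Y x))"
    "pointwise (\<inter>) (vOb Y) J K \<in> (\<Pi>\<^sub>E x \<in> vOb Y. Pow (sieves W Y x))"
    by (auto simp: pointwise_def)
  then show "pointwise (\<union>) (vOb Y) J K \<in> coverages W \<G> Y" "pointwise (\<inter>) (vOb Y) J K \<in> coverages W \<G> Y"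
    using assms unfolding coverages_def by (simp_all add: pointwise_def) blast+
qed

lemma partial_order_coverage_order: "partial_order (coverage_order W \<G> Y)"
proof
  fix J K assume JK: "J \<in> carrier (coverage_order W \<G> Y)" "K \<in> carrier (coverage_order W \<G> Y)"
    "J \<sqsubseteq>\<^bsub>coverage_order W \<G> Y\<^esub> K" "K \<sqsubseteq>\<^bsub>coverage_order W \<G> Y\<^esub> J"
  then have "J x = K x" if "x \<in> vOb Y" for x using that by (auto simp: coverage_order_def)
  then have "J = K" using JK(1,2) by (auto simp: coverage_order_def coverages_def intro: PiE_ext)
  then show "J .=\<^bsub>coverage_order W \<G> Y\<^esub> K" by (simp add: coverage_order_def)
qed (auto simp: coverage_order_def)

lemma coverage_least_upper:
  assumes "J \<in> coverages W \<G> Y" "K \<in> coverages W \<G> Y"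
  shows "least (coverage_order W \<G> Y) (pointwise (\<union>) (vOb Y) J K) (Upper (coverage_order W \<G> Y) {J, K})"
  using assms coverages_pointwise(1)[OF assms]
  unfolding least_def Upper_def coverage_order_def by (auto simp: pointwise_def)

lemma coverage_greatest_lower:
  assumes "J \<in> coverages W \<G> Y" "K \<in> coverages W \<G> Y"
  shows "greatest (coverage_order W \<G> Y) (pointwise (\<inter>) (vOb Y) J K) (Lower (coverage_order W \<G> Y) {J, K})"
  using assms coverages_pointwise(2)[OF assms]
  unfolding greatest_def Lower_def coverage_order_def by (auto simp: pointwise_def)

lemma lattice_coverage_order: "lattice (coverage_order W \<G> Y)"
proof -
  interpret partial_order "coverage_order W \<G> Y" by (rule partial_order_coverage_order)
  show ?thesis
  proof
    fix J K assume "J \<in> carrier (coverage_order W \<G> Y)" "K \<in> carrier (coverage_order W \<G> Y)"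
    then have JK: "J \<in> coverages W \<G> Y" "K \<in> coverages W \<G> Y" by (simp_all add: coverage_order_def)
    show "\<exists>s. least (coverage_order W \<G> Y) s (Upper (coverage_order W \<G> Y) {J, K})"
      using coverage_least_upper[OF JK] by blast
    show "\<exists>s. greatest (coverage_order W \<G> Y) s (Lower (coverage_order W \<G> Y) {J, K})"
      using coverage_greatest_lower[OF JK] by blast
  qed
qed

lemma coverage_join:
  assumes "J \<in> coverages W \<G> Y" "K \<in> coverages W \<G> Y"
  shows "J \<squnion>\<^bsub>coverage_order W \<G> Y\<^esub> K = pointwise (\<union>) (vOb Y) J K"
proof -
  interpret partial_order "coverage_order W \<G> Y" by (rule partial_order_coverage_order)
  note l = coverage_least_upper[OF assms]
  show ?thesis unfolding join_def sup_def by (rule least_unique[OF someI[of "\<lambda>s. least _ s _", OF l] l])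
qed

lemma coverage_meet:
  assumes "J \<in> coverages W \<G> Y" "K \<in> coverages W \<G> Y"
  shows "J \<sqinter>\<^bsub>coverage_order W \<G> Y\<^esub> K = pointwise (\<inter>) (vOb Y) J K"
proof -
  interpret partial_order "coverage_order W \<G> Y" by (rule partial_order_coverage_order)
  note l = coverage_greatest_lower[OF assms]
  show ?thesis unfolding meet_def inf_def by (rule greatest_unique[OF someI[of "\<lambda>s. greatest _ s _", OF l] l])
qed

theorem theorem4p6:
  fixes U :: "('p, 'b) smcc" and V :: "('o, 'a) smcc"
    and F :: "('p, 'b, 'o, 'a) lax_functr" and G :: "('o, 'a, 'p, 'b) lax_functr"
    and \<eta> :: "'p \<Rightarrow> 'b" and \<epsilon> :: "'o \<Rightarrow> 'a"
    and C :: "('c, 'o, 'a) vcat" and \<G> :: "'p set"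
  defines "\<Sigma>C \<equiv> coverage_order V (fob F ` \<G>) (vop V C)"
    and "\<Sigma>GC \<equiv> coverage_order U \<G> (base_change U G (vop V C))"
    and "Gtilde \<equiv> tilde_coverage U V F G \<eta> \<epsilon> (vop V C)"
  assumes "inaccessible_universe TYPE('s)"
    and "enriching_base TYPE('s) U"
    and "enriching_base TYPE('s) V"
    and "monoidal_adjunction U V F G \<eta> \<epsilon>"
    and "small_vcategory TYPE('s) V C"
    and "fp_generating_family TYPE('s) U \<G>"
    and "faithful V G"
    and "conservative V U G"
  shows "Gtilde \<in> carrier \<Sigma>C \<rightarrow> carrier \<Sigma>GC \<and>
    join_pres \<Sigma>C \<Sigma>GC Gtilde \<and>
    meet_pres \<Sigma>C \<Sigma>GC Gtilde \<and>
    inj_on Gtilde (carrier \<Sigma>C)"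
proof -
  interpret closed_monoidal_adjunction U V F G \<eta> \<epsilon>
    using assms(5-7) by (simp add: closed_monoidal_adjunction_def enriching_base_def)
  have reg: "regular_category V" using assms(6) by (simp add: enriching_base_def)
  let ?Y = "vop V C"
  have carrier: "carrier \<Sigma>C = coverages V (fob F ` \<G>) ?Y" "carrier \<Sigma>GC = coverages U \<G> (base_change U G ?Y)"
    by (simp_all add: \<Sigma>C_def \<Sigma>GC_def coverage_order_def)
  have at: "Gtilde J x = tilde_sieve U V F G \<eta> \<epsilon> ?Y x ` J x" if "x \<in> vOb ?Y" for J x
    using that by (simp add: Gtilde_def tilde_coverage_def)
  have mem: "Gtilde J \<in> carrier \<Sigma>GC" if "J \<in> carrier \<Sigma>C" for J
    using tilde_coverage_mem that unfolding carrier Gtilde_def by blast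
  have inj: "inj_on (tilde_sieve U V F G \<eta> \<epsilon> ?Y x) (sieves V ?Y x)" if "x \<in> vOb ?Y" "J \<in> carrier \<Sigma>C" for x J
    by (rule tilde_sieve_inj[OF assms(11) reg coverage_vcategory[OF that(2)[unfolded carrier] that(1)] that(1)])
  have sub: "J x \<subseteq> sieves V ?Y x" if "x \<in> vOb ?Y" "J \<in> carrier \<Sigma>C" for x J
    using that unfolding carrier by (auto simp: coverages_def)
  have "Gtilde (J \<squnion>\<^bsub>\<Sigma>C\<^esub> K) = Gtilde J \<squnion>\<^bsub>\<Sigma>GC\<^esub> Gtilde K" if JK: "J \<in> carrier \<Sigma>C" "K \<in> carrier \<Sigma>C" for J K
  proof -
    have "Gtilde (J \<squnion>\<^bsub>\<Sigma>C\<^esub> K) = Gtilde (pointwise (\<union>) (vOb ?Y) J K)"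
      by (simp only: \<Sigma>C_def coverage_join[OF JK[unfolded carrier]])
    also have "\<dots> = pointwise (\<union>) (vOb ?Y) (Gtilde J) (Gtilde K)"
      by (auto simp: Gtilde_def tilde_coverage_def pointwise_def fun_eq_iff)
    also have "\<dots> = Gtilde J \<squnion>\<^bsub>\<Sigma>GC\<^esub> Gtilde K"
      by (simp add: \<Sigma>GC_def coverage_join[OF mem[OF JK(1), unfolded carrier] mem[OF JK(2), unfolded carrier]])
    finally show ?thesis .
  qed
  moreover have "Gtilde (J \<sqinter>\<^bsub>\<Sigma>C\<^esub> K) = Gtilde J \<sqinter>\<^bsub>\<Sigma>GC\<^esub> Gtilde K" if JK: "J \<in> carrier \<Sigma>C" "K \<in> carrier \<Sigma>C" for J K
  proof -
    have "Gtilde (J \<sqinter>\<^bsub>\<Sigma>C\<^esub> K) = Gtilde (pointwise (\<inter>) (vOb ?Y) J K)"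
      by (simp only: \<Sigma>C_def coverage_meet[OF JK[unfolded carrier]])
    also have "\<dots> = pointwise (\<inter>) (vOb ?Y) (Gtilde J) (Gtilde K)"
    proof
      fix x show "Gtilde (pointwise (\<inter>) (vOb ?Y) J K) x = pointwise (\<inter>) (vOb ?Y) (Gtilde J) (Gtilde K) x"
      proof (cases "x \<in> vOb ?Y")
        case True
        then show ?thesis using inj_on_image_Int[OF inj[OF True JK(1)] sub[OF True JK(1)] sub[OF True JK(2)]]
          by (simp add: at pointwise_def)
      qed (simp add: Gtilde_def tilde_coverage_def pointwise_def)
    qed
    also have "\<dots> = Gtilde J \<sqinter>\<^bsub>\<Sigma>GC\<^esub> Gtilde K"
      by (simp add: \<Sigma>GC_def coverage_meet[OF mem[OF JK(1), unfolded carrier] mem[OF JK(2), unfolded carrier]])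
    finally show ?thesis .
  qed
  moreover have "inj_on Gtilde (carrier \<Sigma>C)"
  proof (rule inj_onI)
    fix J K assume JK: "J \<in> carrier \<Sigma>C" "K \<in> carrier \<Sigma>C" and eq: "Gtilde J = Gtilde K"
    have "J x = K x" if x: "x \<in> vOb ?Y" for x
      using fun_cong[OF eq, of x] inj_on_image_eq_iff[OF inj[OF x JK(1)] sub[OF x JK(1)] sub[OF x JK(2)]]
      by (simp add: at[OF x])
    then show "J = K" using JK unfolding carrier coverages_def by (auto intro: PiE_ext)
  qed
  ultimately show ?thesis
    using mem unfolding join_pres_def meet_pres_def by (simp add: \<Sigma>C_def \<Sigma>GC_def lattice_coverage_order)
qed

end
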